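(* Let $\varphi:[B(\mathcal H)^n]_1\to[B(\mathcal H)^n]_1$ be a free holomorphic function such that its scalar representation has no fixed points in $\mathbb B_n$. Then there is a unique point $\zeta\in\partial\mathbb B_n$ such that each noncommutative ellipsoid ${\bf E}_c(\zeta)$, $c\in(0,1)$, is mapped into itself by every iterate of $\varphi$.
   Context: $n\ge1$; $\mathcal H$ is a separable infinite dimensional complex Hilbert space. $\mathbb F_n^+$ is the free semigroup with generators $g_1,\ldots,g_n$ and identity $g_0$; $|g_0|=0$, $|\alpha|=k$ if $\alpha=g_{i_1}\cdots g_{i_k}$; $X_\alpha:=X_{i_1}\cdots X_{i_k}$, $X_{g_0}:=I$. $[B(\mathcal H)^n]_1:=\{(X_1,\ldots,X_n)\in B(\mathcal H)^n:\ \|X_1X_1^*+\cdots+X_nX_n^*\|^{1/2}<1\}$. A free holomorphic function $f:[B(\mathcal H)^n]_1\to B(\mathcal H)$ is a map $f(X)=\sum_{k=0}^\infty\sum_{|\alpha|=k}a_\alpha X_\alpha$ (series over $k$ converging in operator norm) with $a_\alpha\in\mathbb C$ and $\limsup_{k\to\infty}(\sum_{|\alpha|=k}|a_\alpha|^2)^{1/2k}\le1$; $\varphi=(\varphi_1,\ldots,\varphi_n)$ is free holomorphic if each $\varphi_i$ is. $\mathbb B_n$ is the open Euclidean unit ball of $\mathbb C^n$; identifying $\lambda\in\mathbb B_n$ with $(\lambda_1I,\ldots,\lambda_nI)$, the scalar representation of $\varphi$ is the holomorphic map $\mathbb B_n\ni\lambda\mapsto\varphi(\lambda)\in\mathbb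 B_n$. Iterates are $\varphi^{[k]}=\varphi\circ\cdots\circ\varphi$ ($k$ times). For self-adjoint operators $A,B$ write $A<B$ if $B-A$ is positive and invertible. For $0<c<1$ and $\xi_1=(1,0,\ldots,0)$, the noncommutative ellipsoid with center $(1-c)\xi_1$ and containing $\xi_1$ in its boundary is $${\bf E}_c(\xi_1):=\left\{(X_1,\ldots,X_n)\in B(\mathcal H)^n:\ \frac{[X_1-(1-c)I][X_1^*-(1-c)I]}{c^2}+\frac{X_2X_2^*}{c}+\cdots+\frac{X_nX_n^*}{c}<I\right\}.$$ Equivalently, $X\in{\bf E}_c(\xi_1)$ iff $(I-X_1)(I-X_1^* )<\frac{c}{1-c}(I-\sum_iX_iX_i^* )$. For general $\zeta\in\partial\mathbb B_n$, ${\bf E}_c(\zeta)$ is defined in a similar manner, by rotation: ${\bf E}_c(\zeta)=\{[X_1,\ldots,X_n]U:\ X\in{\bf E}_c(\xi_1)\}$ where $U$ is any unitary $n\times n$ scalar matrix with $\xi_1U=\zeta$; equivalently, $X\in{\bf E}_c(\zeta)$ iff $(I-\sum_i\overline{\zeta}_iX_i)(I-\sum_i\overline{\zeta}_iX_i)^*<\frac{c}{1-c}(I-\sum_iX_iX_i^* )$. *)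

theory Defs
  imports "HOL-Analysis.Analysis"
begin

section \<open>Complex Hilbert spaces\<close>

text \<open>The inner product is linear in the first argument.\<close>

class complex_hilbert = banach +
  fixes scaleC :: "complex \<Rightarrow> 'a \<Rightarrow> 'a" (infixr \<open>*\<^sub>C\<close> 75)
    and cinner :: "'a \<Rightarrow> 'a \<Rightarrow> complex"
  assumes scaleC_add_right: "a *\<^sub>C (x + y) = a *\<^sub>C x + a *\<^sub>C y"
    and scaleC_add_left: "(a + b) *\<^sub>C x = a *\<^sub>C x + b *\<^sub>C x"
    and scaleC_scaleC: "a *\<^sub>C b *\<^sub>C x = (a * b) *\<^sub>C x"
    and scaleC_of_real: "complex_of_real r *\<^sub>C x = r *\<^sub>R x"
    and cinner_commute: "cinner x y = cnj (cinner y x)"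
    and cinner_add_left: "cinner (x + y) z = cinner x z + cinner y z"
    and cinner_scaleC_left: "cinner (a *\<^sub>C x) y = a * cinner x y"
    and cinner_self: "cinner x x = complex_of_real ((norm x)\<^sup>2)"

lemma scaleC_one: "1 *\<^sub>C x = (x::'h::complex_hilbert)"
  using scaleC_of_real[of 1 x] by simp

global_interpretation complex_vector: vector_space "scaleC :: complex \<Rightarrow> 'h \<Rightarrow> 'h::complex_hilbert"
  defines cspan = complex_vector.span
  by unfold_locales (simp_all add: scaleC_add_right scaleC_add_left scaleC_scaleC scaleC_one)

lemma norm_scaleC: "norm (a *\<^sub>C x) = cmod a * norm (x::'h::complex_hilbert)"
proof -
  have "cinner (a *\<^sub>C x) (a *\<^sub>C x) = a * cnj (a * cinner x x)"
    by (metis cinner_commute cinner_scaleC_left)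
  also have "\<dots> = a * cnj a * complex_of_real ((norm x)\<^sup>2)"
    by (simp add: cinner_self)
  also have "\<dots> = complex_of_real ((cmod a * norm x)\<^sup>2)"
    by (simp add: complex_norm_square [symmetric] power_mult_distrib)
  finally have "(norm (a *\<^sub>C x))\<^sup>2 = (cmod a * norm x)\<^sup>2"
    unfolding cinner_self of_real_eq_iff .
  then show ?thesis by simp
qed

section \<open>Bounded operators\<close>

text \<open>The library type of bounded linear maps consists of the real-linear ones; \<open>B(H)\<close> is the
  subset of complex-linear ones, with the inherited (operator) norm.\<close>

definition BH :: "('h::complex_hilbert \<Rightarrow>\<^sub>L 'h) set" where
  "BH = {A :: 'h \<Rightarrow>\<^sub>L 'h. \<forall>a x. A (a *\<^sub>C x) = a *\<^sub>C A x}"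

lift_definition op_scaleC :: "complex \<Rightarrow> ('h::complex_hilbert \<Rightarrow>\<^sub>L 'h) \<Rightarrow> ('h \<Rightarrow>\<^sub>L 'h)"
  is "\<lambda>a f x. a *\<^sub>C f x"
proof -
  fix a :: complex and f :: "'h \<Rightarrow> 'h"
  assume f: "bounded_linear f"
  have "bounded_linear (\<lambda>x::'h. a *\<^sub>C x)"
  proof (rule bounded_linear_intro[where K = "cmod a"])
    show "a *\<^sub>C (r *\<^sub>R x) = r *\<^sub>R (a *\<^sub>C x)" for r and x :: 'h
      by (simp flip: scaleC_of_real add: scaleC_scaleC mult.commute)
  qed (simp_all add: scaleC_add_right norm_scaleC mult.commute)
  from bounded_linear_compose[OF this f] show "bounded_linear (\<lambda>x. a *\<^sub>C f x)" .
qed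

definition op_adj :: "('h::complex_hilbert \<Rightarrow>\<^sub>L 'h) \<Rightarrow> ('h \<Rightarrow>\<^sub>L 'h)" where
  "op_adj A = (THE B :: 'h \<Rightarrow>\<^sub>L 'h. \<forall>x y. cinner (A x) y = cinner x (B y))"

definition op_selfadjoint :: "('h::complex_hilbert \<Rightarrow>\<^sub>L 'h) \<Rightarrow> bool" where
  "op_selfadjoint A \<longleftrightarrow> A \<in> BH \<and> op_adj A = A"

definition op_positive :: "('h::complex_hilbert \<Rightarrow>\<^sub>L 'h) \<Rightarrow> bool" where
  "op_positive A \<longleftrightarrow> A \<in> BH \<and> (\<forall>x. cinner (A x) x \<in> \<real>\<^sub>\<ge>\<^sub>0)"

definition op_invertible :: "('h::complex_hilbert \<Rightarrow>\<^sub>L 'h) \<Rightarrow> bool" where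
  "op_invertible A \<longleftrightarrow> (\<exists>B\<in>BH. A o\<^sub>L B = id_blinfun \<and> B o\<^sub>L A = id_blinfun)"

definition op_less :: "('h::complex_hilbert \<Rightarrow>\<^sub>L 'h) \<Rightarrow> ('h \<Rightarrow>\<^sub>L 'h) \<Rightarrow> bool" where
  "op_less A B \<longleftrightarrow>
     op_selfadjoint A \<and> op_selfadjoint B \<and> op_positive (B - A) \<and> op_invertible (B - A)"

section \<open>Operator tuples and free holomorphic functions\<close>

type_synonym ('h, 'n) optuple = "('h \<Rightarrow>\<^sub>L 'h) ^ 'n"

definition nc_ball :: "('h::complex_hilbert, 'n::finite) optuple set" where
  "nc_ball = {X. (\<forall>i. X $ i \<in> BH) \<and> sqrt (norm (\<Sum>i\<in>UNIV. X $ i o\<^sub>L op_adj (X $ i))) < 1}"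

text \<open>The free semigroup on the generators indexed by \<open>'n\<close> is \<open>'n list\<close>, with identity \<open>[]\<close> and
  length \<open>length\<close>.\<close>

primrec word_prod :: "('h::complex_hilbert, 'n::finite) optuple \<Rightarrow> 'n list \<Rightarrow> ('h \<Rightarrow>\<^sub>L 'h)" where
  "word_prod X [] = id_blinfun"
| "word_prod X (i # \<alpha>) = X $ i o\<^sub>L word_prod X \<alpha>"

definition free_holomorphic ::
    "(('h::complex_hilbert, 'n::finite) optuple \<Rightarrow> ('h \<Rightarrow>\<^sub>L 'h)) \<Rightarrow> bool" where
  "free_holomorphic f \<longleftrightarrow>
     (\<exists>a :: 'n list \<Rightarrow> complex.
        limsup (\<lambda>k. ereal (root (2 * k) (\<Sum>\<alpha> | length \<alpha> = k. (cmod (a \<alpha>))\<^sup>2))) \<le> 1 \<and>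
        (\<forall>X\<in>nc_ball. (\<lambda>k. \<Sum>\<alpha> | length \<alpha> = k. op_scaleC (a \<alpha>) (word_prod X \<alpha>)) sums f X))"

definition free_holomorphic_map ::
    "(('h::complex_hilbert, 'n::finite) optuple \<Rightarrow> ('h, 'm::finite) optuple) \<Rightarrow> bool" where
  "free_holomorphic_map \<phi> \<longleftrightarrow> (\<forall>i. free_holomorphic (\<lambda>X. \<phi> X $ i))"

definition scalar_tuple :: "complex ^ 'n \<Rightarrow> ('h::complex_hilbert, 'n::finite) optuple" where
  "scalar_tuple z = (\<chi> i. op_scaleC (z $ i) id_blinfun)"

text \<open>A free holomorphic map sends scalar tuples in the ball to scalar tuples, and the scalars are
  determined because the Hilbert space is nonzero; so the description below is meaningful on the
  open unit ball.\<close>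

definition scalar_rep ::
    "(('h::complex_hilbert, 'n::finite) optuple \<Rightarrow> ('h, 'n) optuple) \<Rightarrow> complex ^ 'n \<Rightarrow> complex ^ 'n"
  where "scalar_rep \<phi> z = (THE w. \<phi> (scalar_tuple z) = scalar_tuple w)"

section \<open>Noncommutative ellipsoids\<close>

text \<open>The linear order on the index type only serves to single out the index \<open>1\<close>.\<close>

definition first_index :: "'n::{finite,linorder}" where
  "first_index = Min UNIV"

definition ellipsoid1 :: "real \<Rightarrow> ('h::complex_hilbert, 'n::{finite,linorder}) optuple set" where
  "ellipsoid1 c =
     {X. (\<forall>i. X $ i \<in> BH) \<and>
         op_less
           (((X $ first_index - (1 - c) *\<^sub>R id_blinfun) o\<^sub>L
             (op_adj (X $ first_index) - (1 - c) *\<^sub>R id_blinfun)) /\<^sub>R c\<^sup>2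
            + (\<Sum>i\<in>UNIV - {first_index}. (X $ i o\<^sub>L op_adj (X $ i)) /\<^sub>R c))
           id_blinfun}"

definition unitary_matrix :: "complex ^ 'n ^ 'n \<Rightarrow> bool" where
  "unitary_matrix U \<longleftrightarrow>
     (let U' = (\<chi> i j. cnj (U $ j $ i)) in U ** U' = mat 1 \<and> U' ** U = mat 1)"

text \<open>The row \<open>[X\<^sub>1, \<dots>, X\<^sub>n]\<close> times a scalar matrix.\<close>

definition tuple_mult ::
    "('h::complex_hilbert, 'n::finite) optuple \<Rightarrow> complex ^ 'n ^ 'n \<Rightarrow> ('h, 'n) optuple" where
  "tuple_mult X U = (\<chi> j. \<Sum>i\<in>UNIV. op_scaleC (U $ i $ j) (X $ i))"

text \<open>The set of \<open>X U\<close> with \<open>X\<close> in \<^term>\<open>ellipsoid1 c\<close> is the same for every unitary \<open>U\<close> whose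
  first row is \<open>\<zeta>\<close>, so the union over all such \<open>U\<close> equals each single rotate.\<close>

definition ellipsoid ::
    "real \<Rightarrow> complex ^ 'n::{finite,linorder} \<Rightarrow> ('h::complex_hilbert, 'n) optuple set" where
  "ellipsoid c \<zeta> =
     {tuple_mult X U | X U. X \<in> ellipsoid1 c \<and> unitary_matrix U \<and> axis first_index 1 v* U = \<zeta>}"

end

theory Submission
  imports Defs
begin

text \<open>Evaluating \<open>\<phi>\<close> at compressed, dilated left shifts shows that its coefficients define a row
  contraction on the full Fock space. Testing this contraction on the Poisson kernel of an operator
  point \<open>X\<close> plus the Szego kernel of a scalar point \<open>\<lambda>\<close> gives a Schwarz--Pick inequality
  between \<open>(X, \<lambda>)\<close> and \<open>(\<phi> X, \<phi> \<lambda>)\<close>. Brouwer's theorem provides fixed points of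
  \<open>r \<phi>\<close> in the scalar ball; as \<open>r\<close> tends to 1 they accumulate at a boundary point \<open>\<zeta>\<close>, and
  the limiting inequality is the invariance of the ellipsoids at \<open>\<zeta>\<close>. For two such points,
  mutually tangent scalar ellipsoids meet in a single point by strict convexity, which would then
  be a fixed point in the ball.\<close>

text \<open>The obstacle is strictness: an ellipsoid is cut out by an operator inequality whose
  difference is invertible, and this must survive the limit r -> 1. Strict inequalities are
  therefore rewritten as bounds on quadratic forms with a uniform margin. The limiting inequality
  compares vectors k and h tied by
  \<open>k - adj_comb \<zeta> X k = h - adj_comb \<zeta> (\<phi> X) h\<close>. For such a pair the
  squared terms of the ellipsoid inequality at X and at \<phi> X coincide, and the margin changes
  only through comparing the norms of h and k.

  One point of the Schwarz--Pick inequality is scalar because the fixed points come from Brouwer's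
  theorem in the scalar ball. If r \<phi>(z) = z, then \<phi>(z) = z / r has at least the norm of z,
  so the quotient of 1 - |\<phi>(z)|^2 by 1 - |z|^2 is at most 1. This is why the limit has constant
  1 and each ellipsoid goes into itself rather than into a larger one.

  The Fock space is never built: words of bounded length label a finite orthonormal family in H,
  which infinite dimension supplies, and limits are taken only in the resulting finite
  inequalities.\<close>

section \<open>Calculus of the complex inner product\<close>

lemma cinner_add_right: "cinner x (y + z) = cinner x y + cinner x (z::'h::complex_hilbert)"
  by (metis cinner_add_left cinner_commute complex_cnj_add)

lemma cinner_scaleC_right: "cinner x (a *\<^sub>C y) = cnj a * cinner x (y::'h::complex_hilbert)"
  by (metis cinner_commute cinner_scaleC_left complex_cnj_mult)

lemma cinner_scaleR_left: "cinner (r *\<^sub>R x) y = r *\<^sub>R cinner x (y::'h::complex_hilbert)"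
  by (simp add: cinner_scaleC_left scaleR_conv_of_real flip: scaleC_of_real)

lemma cinner_scaleR_right: "cinner x (r *\<^sub>R y) = r *\<^sub>R cinner x (y::'h::complex_hilbert)"
  by (simp add: cinner_scaleC_right scaleR_conv_of_real flip: scaleC_of_real)

lemma norm_add_scaleC_sq:
  fixes x y :: "'h::complex_hilbert"
  shows "(norm (x + a *\<^sub>C y))\<^sup>2 =
    (norm x)\<^sup>2 + 2 * Re (cnj a * cinner x y) + (cmod a)\<^sup>2 * (norm y)\<^sup>2"
proof -
  have "complex_of_real ((norm (x + a *\<^sub>C y))\<^sup>2) = cinner (x + a *\<^sub>C y) (x + a *\<^sub>C y)"
    by (simp only: cinner_self)
  also have "\<dots> = cinner x x + (cnj a * cinner x y + cnj (cnj a * cinner x y))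
      + (a * cnj a) * cinner y y"
    by (simp add: cinner_add_left cinner_add_right cinner_scaleC_left cinner_scaleC_right
        cinner_commute[of y x] algebra_simps)
  also have "\<dots> = complex_of_real ((norm x)\<^sup>2 + 2 * Re (cnj a * cinner x y)
      + (cmod a)\<^sup>2 * (norm y)\<^sup>2)"
    by (simp only: cinner_self complex_add_cnj complex_norm_square[symmetric] of_real_add of_real_mult)
  finally show ?thesis unfolding of_real_eq_iff .
qed

lemma norm_cinner_le: "cmod (cinner x y) \<le> norm x * norm (y::'h::complex_hilbert)"
proof (cases "y = 0")
  case True
  then show ?thesis using cinner_scaleC_right[of x 0 y] by (simp add: complex_vector.scale_zero_left)
next
  case False
  define c where "c = cinner x y"
  define s where "s = (norm y)\<^sup>2"
  have s: "s > 0" using False by (simp add: s_def)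
  have cc: "cnj c * c = of_real ((cmod c)\<^sup>2)" by (metis complex_norm_square mult.commute)
  \<comment> \<open>The coefficient - c / s removes from x its projection on y; what remains of the
    squared norm is the Cauchy--Schwarz gap.\<close>
  have "0 \<le> (norm (x + (- complex_of_real (1 / s) * c) *\<^sub>C y))\<^sup>2" by simp
  also have "\<dots> = (norm x)\<^sup>2 + 2 * (- (1 / s) * (cmod c)\<^sup>2) + (1 / s * cmod c)\<^sup>2 * s"
    unfolding norm_add_scaleC_sq c_def[symmetric] using s
    by (simp add: s_def[symmetric] mult.assoc cc norm_mult norm_divide)
  also have "\<dots> = (norm x)\<^sup>2 - (cmod c)\<^sup>2 / s"
    using s by (simp add: power2_eq_square field_simps)
  finally have "(cmod c)\<^sup>2 \<le> (norm x * norm y)\<^sup>2"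
    using s by (simp add: s_def field_simps power_mult_distrib)
  then show ?thesis unfolding c_def by (rule power2_le_imp_le) simp
qed

interpretation cinner: bounded_bilinear "cinner :: 'h::complex_hilbert \<Rightarrow> 'h \<Rightarrow> complex"
  by unfold_locales
    (auto simp: cinner_add_left cinner_add_right cinner_scaleR_left cinner_scaleR_right
      intro!: exI[of _ 1] norm_cinner_le)

interpretation scaleC: bounded_bilinear "scaleC :: complex \<Rightarrow> 'h::complex_hilbert \<Rightarrow> 'h"
  by unfold_locales
    (auto simp: scaleC_add_left scaleC_add_right norm_scaleC scaleC_scaleC scaleR_conv_of_real
      mult.commute simp flip: scaleC_of_real intro!: exI[of _ 1])

lemma Re_cinner_self: "Re (cinner x x) = (norm (x::'h::complex_hilbert))\<^sup>2"
  by (simp add: cinner_self)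

lemma Re_cinner_commute: "Re (cinner x y) = Re (cinner y (x::'h::complex_hilbert))"
  by (subst cinner_commute) simp

lemma norm_add_sq:
  "(norm (x + y))\<^sup>2 = (norm x)\<^sup>2 + 2 * Re (cinner x y) + (norm (y::'h::complex_hilbert))\<^sup>2"
  using norm_add_scaleC_sq[of x 1 y] by (simp add: scaleC_one)

lemma norm_diff_sq:
  "(norm (x - y))\<^sup>2 = (norm x)\<^sup>2 - 2 * Re (cinner x y) + (norm (y::'h::complex_hilbert))\<^sup>2"
  using norm_add_scaleC_sq[of x "-1" y] by (simp add: scaleC_one scaleC.minus_left)

lemma cinner_ext:
  assumes "\<And>x. cinner x y = cinner x (z::'h::complex_hilbert)"
  shows "y = z"
proof -
  have "cinner (y - z) (y - z) = 0"
    using assms by (simp add: cinner.diff_right)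
  then show ?thesis by (simp add: cinner_self)
qed

subsection \<open>Riesz representation and adjoints\<close>

text \<open>The parallelogram law makes every minimising sequence Cauchy, and completeness gives the
  limit. The minimiser of this functional is the Riesz vector of f.\<close>

lemma minimizer_exists:
  fixes f :: "'h::complex_hilbert \<Rightarrow> real"
  assumes f: "bounded_linear f"
  shows "\<exists>x. \<forall>y. (norm x)\<^sup>2 - 2 * f x \<le> (norm y)\<^sup>2 - 2 * f y"
proof -
  interpret f: bounded_linear f by fact
  define q where "q x = (norm x)\<^sup>2 - 2 * f x" for x
  obtain K where K: "\<And>x. \<bar>f x\<bar> \<le> norm x * K"
    using f.bounded by auto
  have lb: "- K\<^sup>2 \<le> q x" for x
  proof -
    have "0 \<le> (norm x - K)\<^sup>2" by simp
    then show ?thesis using K[of x] by (simp add: q_def power2_eq_square algebra_simps)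
  qed
  define m where "m = Inf (range q)"
  have m: "m \<le> q x" for x
    unfolding m_def by (rule cInf_lower) (auto intro!: bdd_belowI[of _ "- K\<^sup>2"] lb)
  have "\<exists>x. q x < m + 1 / Suc n" for n
    using cInf_lessD[of "range q" "m + 1 / Suc n"] unfolding m_def by force
  then obtain x where x: "\<And>n. q (x n) < m + 1 / Suc n" by metis
  \<comment> \<open>The linear part of \<open>q\<close> cancels, since f at the midpoint is the mean
    of its values; only the parallelogram identity for the norm remains.\<close>
  have par: "(norm (a - b))\<^sup>2 \<le> 2 * (q a + q b - 2 * m)" for a b
  proof -
    have "(norm ((1/2) *\<^sub>R (a + b)))\<^sup>2 = (norm (a + b))\<^sup>2 / 4"
      by (simp add: power_divide)
    moreover have "f ((1/2) *\<^sub>R (a + b)) = (f a + f b) / 2"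
      by (simp only: f.scaleR f.add) simp
    ultimately have "2 * (q a + q b - 2 * q ((1/2) *\<^sub>R (a + b))) = (norm (a - b))\<^sup>2"
      unfolding q_def norm_diff_sq norm_add_sq by argo
    then show ?thesis using m[of "(1/2) *\<^sub>R (a + b)"] by argo
  qed
  have "Cauchy x"
  proof (rule CauchyI)
    fix e :: real assume "e > 0"
    then obtain M where M: "1 / Suc M < e\<^sup>2 / 4"
      by (metis nat_approx_posE zero_less_divide_iff zero_less_numeral zero_less_power)
    have "norm (x i - x j) < e" if "i \<ge> M" "j \<ge> M" for i j
    proof -
      have "1 / Suc i \<le> 1 / Suc M" "1 / Suc j \<le> 1 / Suc M"
        using that by (simp_all add: frac_le)
      then have "(norm (x i - x j))\<^sup>2 < e\<^sup>2"
        using par[of "x i" "x j"] x[of i] x[of j] M by argo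
      then show ?thesis using \<open>e > 0\<close> by (simp add: power_less_imp_less_base)
    qed
    then show "\<exists>M. \<forall>i\<ge>M. \<forall>j\<ge>M. norm (x i - x j) < e" by blast
  qed
  then obtain l where l: "x \<longlonglongrightarrow> l" using Cauchy_convergent_iff convergent_def by blast
  have "(\<lambda>n. q (x n)) \<longlonglongrightarrow> q l"
    unfolding q_def by (intro tendsto_intros l f.tendsto)
  moreover have "(\<lambda>n. m + 1 / Suc n) \<longlonglongrightarrow> m + 0"
    by (intro tendsto_intros LIMSEQ_Suc[OF lim_1_over_n])
  ultimately have "q l \<le> m"
    using x by (intro LIMSEQ_le) (auto intro: less_imp_le)
  then have "\<forall>y. q l \<le> q y" using m order_trans by blast
  then show ?thesis unfolding q_def by blast
qed

text \<open>The directional derivatives at the minimiser vanish, which settles the real parts;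
  complex homogeneity at \<open>\<i> *\<^sub>C x\<close> then settles the imaginary parts.\<close>

lemma riesz_representation:
  fixes f :: "'h::complex_hilbert \<Rightarrow> complex"
  assumes f: "bounded_linear f" and sc: "\<And>a x. f (a *\<^sub>C x) = a * f x"
  obtains y where "\<And>x. f x = cinner x y"
proof -
  interpret f: bounded_linear f by fact
  have "bounded_linear (\<lambda>x. Re (f x))"
    by (rule bounded_linear_compose[OF bounded_linear_Re f])
  then obtain y where y: "\<And>x. (norm y)\<^sup>2 - 2 * Re (f y) \<le> (norm x)\<^sup>2 - 2 * Re (f x)"
    using minimizer_exists by blast
  have Re_eq: "Re (f x) = Re (cinner x y)" for x
  proof -
    define d where "d = Re (cinner x y) - Re (f x)"
    have *: "0 \<le> 2 * t * d + t\<^sup>2 * (norm x)\<^sup>2" for t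
      using y[of "y + t *\<^sub>R x"]
      by (simp add: norm_add_sq f.add f.scaleR cinner.scaleR_right d_def power_mult_distrib
          Re_cinner_commute[of y x] algebra_simps)
    \<comment> \<open>Adding 1 keeps \<open>s\<close> positive at x = 0. At t = - d / s, after
      clearing s^2, the quadratic inequality reads 0 \<le> - d^2 (|x|^2 + 2).\<close>
    define s where "s = (norm x)\<^sup>2 + 1"
    have s: "s > 0" by (simp add: s_def add_nonneg_pos)
    have "0 \<le> s\<^sup>2 * (2 * (- d / s) * d + (- d / s)\<^sup>2 * (norm x)\<^sup>2)"
      using *[of "- d / s"] by simp
    also have "\<dots> = d\<^sup>2 * ((norm x)\<^sup>2 - 2 * s)"
      using s by (simp add: field_simps power2_eq_square)
    also have "\<dots> = - (d\<^sup>2 * (norm x)\<^sup>2) - 2 * d\<^sup>2"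
      by (simp add: s_def algebra_simps)
    finally have "d\<^sup>2 * (norm x)\<^sup>2 + 2 * d\<^sup>2 \<le> 0" by simp
    moreover have "0 \<le> d\<^sup>2 * (norm x)\<^sup>2" by simp
    ultimately have "d\<^sup>2 \<le> 0" by linarith
    then show ?thesis by (simp add: d_def)
  qed
  show thesis
  proof (rule that[of y], rule complex_eqI)
    fix x
    show "Im (f x) = Im (cinner x y)"
      using Re_eq[of "\<i> *\<^sub>C x"] by (simp add: sc cinner_scaleC_left)
  qed (rule Re_eq)
qed

lemma BH_scaleC: "A \<in> BH \<Longrightarrow> A (a *\<^sub>C x) = a *\<^sub>C A x"
  by (simp add: BH_def)

lemma BH_comb:
  "id_blinfun \<in> BH" "A \<in> BH \<Longrightarrow> B \<in> BH \<Longrightarrow> A + B \<in> BH" "A \<in> BH \<Longrightarrow> B \<in> BH \<Longrightarrow> A - B \<in> BH"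
  "A \<in> BH \<Longrightarrow> B \<in> BH \<Longrightarrow> A o\<^sub>L B \<in> BH" "A \<in> BH \<Longrightarrow> r *\<^sub>R A \<in> BH" "A \<in> BH \<Longrightarrow> op_scaleC a A \<in> BH"
  by (auto simp: BH_def blinfun.add_left blinfun.diff_left blinfun.scaleR_left scaleC_add_right
      scaleC.diff_right op_scaleC.rep_eq scaleC_scaleC mult.commute simp flip: scaleC_of_real)

lemma BH_sum: "(\<And>i. i \<in> I \<Longrightarrow> A i \<in> BH) \<Longrightarrow> sum A I \<in> BH"
proof (induction I rule: infinite_finite_induct)
  case (insert i I)
  then show ?case by (simp add: BH_comb)
qed (auto simp: BH_def)

lemma op_adj_eqI:
  fixes A B :: "'h::complex_hilbert \<Rightarrow>\<^sub>L 'h"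
  assumes "\<And>x y. cinner (A x) y = cinner x (B y)"
  shows "op_adj A = B"
  unfolding op_adj_def
proof (rule the_equality)
  fix C :: "'h \<Rightarrow>\<^sub>L 'h" assume "\<forall>x y. cinner (A x) y = cinner x (C y)"
  then show "C = B" using assms by (intro blinfun_eqI) (metis cinner_ext)
qed (use assms in blast)

lemma adjoint_exists:
  fixes A :: "'h::complex_hilbert \<Rightarrow>\<^sub>L 'h"
  assumes "A \<in> BH"
  obtains B where "B \<in> BH" "\<And>x y. cinner (A x) y = cinner x (blinfun_apply B y)"
proof -
  have "\<exists>z. \<forall>x. cinner (A x) y = cinner x z" for y
  proof -
    have "bounded_linear (\<lambda>x. cinner (A x) y)"
      by (rule bounded_linear_compose[OF cinner.bounded_linear_left blinfun.bounded_linear_right])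
    moreover have "cinner (A (a *\<^sub>C x)) y = a * cinner (A x) y" for a x
      by (simp add: BH_scaleC[OF assms] cinner_scaleC_left)
    ultimately show ?thesis by (rule riesz_representation) blast
  qed
  then obtain b where b: "\<And>x y. cinner (A x) y = cinner x (b y)" by metis
  have bounded: "norm (b y) \<le> norm y * norm A" for y
  proof -
    have "(norm (b y))\<^sup>2 = Re (cinner (A (b y)) y)" by (simp add: b Re_cinner_self)
    also have "\<dots> \<le> norm (A (b y)) * norm y"
      using complex_Re_le_cmod norm_cinner_le order_trans by blast
    also have "\<dots> \<le> norm A * norm (b y) * norm y"
      by (intro mult_right_mono norm_blinfun) simp
    finally have "norm (b y) * norm (b y) \<le> norm (b y) * (norm y * norm A)"
      by (simp add: power2_eq_square algebra_simps)
    then show ?thesis by (cases "b y = 0") auto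
  qed
  have "bounded_linear b"
    by (intro bounded_linear_intro[OF _ _ bounded] cinner_ext)
      (simp_all add: cinner.add_right cinner.scaleR_right flip: b)
  then have B: "blinfun_apply (Blinfun b) = b" by (rule bounded_linear_Blinfun_apply)
  have "b (a *\<^sub>C y) = a *\<^sub>C b y" for a y
    by (rule cinner_ext) (simp add: cinner_scaleC_right flip: b)
  then show thesis using that[of "Blinfun b"] b by (simp add: B BH_def)
qed

lemma
  fixes A :: "'h::complex_hilbert \<Rightarrow>\<^sub>L 'h"
  assumes "A \<in> BH"
  shows op_adj_BH [simp]: "op_adj A \<in> BH"
    and cinner_op_adj: "cinner (blinfun_apply A x) y = cinner x (op_adj A y)"
proof -
  obtain B where B: "B \<in> BH" "\<And>x y. cinner (A x) y = cinner x (blinfun_apply B y)"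
    using adjoint_exists assms by blast
  then have "op_adj A = B" by (intro op_adj_eqI)
  with B show "op_adj A \<in> BH" "cinner (blinfun_apply A x) y = cinner x (op_adj A y)" by auto
qed

lemma cinner_op_adj': "A \<in> BH \<Longrightarrow> cinner (op_adj A x) y = cinner x (blinfun_apply A y)"
  by (metis cinner_commute cinner_op_adj)

lemma op_adj_sandwich: "A \<in> BH \<Longrightarrow> Re (cinner (A (op_adj A x)) x) = (norm (op_adj A x))\<^sup>2"
  by (metis cinner_op_adj Re_cinner_self)

lemma norm_op_adj_le:
  assumes "A \<in> BH"
  shows "norm (op_adj A x) \<le> norm A * norm x"
proof -
  have "(norm (op_adj A x))\<^sup>2 \<le> norm (A (op_adj A x)) * norm x"
    using complex_Re_le_cmod norm_cinner_le order_trans op_adj_sandwich[OF assms] by metis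
  also have "\<dots> \<le> norm A * norm (op_adj A x) * norm x"
    by (intro mult_right_mono norm_blinfun) simp
  finally have "norm (op_adj A x) * norm (op_adj A x) \<le> norm (op_adj A x) * (norm A * norm x)"
    by (simp add: power2_eq_square algebra_simps)
  then show ?thesis by (cases "op_adj A x = 0") auto
qed

subsection \<open>Coercive operators\<close>

text \<open>Lax--Milgram by Banach's theorem: for a small step t the map x -> x - t (A x - w) is a
  contraction, and its fixed point solves A x = w. Coercivity also bounds the inverse by 1 /
  e.\<close>

lemma coercive_invertible:
  fixes A :: "'h::complex_hilbert \<Rightarrow>\<^sub>L 'h"
  assumes A: "A \<in> BH" and e: "e > 0" and coercive: "\<And>x. e * (norm x)\<^sup>2 \<le> Re (cinner (A x) x)"
  shows "op_invertible A"
proof -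
  have below: "e * norm x \<le> norm (A x)" for x
  proof (cases "x = 0")
    case False
    have "e * (norm x)\<^sup>2 \<le> norm (A x) * norm x"
      using coercive[of x] complex_Re_le_cmod norm_cinner_le order_trans by metis
    then have "(e * norm x) * norm x \<le> norm (A x) * norm x"
      by (simp add: power2_eq_square algebra_simps)
    then show ?thesis using False by (simp only: mult_le_cancel_right) simp
  qed auto
  have "\<exists>x. A x = w" for w
  proof -
    \<comment> \<open>With t = e / M the contraction factor squared is 1 - e^2 / M; the summands e^2
      and 1 keep this positive, so its square root can be taken.\<close>
    define M where "M = (norm A)\<^sup>2 + e\<^sup>2 + 1"
    have M: "M > e\<^sup>2" "M > 0" "(norm A)\<^sup>2 \<le> M" using e by (auto simp: M_def add_nonneg_pos)
    define t where "t = e / M"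
    have t: "t > 0" using e M by (simp add: t_def)
    define c where "c = sqrt (1 - e\<^sup>2 / M)"
    have c: "0 \<le> c" "c < 1" using M e by (auto simp: c_def)
    have contr: "norm (x - t *\<^sub>R A x) \<le> c * norm x" for x
    proof -
      have "(norm (x - t *\<^sub>R A x))\<^sup>2 = (norm x)\<^sup>2 - 2 * t * Re (cinner (A x) x) + t\<^sup>2 * (norm (A x))\<^sup>2"
        by (simp add: norm_diff_sq cinner.scaleR_right power_mult_distrib Re_cinner_commute[of x])
      also have "\<dots> \<le> (norm x)\<^sup>2 - 2 * t * (e * (norm x)\<^sup>2) + t\<^sup>2 * (M * (norm x)\<^sup>2)"
      proof -
        have "(norm (A x))\<^sup>2 \<le> (norm A * norm x)\<^sup>2"
          by (intro power_mono norm_blinfun) simp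
        also have "\<dots> \<le> M * (norm x)\<^sup>2"
          unfolding power_mult_distrib by (intro mult_right_mono M) simp
        finally have "t\<^sup>2 * (norm (A x))\<^sup>2 \<le> t\<^sup>2 * (M * (norm x)\<^sup>2)"
          by (intro mult_left_mono) simp_all
        moreover have "2 * t * (e * (norm x)\<^sup>2) \<le> 2 * t * Re (cinner (A x) x)"
          by (intro mult_left_mono coercive) (use t in simp)
        ultimately show ?thesis by linarith
      qed
      also have "\<dots> = (1 - e\<^sup>2 / M) * (norm x)\<^sup>2"
        using M(2) by (simp add: t_def field_simps power2_eq_square)
      also have "\<dots> = (c * norm x)\<^sup>2"
        using M e by (simp add: c_def power_mult_distrib)
      finally show ?thesis by (rule power2_le_imp_le) (use c in simp)
    qed
    have "\<exists>!x. (\<lambda>x. x - t *\<^sub>R (A x - w)) x = x"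
    proof (rule banach_fix_type[OF c])
      show "\<forall>x y. dist (x - t *\<^sub>R (A x - w)) (y - t *\<^sub>R (A y - w)) \<le> c * dist x y"
      proof (intro allI)
        fix x y :: 'h
        have "x - t *\<^sub>R (A x - w) - (y - t *\<^sub>R (A y - w)) = (x - y) - t *\<^sub>R A (x - y)"
          by (simp add: blinfun.diff_right algebra_simps)
        then show "dist (x - t *\<^sub>R (A x - w)) (y - t *\<^sub>R (A y - w)) \<le> c * dist x y"
          using contr[of "x - y"] by (simp only: dist_norm)
      qed
    qed
    then show ?thesis using t by auto
  qed
  then obtain b where b: "\<And>w. A (b w) = w" by metis
  have inj: "x = y" if "A x = A y" for x y
  proof -
    have "e * norm (x - y) \<le> 0" using below[of "x - y"] that by (simp add: blinfun.diff_right)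
    then show ?thesis using e by (simp add: mult_le_0_iff)
  qed
  have "bounded_linear b"
  proof (rule bounded_linear_intro[where K = "1 / e"])
    show "norm (b w) \<le> norm w * (1 / e)" for w
      using below[of "b w"] e by (simp add: b field_simps)
    show "b (x + y) = b x + b y" "b (r *\<^sub>R x) = r *\<^sub>R b x" for x y r
      by (rule inj, simp add: b blinfun.add_right blinfun.scaleR_right)+
  qed
  then have B: "blinfun_apply (Blinfun b) = b" by (rule bounded_linear_Blinfun_apply)
  have "b (a *\<^sub>C y) = a *\<^sub>C b y" for a y
    by (rule inj) (simp add: b BH_scaleC[OF A])
  then have "Blinfun b \<in> BH" by (simp add: B BH_def)
  moreover have "A o\<^sub>L Blinfun b = id_blinfun"
    by (rule blinfun_eqI) (simp add: B b)
  moreover have "Blinfun b o\<^sub>L A = id_blinfun"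
    by (rule blinfun_eqI, rule inj) (simp add: B b)
  ultimately show ?thesis unfolding op_invertible_def by blast
qed

text \<open>Positivity of A is tested at \<open>B x - b *\<^sub>R x\<close>, where A sends B x back
  to x. As b is at least the norm of the inverse B, expanding gives the lower bound 1 / b without
  square roots of operators.\<close>

lemma invertible_coercive:
  fixes A :: "'h::complex_hilbert \<Rightarrow>\<^sub>L 'h"
  assumes pos: "\<And>x. 0 \<le> Re (cinner (A x) x)" and sa: "op_selfadjoint A" and inv: "op_invertible A"
  obtains e where "e > 0" "\<And>x. e * (norm x)\<^sup>2 \<le> Re (cinner (A x) x)"
proof -
  obtain B where AB: "A o\<^sub>L B = id_blinfun" using inv by (auto simp: op_invertible_def)
  have A: "A \<in> BH" and adj: "op_adj A = A" using sa by (auto simp: op_selfadjoint_def)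
  define b where "b = norm B + 1"
  have b: "b > 0" by (simp add: b_def add_nonneg_pos)
  show thesis
  proof (rule that[of "1 / b"])
    fix x
    have ABx: "A (B x) = x" using AB by (metis blinfun_apply_id_blinfun blinfun_apply_blinfun_compose)
    have *: "cinner (A x) (B x) = cinner x x" using cinner_op_adj[OF A, of x] by (simp add: adj ABx)
    have "0 \<le> Re (cinner (A (B x - b *\<^sub>R x)) (B x - b *\<^sub>R x))" by (rule pos)
    also have "\<dots> = Re (cinner x (B x)) - 2 * b * (norm x)\<^sup>2 + b\<^sup>2 * Re (cinner (A x) x)"
      by (simp add: blinfun.diff_right blinfun.scaleR_right cinner.diff_left cinner.diff_right ABx *
          cinner.scaleR_left cinner.scaleR_right Re_cinner_self power2_eq_square algebra_simps)
    also have "Re (cinner x (B x)) \<le> b * (norm x)\<^sup>2"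
    proof -
      have "Re (cinner x (B x)) \<le> norm x * norm (B x)"
        using complex_Re_le_cmod norm_cinner_le order_trans by blast
      also have "\<dots> \<le> norm x * (norm B * norm x)" by (intro mult_left_mono norm_blinfun) simp
      also have "\<dots> \<le> b * (norm x)\<^sup>2" by (simp add: b_def power2_eq_square algebra_simps)
      finally show ?thesis .
    qed
    finally have "b * (norm x)\<^sup>2 \<le> b * (b * Re (cinner (A x) x))"
      by (simp add: power2_eq_square algebra_simps)
    then show "1 / b * (norm x)\<^sup>2 \<le> Re (cinner (A x) x)" using b by (simp add: field_simps)
  qed (use b in simp)
qed

text \<open>For a positive operator, invertibility and a uniform positive lower bound are the same
  thing. The margin \<open>e\<close> is a number that can be tracked through estimates, which
  invertibility is not.\<close>

lemma op_less_iff_coercive: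
  fixes M :: "'h::complex_hilbert \<Rightarrow>\<^sub>L 'h"
  assumes M: "M \<in> BH" and sa: "\<And>x y. cinner (M x) y = cinner x (M y)"
  shows "op_less M id_blinfun \<longleftrightarrow>
    (\<exists>e>0. \<forall>x. Re (cinner (M x) x) + e * (norm x)\<^sup>2 \<le> (norm x)\<^sup>2)"
proof -
  define A where "A = id_blinfun - M"
  have A: "A \<in> BH" by (simp add: A_def BH_comb M)
  have A_sa: "cinner (A x) y = cinner x (A y)" for x y
    by (simp add: A_def blinfun.diff_left cinner.diff_left cinner.diff_right sa)
  have q: "Re (cinner (A x) x) = (norm x)\<^sup>2 - Re (cinner (M x) x)" for x
    by (simp add: A_def blinfun.diff_left cinner.diff_left Re_cinner_self)
  have selfadj: "op_selfadjoint M" "op_selfadjoint (id_blinfun :: 'h \<Rightarrow>\<^sub>L 'h)" "op_selfadjoint A"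
    unfolding op_selfadjoint_def using M A sa A_sa by (auto intro: op_adj_eqI simp: BH_comb)
  have real: "cinner (A x) x \<in> \<real>\<^sub>\<ge>\<^sub>0 \<longleftrightarrow> 0 \<le> Re (cinner (A x) x)" for x
  proof -
    have "cnj (cinner (A x) x) = cinner (A x) x"
      using cinner_commute[of x "A x"] by (simp add: A_sa)
    then have "Im (cinner (A x) x) = 0"
      by (simp add: complex_eq_iff)
    then show ?thesis by (auto simp: complex_nonneg_Reals_iff)
  qed
  have "op_less M id_blinfun \<longleftrightarrow> (\<forall>x. 0 \<le> Re (cinner (A x) x)) \<and> op_invertible A"
    by (simp add: op_less_def selfadj op_positive_def A real flip: A_def)
  also have "\<dots> \<longleftrightarrow> (\<exists>e>0. \<forall>x. e * (norm x)\<^sup>2 \<le> Re (cinner (A x) x))"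
  proof safe
    assume "\<forall>x. 0 \<le> Re (cinner (A x) x)" "op_invertible A"
    then show "\<exists>e>0. \<forall>x. e * (norm x)\<^sup>2 \<le> Re (cinner (A x) x)"
      using invertible_coercive[of A] selfadj(3) by metis
  next
    fix e :: real and x :: 'h
    assume e: "e > 0" "\<forall>x. e * (norm x)\<^sup>2 \<le> Re (cinner (A x) x)"
    have "0 \<le> e * (norm x)\<^sup>2" using e by simp
    then show "0 \<le> Re (cinner (A x) x)" using e(2) order_trans by blast
    show "op_invertible A" using coercive_invertible[OF A e(1)] e(2) by blast
  qed
  finally show ?thesis by (simp add: q algebra_simps)
qed

subsection \<open>Row contractions\<close>

definition row_form :: "('h::complex_hilbert, 'n::finite) optuple \<Rightarrow> 'h \<Rightarrow> real" where
  "row_form X h = (\<Sum>i\<in>UNIV. (norm (op_adj (X $ i) h))\<^sup>2)"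

text \<open>The adjoint of the sum of conj(z_i) X_i. Hence \<open>h - adj_comb \<zeta> X h\<close>
  is the vector whose squared norm is the quadratic form of the left side of the ellipsoid
  inequality.\<close>

definition adj_comb :: "complex ^ 'n \<Rightarrow> ('h::complex_hilbert, 'n::finite) optuple \<Rightarrow> 'h \<Rightarrow> 'h" where
  "adj_comb z X h = (\<Sum>i\<in>UNIV. z $ i *\<^sub>C op_adj (X $ i) h)"

lemma row_form_nonneg: "0 \<le> row_form X h"
  by (simp add: row_form_def sum_nonneg)

lemma bounded_linear_adj_comb: "bounded_linear (adj_comb z X)"
  unfolding adj_comb_def
  by (intro bounded_linear_sum bounded_linear_compose[OF scaleC.bounded_linear_right]
      blinfun.bounded_linear_right)

lemmas adj_comb_diff = linear_diff[OF bounded_linear.linear[OF bounded_linear_adj_comb]]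

lemma op_adj_scaleC: "A \<in> BH \<Longrightarrow> op_adj A (a *\<^sub>C x) = a *\<^sub>C op_adj A x"
  by (rule BH_scaleC[OF op_adj_BH])

lemma adj_comb_scaleC:
  assumes "\<And>i. X $ i \<in> BH"
  shows "adj_comb z X (a *\<^sub>C h) = a *\<^sub>C adj_comb z X h"
  by (simp add: adj_comb_def op_adj_scaleC[OF assms] scaleC_scaleC scaleC.sum_right mult.commute)

lemma row_form_eq:
  assumes "\<And>i. X $ i \<in> BH"
  shows "row_form X h = Re (cinner (blinfun_apply (\<Sum>i\<in>UNIV. X $ i o\<^sub>L op_adj (X $ i)) h) h)"
  by (simp add: row_form_def blinfun.sum_left cinner.sum_left op_adj_sandwich assms)

lemma norm_vec_sq: "(norm (z :: complex ^ 'n::finite))\<^sup>2 = (\<Sum>i\<in>UNIV. (cmod (z $ i))\<^sup>2)"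
  by (simp add: norm_vec_def L2_set_def sum_nonneg)

lemma norm_adj_comb_le: "norm (adj_comb z X h) \<le> norm z * sqrt (row_form X h)"
proof -
  have "norm (adj_comb z X h) \<le> (\<Sum>i\<in>UNIV. cmod (z $ i) * norm (op_adj (X $ i) h))"
    unfolding adj_comb_def by (rule sum_norm_le) (simp add: norm_scaleC)
  also have "\<dots> = (\<Sum>i\<in>UNIV. \<bar>cmod (z $ i)\<bar> * \<bar>norm (op_adj (X $ i) h)\<bar>)" by simp
  also have "\<dots> \<le> L2_set (\<lambda>i. cmod (z $ i)) UNIV * L2_set (\<lambda>i. norm (op_adj (X $ i) h)) UNIV"
    by (rule L2_set_mult_ineq)
  finally show ?thesis by (simp add: norm_vec_def L2_set_def row_form_def)
qed

text \<open>For the backward direction the norm of the positive operator T must be recovered from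
  its quadratic form: |T h|^2 is a sum of products of the components of h and of T h, and
  Cauchy--Schwarz bounds it by the form at h and at T h.\<close>

lemma nc_ball_iff:
  fixes X :: "('h::complex_hilbert, 'n::finite) optuple"
  shows "X \<in> nc_ball \<longleftrightarrow>
    (\<forall>i. X $ i \<in> BH) \<and> (\<exists>r. 0 \<le> r \<and> r < 1 \<and> (\<forall>h. row_form X h \<le> r * (norm h)\<^sup>2))"
proof (cases "\<forall>i. X $ i \<in> BH")
  case True
  then have BH: "X $ i \<in> BH" for i by blast
  define T where "T = (\<Sum>i\<in>UNIV. X $ i o\<^sub>L op_adj (X $ i))"
  have rf: "row_form X h = Re (cinner (T h) h)" for h
    unfolding T_def by (rule row_form_eq[OF BH])
  have "norm T < 1 \<longleftrightarrow> (\<exists>r. 0 \<le> r \<and> r < 1 \<and> (\<forall>h. row_form X h \<le> r * (norm h)\<^sup>2))"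
  proof
    assume *: "norm T < 1"
    have "row_form X h \<le> norm T * (norm h)\<^sup>2" for h
    proof -
      have "row_form X h \<le> norm (T h) * norm h"
        unfolding rf using complex_Re_le_cmod norm_cinner_le order_trans by blast
      also have "\<dots> \<le> norm T * norm h * norm h"
        by (intro mult_right_mono norm_blinfun) simp
      finally show ?thesis by (simp add: power2_eq_square mult.assoc)
    qed
    with * show "\<exists>r. 0 \<le> r \<and> r < 1 \<and> (\<forall>h. row_form X h \<le> r * (norm h)\<^sup>2)"
      by (intro exI[of _ "norm T"]) auto
  next
    assume "\<exists>r. 0 \<le> r \<and> r < 1 \<and> (\<forall>h. row_form X h \<le> r * (norm h)\<^sup>2)"
    then obtain r where r: "0 \<le> r" "r < 1" "\<And>h. row_form X h \<le> r * (norm h)\<^sup>2" by blast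
    have "norm (T h) \<le> r * norm h" for h
    proof -
      have "(norm (T h))\<^sup>2 = (\<Sum>i\<in>UNIV. Re (cinner (op_adj (X $ i) h) (op_adj (X $ i) (T h))))"
      proof -
        have "cinner (T h) (T h) = (\<Sum>i\<in>UNIV. cinner (op_adj (X $ i) h) (op_adj (X $ i) (T h)))"
          by (subst T_def) (simp add: blinfun.sum_left cinner.sum_left cinner_op_adj BH)
        then show ?thesis unfolding Re_cinner_self[symmetric] by (simp only: Re_sum)
      qed
      also have "\<dots> \<le> (\<Sum>i\<in>UNIV. \<bar>norm (op_adj (X $ i) h)\<bar> * \<bar>norm (op_adj (X $ i) (T h))\<bar>)"
        using complex_Re_le_cmod norm_cinner_le order_trans by (intro sum_mono) fastforce
      also have "\<dots> \<le> sqrt (row_form X h) * sqrt (row_form X (T h))"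
        using L2_set_mult_ineq[of "\<lambda>i. norm (op_adj (X $ i) h)" "\<lambda>i. norm (op_adj (X $ i) (T h))" UNIV]
        by (simp add: L2_set_def row_form_def)
      also have "\<dots> \<le> sqrt (r * (norm h)\<^sup>2) * sqrt (r * (norm (T h))\<^sup>2)"
        by (intro mult_mono real_sqrt_le_mono r) (use r row_form_nonneg in auto)
      also have "\<dots> = norm (T h) * (r * norm h)"
        using r by (simp add: real_sqrt_mult)
      finally have "norm (T h) * norm (T h) \<le> norm (T h) * (r * norm h)"
        by (simp add: power2_eq_square)
      then show ?thesis using r by (cases "T h = 0") auto
    qed
    then have "norm T \<le> r" using r by (intro norm_blinfun_bound)
    with r show "norm T < 1" by simp
  qed
  with True show ?thesis unfolding nc_ball_def by (simp add: T_def)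
qed (auto simp: nc_ball_def)

lemma op_adj_scalar: "op_adj (op_scaleC a id_blinfun) = op_scaleC (cnj a) (id_blinfun :: 'h::complex_hilbert \<Rightarrow>\<^sub>L 'h)"
  by (rule op_adj_eqI) (simp add: op_scaleC.rep_eq cinner_scaleC_left cinner_scaleC_right)

lemma row_form_scalar: "row_form (scalar_tuple z) h = (norm z)\<^sup>2 * (norm h)\<^sup>2"
  by (simp add: row_form_def scalar_tuple_def op_adj_scalar op_scaleC.rep_eq norm_scaleC
      power_mult_distrib norm_vec_sq sum_distrib_right)

lemma adj_comb_scalar: "adj_comb w (scalar_tuple z) h = (\<Sum>i\<in>UNIV. w $ i * cnj (z $ i)) *\<^sub>C h"
  by (simp add: adj_comb_def scalar_tuple_def op_adj_scalar op_scaleC.rep_eq scaleC_scaleC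
      scaleC.sum_left)

lemma scalar_tuple_BH: "scalar_tuple z $ i \<in> BH"
  by (simp add: scalar_tuple_def BH_comb)

lemma scalar_tuple_nc_ball_iff:
  fixes z :: "complex ^ 'n::finite"
  assumes "(h0::'h::complex_hilbert) \<noteq> 0"
  shows "(scalar_tuple z :: ('h, 'n) optuple) \<in> nc_ball \<longleftrightarrow> z \<in> ball 0 1"
proof
  assume "(scalar_tuple z :: ('h, 'n) optuple) \<in> nc_ball"
  then obtain r where "r < 1" "(norm z)\<^sup>2 * (norm h0)\<^sup>2 \<le> r * (norm h0)\<^sup>2"
    unfolding nc_ball_iff row_form_scalar by blast
  then have "(norm z)\<^sup>2 < 1" using assms by simp
  then show "z \<in> ball 0 1" by (simp add: power_less_one_iff)
next
  assume "z \<in> ball 0 1"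
  then have "(norm z)\<^sup>2 < 1" by (simp add: power_less_one_iff)
  then show "(scalar_tuple z :: ('h, 'n) optuple) \<in> nc_ball"
    unfolding nc_ball_iff row_form_scalar by (auto simp: scalar_tuple_BH intro!: exI[of _ "(norm z)\<^sup>2"])
qed

subsection \<open>Ellipsoids\<close>

lemma cinner_sandwich_diff:
  fixes A :: "'h::complex_hilbert \<Rightarrow>\<^sub>L 'h"
  assumes "A \<in> BH"
  shows "cinner (((A - r *\<^sub>R id_blinfun) o\<^sub>L (op_adj A - r *\<^sub>R id_blinfun)) x) y =
    cinner (op_adj A x - r *\<^sub>R x) (op_adj A y - r *\<^sub>R y)"
proof -
  have "op_adj (A - r *\<^sub>R id_blinfun) = op_adj A - r *\<^sub>R id_blinfun"
    by (rule op_adj_eqI) (simp add: blinfun.diff_left blinfun.scaleR_left cinner.diff_left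
        cinner.diff_right cinner.scaleR_left cinner.scaleR_right cinner_op_adj assms)
  then show ?thesis
    using cinner_op_adj[of "A - r *\<^sub>R id_blinfun" "op_adj A x - r *\<^sub>R x" y] assms
    by (simp add: BH_comb blinfun.diff_left blinfun.scaleR_left)
qed

text \<open>The second description of the ellipsoid, tested on vectors; \<open>e\<close> records
  that the difference of the two sides is invertible and not merely positive.\<close>

definition ellipsoid_gap ::
    "real \<Rightarrow> complex ^ 'n::finite \<Rightarrow> ('h::complex_hilbert, 'n) optuple \<Rightarrow> bool" where
  "ellipsoid_gap c \<zeta> X \<longleftrightarrow> (\<exists>e>0. \<forall>h. (norm (h - adj_comb \<zeta> X h))\<^sup>2 + e * (norm h)\<^sup>2 \<le>
      c / (1 - c) * ((norm h)\<^sup>2 - row_form X h))"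

text \<open>Multiplication by c^2 / (1 - c) turns one description into the other: expanding the
  square in the first coordinate produces a surplus - c |h|^2, which is absorbed by c^2 / (1 - c) =
  c / (1 - c) - c. The margin is rescaled by the same factor.\<close>

lemma ellipsoid1_iff:
  fixes X :: "('h::complex_hilbert, 'n::{finite,linorder}) optuple"
  assumes c: "0 < c" "c < 1"
  shows "X \<in> ellipsoid1 c \<longleftrightarrow> (\<forall>i. X $ i \<in> BH) \<and> ellipsoid_gap c (axis first_index 1) X"
proof (cases "\<forall>i. X $ i \<in> BH")
  case True
  then have BH: "X $ i \<in> BH" for i by blast
  define M where "M = ((X $ first_index - (1 - c) *\<^sub>R id_blinfun) o\<^sub>L
             (op_adj (X $ first_index) - (1 - c) *\<^sub>R id_blinfun)) /\<^sub>R c\<^sup>2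
            + (\<Sum>i\<in>UNIV - {first_index}. (X $ i o\<^sub>L op_adj (X $ i)) /\<^sub>R c)"
  have M: "cinner (M x) y =
      cinner (op_adj (X $ first_index) x - (1 - c) *\<^sub>R x) (op_adj (X $ first_index) y - (1 - c) *\<^sub>R y) /\<^sub>R c\<^sup>2
      + (\<Sum>i\<in>UNIV - {first_index}. cinner (op_adj (X $ i) x) (op_adj (X $ i) y) /\<^sub>R c)" for x y
    unfolding M_def blinfun.add_left blinfun.scaleR_left blinfun.sum_left cinner.add_left
      cinner.scaleR_left cinner.sum_left cinner_sandwich_diff[OF BH]
    by (simp add: cinner_op_adj BH)
  have M_BH: "M \<in> BH"
    unfolding M_def by (intro BH_comb BH_sum op_adj_BH BH)
  have M_sa: "cinner (M x) y = cinner x (M y)" for x y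
  proof -
    have "cinner (M x) y = cnj (cinner (M y) x)"
      unfolding M complex_cnj_add complex_cnj_scaleR cnj_sum by (simp add: cinner_commute[symmetric])
    then show ?thesis by (metis cinner_commute)
  qed
  have adj_axis: "adj_comb (axis first_index 1) X h = op_adj (X $ first_index) h" for h
  proof -
    have "adj_comb (axis first_index 1) X h =
        (\<Sum>i\<in>UNIV. if i = first_index then op_adj (X $ i) h else 0)"
      unfolding adj_comb_def by (intro sum.cong) (auto simp: axis_def scaleC_one scaleC.zero_left)
    then show ?thesis by simp
  qed
  have scaled: "c\<^sup>2 * Re (cinner (M h) h) / (1 - c) =
      (norm (h - adj_comb (axis first_index 1) X h))\<^sup>2 - c * (norm h)\<^sup>2 + c / (1 - c) * row_form X h"
    (is "?l = ?r") for h
  proof -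
    define u where "u = op_adj (X $ first_index) h"
    have rf: "row_form X h = (norm u)\<^sup>2 + (\<Sum>i\<in>UNIV - {first_index}. (norm (op_adj (X $ i) h))\<^sup>2)"
      unfolding row_form_def u_def by (rule sum.remove) auto
    have M_h: "Re (cinner (M h) h) = (norm (u - (1 - c) *\<^sub>R h))\<^sup>2 / c\<^sup>2 + (row_form X h - (norm u)\<^sup>2) / c"
      unfolding M rf u_def[symmetric]
      by (simp add: Re_cinner_self divide_inverse mult.commute flip: sum_distrib_left)
    have u_sq: "(norm (u - (1 - c) *\<^sub>R h))\<^sup>2 =
        (norm u)\<^sup>2 - 2 * (1 - c) * Re (cinner u h) + (1 - c)\<^sup>2 * (norm h)\<^sup>2"
      by (simp add: norm_diff_sq cinner.scaleR_right power_mult_distrib)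
    have "c\<^sup>2 * Re (cinner (M h) h) =
        (norm u)\<^sup>2 - 2 * (1 - c) * Re (cinner u h) + (1 - c)\<^sup>2 * (norm h)\<^sup>2 + c * (row_form X h - (norm u)\<^sup>2)"
    proof -
      have *: "c\<^sup>2 * (P / c\<^sup>2 + Q / c) = P + c * Q" for P Q :: real
        using c by (simp add: field_simps power2_eq_square)
      show ?thesis unfolding M_h u_sq * ..
    qed
    also have "\<dots> = (1 - c) * ((norm u)\<^sup>2 - 2 * Re (cinner u h) + (1 - c) * (norm h)\<^sup>2) + c * row_form X h"
      by (simp add: power2_eq_square algebra_simps)
    finally have "?l = (norm u)\<^sup>2 - 2 * Re (cinner u h) + (1 - c) * (norm h)\<^sup>2 + c / (1 - c) * row_form X h"
      using c by (simp add: add_divide_distrib)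
    also have "\<dots> = ?r"
      unfolding adj_axis u_def[symmetric] norm_diff_sq Re_cinner_commute[of h] by (simp add: algebra_simps)
    finally show ?thesis .
  qed
  have step: "Re (cinner (M h) h) + e * (norm h)\<^sup>2 \<le> (norm h)\<^sup>2 \<longleftrightarrow>
      (norm (h - adj_comb (axis first_index 1) X h))\<^sup>2 + (c\<^sup>2 / (1 - c) * e) * (norm h)\<^sup>2 \<le>
      c / (1 - c) * ((norm h)\<^sup>2 - row_form X h)" for h e
  proof -
    have "Re (cinner (M h) h) + e * (norm h)\<^sup>2 \<le> (norm h)\<^sup>2 \<longleftrightarrow>
      c\<^sup>2 / (1 - c) * (Re (cinner (M h) h) + e * (norm h)\<^sup>2) \<le> c\<^sup>2 / (1 - c) * (norm h)\<^sup>2"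
      using c by (intro mult_le_cancel_left_pos[symmetric]) simp
    also have "\<dots> \<longleftrightarrow> c\<^sup>2 * Re (cinner (M h) h) / (1 - c) + c\<^sup>2 / (1 - c) * e * (norm h)\<^sup>2 \<le> c\<^sup>2 / (1 - c) * (norm h)\<^sup>2"
      by (simp add: algebra_simps)
    also have "c\<^sup>2 / (1 - c) * (norm h)\<^sup>2 = c / (1 - c) * (norm h)\<^sup>2 - c * (norm h)\<^sup>2"
      using c by (simp add: field_simps power2_eq_square)
    finally show ?thesis unfolding scaled by (simp add: algebra_simps)
  qed
  have "X \<in> ellipsoid1 c \<longleftrightarrow> (\<exists>e>0. \<forall>h. Re (cinner (M h) h) + e * (norm h)\<^sup>2 \<le> (norm h)\<^sup>2)"
    unfolding ellipsoid1_def mem_Collect_eq M_def[symmetric] op_less_iff_coercive[OF M_BH M_sa]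
    using True by blast
  also have "\<dots> \<longleftrightarrow> ellipsoid_gap c (axis first_index 1) X"
    unfolding step ellipsoid_gap_def
  proof safe
    fix e :: real
    assume "e > 0" "\<forall>h. (norm (h - adj_comb (axis first_index 1) X h))\<^sup>2
             + c\<^sup>2 / (1 - c) * e * (norm h)\<^sup>2 \<le> c / (1 - c) * ((norm h)\<^sup>2 - row_form X h)"
    then show "\<exists>e>0. \<forall>h. (norm (h - adj_comb (axis first_index 1) X h))\<^sup>2 + e * (norm h)\<^sup>2 \<le>
        c / (1 - c) * ((norm h)\<^sup>2 - row_form X h)"
      using c by (intro exI[of _ "c\<^sup>2 / (1 - c) * e"]) auto
  next
    fix e :: real
    assume "e > 0" "\<forall>h. (norm (h - adj_comb (axis first_index 1) X h))\<^sup>2 + e * (norm h)\<^sup>2 \<le>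
        c / (1 - c) * ((norm h)\<^sup>2 - row_form X h)"
    moreover have "c\<^sup>2 / (1 - c) * ((1 - c) / c\<^sup>2 * e) = e" using c by simp
    ultimately show "\<exists>e>0. \<forall>h. (norm (h - adj_comb (axis first_index 1) X h))\<^sup>2
             + c\<^sup>2 / (1 - c) * e * (norm h)\<^sup>2 \<le> c / (1 - c) * ((norm h)\<^sup>2 - row_form X h)"
      using c by (intro exI[of _ "(1 - c) / c\<^sup>2 * e"]) auto
  qed
  finally show ?thesis using True by blast
qed (auto simp: ellipsoid1_def)

lemma unitary_matrix_iff:
  "unitary_matrix U \<longleftrightarrow>
    (\<forall>i j. (\<Sum>k\<in>UNIV. U $ i $ k * cnj (U $ j $ k)) = (if i = j then 1 else 0)) \<and>
    (\<forall>i j. (\<Sum>k\<in>UNIV. cnj (U $ k $ i) * U $ k $ j) = (if i = j then 1 else 0))"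
  by (simp add: unitary_matrix_def Let_def vec_eq_iff matrix_matrix_mult_def mat_def)

lemma tuple_mult_BH: "(\<And>i. X $ i \<in> BH) \<Longrightarrow> tuple_mult X U $ j \<in> BH"
  by (simp add: tuple_mult_def BH_sum BH_comb)

lemma op_adj_tuple_mult:
  assumes "\<And>i. X $ i \<in> BH"
  shows "op_adj (tuple_mult X U $ j) h = (\<Sum>i\<in>UNIV. cnj (U $ i $ j) *\<^sub>C op_adj (X $ i) h)"
proof -
  have "op_adj (tuple_mult X U $ j) = (\<Sum>i\<in>UNIV. op_scaleC (cnj (U $ i $ j)) (op_adj (X $ i)))"
    by (rule op_adj_eqI)
      (simp add: tuple_mult_def blinfun.sum_left op_scaleC.rep_eq cinner.sum_left cinner.sum_right
        cinner_scaleC_left cinner_scaleC_right cinner_op_adj assms)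
  then show ?thesis by (simp add: blinfun.sum_left op_scaleC.rep_eq)
qed

lemma axis_vector_matrix_mult: "(axis k 1 v* U) $ j = (U :: complex ^ 'n ^ 'm::finite) $ k $ j"
proof -
  have "(axis k 1 v* U) $ j = (\<Sum>i\<in>UNIV. if i = k then U $ i $ j else 0)"
    unfolding vector_matrix_mult_def axis_def vec_lambda_beta by (intro sum.cong) auto
  then show ?thesis by simp
qed

text \<open>Orthonormality of the rows of U collapses the double sum to its diagonal. Together with
  \<open>row_form_tuple_mult\<close> this makes \<open>ellipsoid_gap\<close> invariant under
  rotating the tuple and the boundary point simultaneously.\<close>

lemma adj_comb_tuple_mult:
  assumes X: "\<And>i. X $ i \<in> BH" and U: "unitary_matrix U"
  shows "adj_comb (axis k 1 v* U) (tuple_mult X U) h = adj_comb (axis k 1) X h"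
proof -
  have "adj_comb (axis k 1 v* U) (tuple_mult X U) h =
      (\<Sum>j\<in>UNIV. \<Sum>i\<in>UNIV. (U $ k $ j * cnj (U $ i $ j)) *\<^sub>C op_adj (X $ i) h)"
    by (simp add: adj_comb_def op_adj_tuple_mult[OF X] axis_vector_matrix_mult scaleC.sum_right scaleC_scaleC)
  also have "\<dots> = (\<Sum>i\<in>UNIV. (\<Sum>j\<in>UNIV. U $ k $ j * cnj (U $ i $ j)) *\<^sub>C op_adj (X $ i) h)"
    by (subst sum.swap) (simp add: scaleC.sum_left)
  also have "\<dots> = (\<Sum>i\<in>UNIV. axis k 1 $ i *\<^sub>C op_adj (X $ i) h)"
    using U by (intro sum.cong) (auto simp: unitary_matrix_iff axis_def)
  finally show ?thesis by (simp add: adj_comb_def)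
qed

lemma row_form_tuple_mult:
  assumes X: "\<And>i. X $ i \<in> BH" and U: "unitary_matrix U"
  shows "row_form (tuple_mult X U) h = row_form X h"
proof -
  have "complex_of_real (row_form (tuple_mult X U) h) =
      (\<Sum>j\<in>UNIV. \<Sum>i\<in>UNIV. \<Sum>k\<in>UNIV. cnj (U $ i $ j) * U $ k $ j * cinner (op_adj (X $ i) h) (op_adj (X $ k) h))"
    unfolding row_form_def of_real_sum cinner_self[symmetric] op_adj_tuple_mult[OF X]
    by (simp only: cinner.sum_left)
      (simp add: cinner.sum_right cinner_scaleC_left cinner_scaleC_right sum_distrib_left mult.assoc
        mult.left_commute[of "cnj _"])
  also have "\<dots> = (\<Sum>i\<in>UNIV. \<Sum>k\<in>UNIV. \<Sum>j\<in>UNIV. cnj (U $ i $ j) * U $ k $ j * cinner (op_adj (X $ i) h) (op_adj (X $ k) h))"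
    by (subst sum.swap, rule sum.cong[OF refl], rule sum.swap)
  also have "\<dots> = (\<Sum>i\<in>UNIV. \<Sum>k\<in>UNIV. if k = i then cinner (op_adj (X $ i) h) (op_adj (X $ i) h) else 0)"
  proof (intro sum.cong refl)
    fix i k
    have "(\<Sum>j\<in>UNIV. cnj (U $ i $ j) * U $ k $ j) = (if k = i then 1 else 0)"
      using U by (simp add: unitary_matrix_iff mult.commute)
    then show "(\<Sum>j\<in>UNIV. cnj (U $ i $ j) * U $ k $ j * cinner (op_adj (X $ i) h) (op_adj (X $ k) h)) =
        (if k = i then cinner (op_adj (X $ i) h) (op_adj (X $ i) h) else 0)"
      by (simp flip: sum_distrib_right)
  qed
  also have "\<dots> = complex_of_real (row_form X h)"
    by (simp add: cinner_self row_form_def)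
  finally show ?thesis by (simp only: of_real_eq_iff)
qed

lemma tuple_mult_assoc: "tuple_mult (tuple_mult X V) U = tuple_mult X (V ** U)"
proof -
  have "tuple_mult (tuple_mult X V) U $ j = tuple_mult X (V ** U) $ j" for j
  proof (rule blinfun_eqI)
    fix h
    have "(tuple_mult (tuple_mult X V) U $ j) h =
        (\<Sum>k\<in>UNIV. \<Sum>i\<in>UNIV. (V $ i $ k * U $ k $ j) *\<^sub>C (X $ i) h)"
      by (simp add: tuple_mult_def blinfun.sum_left op_scaleC.rep_eq scaleC.sum_right scaleC_scaleC
          mult.commute)
    also have "\<dots> = (\<Sum>i\<in>UNIV. \<Sum>k\<in>UNIV. (V $ i $ k * U $ k $ j) *\<^sub>C (X $ i) h)"
      by (rule sum.swap)
    finally show "(tuple_mult (tuple_mult X V) U $ j) h = (tuple_mult X (V ** U) $ j) h"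
      by (simp add: tuple_mult_def blinfun.sum_left op_scaleC.rep_eq matrix_matrix_mult_def scaleC.sum_left)
  qed
  then show ?thesis by (simp add: vec_eq_iff)
qed

lemma tuple_mult_one: "tuple_mult X (mat 1) = X"
proof -
  have "tuple_mult X (mat 1) $ j = X $ j" for j
  proof -
    have "tuple_mult X (mat 1) $ j = (\<Sum>i\<in>UNIV. if i = j then X $ i else 0)"
      unfolding tuple_mult_def vec_lambda_beta
      by (intro sum.cong refl blinfun_eqI) (simp add: mat_def op_scaleC.rep_eq scaleC_one scaleC.zero_left)
    then show ?thesis by simp
  qed
  then show ?thesis by (simp add: vec_eq_iff)
qed

text \<open>The unitary is the complex reflection \<open>I - v v\<^sup>* / a\<close> along \<open>v = e - \<zeta>\<close>; in the
  degenerate case \<open>\<zeta> = e\<close> it is the identity because \<open>x / 0 = 0\<close>.\<close>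

lemma unitary_with_row:
  fixes \<zeta> :: "complex ^ 'n::finite"
  assumes "norm \<zeta> = 1"
  obtains U where "unitary_matrix U" "axis k 1 v* U = \<zeta>"
proof -
  define e :: "complex ^ 'n" where "e = axis k 1"
  define v where "v = e - \<zeta>"
  define a where "a = 1 - \<zeta> $ k"
  define U :: "complex ^ 'n ^ 'n" where
    "U = (\<chi> i j. (if i = j then 1 else 0) - cnj (v $ i) * v $ j / cnj a)"
  have sq: "(\<Sum>i\<in>UNIV. \<zeta> $ i * cnj (\<zeta> $ i)) = 1"
  proof -
    have "(\<Sum>i\<in>UNIV. (cmod (\<zeta> $ i))\<^sup>2) = 1" using assms norm_vec_sq[of \<zeta>] by simp
    then have "complex_of_real (\<Sum>i\<in>UNIV. (cmod (\<zeta> $ i))\<^sup>2) = 1" by simp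
    then show ?thesis unfolding of_real_sum complex_norm_square .
  qed
  \<comment> \<open>This is exactly the relation that makes the reflection with complex factor 1 /
    cnj a unitary, and it is where \<zeta> having norm 1 enters.\<close>
  have vv: "(\<Sum>i\<in>UNIV. v $ i * cnj (v $ i)) = a + cnj a"
  proof -
    have "(\<Sum>i\<in>UNIV. v $ i * cnj (v $ i)) =
        (\<Sum>i\<in>UNIV. (if i = k then 1 - \<zeta> $ i - cnj (\<zeta> $ i) else 0) + \<zeta> $ i * cnj (\<zeta> $ i))"
      by (intro sum.cong) (auto simp: v_def e_def axis_def algebra_simps)
    also have "\<dots> = (1 - \<zeta> $ k - cnj (\<zeta> $ k)) + 1"
      by (simp only: sum.distrib sq) simp
    finally show ?thesis by (simp add: a_def)
  qed
  have vk: "v $ k = a" by (simp add: v_def e_def a_def axis_def)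
  \<comment> \<open>In the degenerate case all of v vanishes, so the divisions by zero in U only
    ever multiply zero.\<close>
  have a0: "v $ i = 0" if "a = 0" for i
  proof -
    have "complex_of_real (\<Sum>i\<in>UNIV. (cmod (v $ i))\<^sup>2) = 0"
      using vv that unfolding of_real_sum complex_norm_square by simp
    then have "(norm v)\<^sup>2 = 0" unfolding norm_vec_sq by (simp only: of_real_eq_0_iff)
    then show ?thesis by simp
  qed
  have "(\<Sum>l\<in>UNIV. U $ i $ l * cnj (U $ j $ l)) = (if i = j then 1 else 0)" for i j
  proof -
    have "(\<Sum>l\<in>UNIV. U $ i $ l * cnj (U $ j $ l)) =
       (\<Sum>l\<in>UNIV. (if l = i then (if i = j then 1 else 0) else 0)
          - (if l = i then v $ j * cnj (v $ i) / a else 0)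
          - (if l = j then cnj (v $ i) * v $ j / cnj a else 0)
          + cnj (v $ i) * v $ j / (a * cnj a) * (v $ l * cnj (v $ l)))"
      by (intro sum.cong) (auto simp: U_def algebra_simps)
    also have "\<dots> = (if i = j then 1 else 0) - v $ j * cnj (v $ i) / a - cnj (v $ i) * v $ j / cnj a
        + cnj (v $ i) * v $ j / (a * cnj a) * (a + cnj a)"
      unfolding sum.distrib sum_subtractf sum_distrib_left[symmetric] vv by simp
    also have "\<dots> = (if i = j then 1 else 0)"
      by (cases "a = 0") (auto simp: a0 field_simps)
    finally show ?thesis .
  qed
  then have "U ** (\<chi> i j. cnj (U $ j $ i)) = mat 1"
    by (simp add: vec_eq_iff matrix_matrix_mult_def mat_def)
  then have "unitary_matrix U"
    unfolding unitary_matrix_def Let_def using matrix_left_right_inverse by blast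
  moreover have "axis k 1 v* U = \<zeta>"
  proof -
    have "(axis k 1 v* U) $ j = \<zeta> $ j" for j
    proof -
      have "(axis k 1 v* U) $ j = (if k = j then 1 else 0) - cnj (v $ k) * v $ j / cnj a"
        by (simp add: U_def axis_vector_matrix_mult)
      also have "\<dots> = (if k = j then 1 else 0) - v $ j"
        unfolding vk by (cases "a = 0") (auto simp: a0)
      finally show ?thesis by (auto simp: v_def e_def axis_def)
    qed
    then show ?thesis by (simp add: vec_eq_iff)
  qed
  ultimately show thesis by (rule that)
qed

text \<open>Rotation invariance moves the description from the first basis vector to \<zeta>. The
  right-hand side does not mention U, so a single unitary with first row \<zeta> is enough for the
  converse.\<close>

lemma ellipsoid_iff:
  fixes X :: "('h::complex_hilbert, 'n::{finite,linorder}) optuple"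
  assumes c: "0 < c" "c < 1" and \<zeta>: "norm \<zeta> = 1"
  shows "X \<in> ellipsoid c \<zeta> \<longleftrightarrow> (\<forall>i. X $ i \<in> BH) \<and> ellipsoid_gap c \<zeta> X"
proof
  assume "X \<in> ellipsoid c \<zeta>"
  then obtain Z U where X: "X = tuple_mult Z U" and Z: "Z \<in> ellipsoid1 c" and U: "unitary_matrix U"
    and \<zeta>: "axis first_index 1 v* U = \<zeta>" unfolding ellipsoid_def by blast
  from Z have BH: "\<And>i. Z $ i \<in> BH" and "ellipsoid_gap c (axis first_index 1) Z"
    unfolding ellipsoid1_iff[OF c] by auto
  then show "(\<forall>i. X $ i \<in> BH) \<and> ellipsoid_gap c \<zeta> X"
    unfolding ellipsoid_gap_def X \<zeta>[symmetric]
    by (simp add: adj_comb_tuple_mult[OF BH U] row_form_tuple_mult[OF BH U] tuple_mult_BH)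
next
  assume *: "(\<forall>i. X $ i \<in> BH) \<and> ellipsoid_gap c \<zeta> X"
  obtain U where U: "unitary_matrix U" "axis first_index 1 v* U = \<zeta>"
    using unitary_with_row[OF \<zeta>] by blast
  define V where "V = (\<chi> i j. cnj (U $ j $ i))"
  define Z where "Z = tuple_mult X V"
  have "V ** U = mat 1" using U(1) by (simp add: unitary_matrix_def Let_def V_def)
  then have X: "X = tuple_mult Z U"
    by (simp add: Z_def tuple_mult_assoc tuple_mult_one)
  have BH: "\<And>i. Z $ i \<in> BH" unfolding Z_def using * by (simp add: tuple_mult_BH)
  have "ellipsoid_gap c (axis first_index 1) Z"
    using * unfolding ellipsoid_gap_def X U(2)[symmetric]
      adj_comb_tuple_mult[OF BH U(1)] row_form_tuple_mult[OF BH U(1)] by blast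
  then have "Z \<in> ellipsoid1 c" unfolding ellipsoid1_iff[OF c] using BH by blast
  then show "X \<in> ellipsoid c \<zeta>" unfolding ellipsoid_def using X U by blast
qed

lemma ellipsoid_subset_nc_ball:
  assumes c: "0 < c" "c < 1" and \<zeta>: "norm \<zeta> = 1"
  shows "ellipsoid c \<zeta> \<subseteq> nc_ball"
proof
  fix X assume "X \<in> ellipsoid c \<zeta>"
  then obtain e where X: "\<forall>i. X $ i \<in> BH" and e: "e > 0"
    and gap: "\<And>h. (norm (h - adj_comb \<zeta> X h))\<^sup>2 + e * (norm h)\<^sup>2 \<le>
      c / (1 - c) * ((norm h)\<^sup>2 - row_form X h)"
    unfolding ellipsoid_iff[OF assms] ellipsoid_gap_def by blast
  define d where "d = e * (1 - c) / c"
  have d: "d > 0" using e c by (simp add: d_def)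
  have "row_form X h \<le> (1 - d) * (norm h)\<^sup>2" for h
  proof -
    have "e * (norm h)\<^sup>2 \<le> c / (1 - c) * ((norm h)\<^sup>2 - row_form X h)"
      using gap[of h] zero_le_power2[of "norm (h - adj_comb \<zeta> X h)"] by linarith
    then have "d * (norm h)\<^sup>2 \<le> (norm h)\<^sup>2 - row_form X h"
      using c unfolding d_def by (simp add: field_simps)
    then show ?thesis by (simp add: algebra_simps)
  qed
  \<comment> \<open>The maximum is needed because \<open>nc_ball_iff\<close> asks for a nonnegative
    factor, while on the zero space 1 - d may be negative.\<close>
  then have "row_form X h \<le> max 0 (1 - d) * (norm h)\<^sup>2" for h
    by (meson max.cobounded2 mult_right_mono order_trans zero_le_power2)
  then show "X \<in> nc_ball"
    unfolding nc_ball_iff using X d by (intro conjI exI[of _ "max 0 (1 - d)"]) auto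
qed

subsection \<open>Sums over words\<close>

lemma finite_words: "finite {\<alpha> :: 'n::finite list. length \<alpha> < N}" "finite {\<alpha> :: 'n::finite list. length \<alpha> = N}"
  using finite_lists_length_le[of "UNIV :: 'n set" N] by (auto elim: rev_finite_subset)

lemma sum_words_Suc:
  fixes f :: "'n::finite list \<Rightarrow> 'b::comm_monoid_add"
  shows "(\<Sum>\<alpha> | length \<alpha> < Suc N. f \<alpha>) = f [] + (\<Sum>i\<in>UNIV. \<Sum>\<alpha> | length \<alpha> < N. f (i # \<alpha>))"
proof -
  have "{\<alpha> :: 'n list. length \<alpha> < Suc N} =
      insert [] ((\<lambda>(i, \<alpha>). i # \<alpha>) ` (UNIV \<times> {\<alpha>. length \<alpha> < N}))"
  proof (intro set_eqI iffI)
    fix x :: "'n list" assume "x \<in> {\<alpha>. length \<alpha> < Suc N}"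
    then show "x \<in> insert [] ((\<lambda>(i, \<alpha>). i # \<alpha>) ` (UNIV \<times> {\<alpha>. length \<alpha> < N}))"
      by (cases x) auto
  qed auto
  moreover have "inj_on (\<lambda>(i, \<alpha>). i # \<alpha>) (UNIV \<times> {\<alpha> :: 'n list. length \<alpha> < N})"
    by (auto intro: inj_onI)
  ultimately show ?thesis
    by (simp add: sum.insert finite_words image_iff sum.reindex split_def sum.cartesian_product comp_def)
qed

lemma sum_words_by_length:
  fixes f :: "'n::finite list \<Rightarrow> 'b::comm_monoid_add"
  shows "(\<Sum>k<N. \<Sum>\<alpha> | length \<alpha> = k. f \<alpha>) = (\<Sum>\<alpha> | length \<alpha> < N. f \<alpha>)"
proof (induction N)
  case (Suc N)
  have "{\<alpha> :: 'n list. length \<alpha> < Suc N} = {\<alpha>. length \<alpha> < N} \<union> {\<alpha>. length \<alpha> = N}" by auto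
  then show ?case using Suc by (simp add: sum.union_disjoint finite_words disjoint_iff)
qed simp

lemma sum_words_eq_Suc:
  fixes f :: "'n::finite list \<Rightarrow> 'b::comm_monoid_add"
  shows "(\<Sum>\<alpha> | length \<alpha> = Suc N. f \<alpha>) = (\<Sum>i\<in>UNIV. \<Sum>\<alpha> | length \<alpha> = N. f (i # \<alpha>))"
proof -
  have "{\<alpha> :: 'n list. length \<alpha> = Suc N} = (\<lambda>(i, \<alpha>). i # \<alpha>) ` (UNIV \<times> {\<alpha>. length \<alpha> = N})"
  proof (intro set_eqI iffI)
    fix x :: "'n list" assume "x \<in> {\<alpha>. length \<alpha> = Suc N}"
    then show "x \<in> (\<lambda>(i, \<alpha>). i # \<alpha>) ` (UNIV \<times> {\<alpha>. length \<alpha> = N})"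
      by (cases x) auto
  qed auto
  moreover have "inj_on (\<lambda>(i, \<alpha>). i # \<alpha>) (UNIV \<times> {\<alpha> :: 'n list. length \<alpha> = N})"
    by (auto intro: inj_onI)
  ultimately show ?thesis
    by (simp add: sum.reindex split_def sum.cartesian_product comp_def)
qed

primrec scalar_word :: "complex ^ 'n \<Rightarrow> 'n list \<Rightarrow> complex" where
  "scalar_word z [] = 1"
| "scalar_word z (i # \<alpha>) = z $ i * scalar_word z \<alpha>"

lemma scalar_word_append: "scalar_word z (\<alpha> @ \<beta>) = scalar_word z \<alpha> * scalar_word z \<beta>"
  by (induction \<alpha>) auto

lemma word_prod_scalar_tuple:
  "word_prod (scalar_tuple z) \<alpha> = op_scaleC (scalar_word z \<alpha>) id_blinfun"
  by (induction \<alpha>)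
    (auto intro!: blinfun_eqI simp: scalar_tuple_def op_scaleC.rep_eq scaleC_scaleC scaleC_one)

lemma sum_scalar_word_sq:
  fixes z :: "complex ^ 'n::finite"
  shows "(\<Sum>\<alpha> | length \<alpha> = k. (cmod (scalar_word z \<alpha>))\<^sup>2) = ((norm z)\<^sup>2) ^ k"
  by (induction k)
    (simp_all add: sum_words_eq_Suc norm_mult power_mult_distrib norm_vec_sq
      flip: sum_distrib_left sum_distrib_right)

subsection \<open>Orthonormal families\<close>

definition orthonormal_on :: "'i set \<Rightarrow> ('i \<Rightarrow> 'h::complex_hilbert) \<Rightarrow> bool" where
  "orthonormal_on W e \<longleftrightarrow> (\<forall>i\<in>W. \<forall>j\<in>W. cinner (e i) (e j) = (if i = j then 1 else 0))"

text \<open>Gram--Schmidt never gets stuck, because a finite set does not span the space. Indexed by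
  words, such a family is the basis of a truncated Fock space inside H.\<close>

lemma orthonormal_family_exists:
  assumes inf: "\<not> (\<exists>B :: 'h::complex_hilbert set. finite B \<and> cspan B = UNIV)" and "finite W"
  shows "\<exists>e :: 'i \<Rightarrow> 'h. orthonormal_on W e"
  using \<open>finite W\<close>
proof induction
  case (insert x F)
  then obtain e :: "'i \<Rightarrow> 'h" where e: "orthonormal_on F e" by blast
  obtain y where y: "y \<notin> cspan (e ` F)" using inf insert.hyps by (metis UNIV_eq_I finite_imageI)
  define z where "z = y - (\<Sum>i\<in>F. cinner y (e i) *\<^sub>C e i)"
  have "(\<Sum>i\<in>F. cinner y (e i) *\<^sub>C e i) \<in> cspan (e ` F)"
    by (intro complex_vector.span_sum complex_vector.span_scale complex_vector.span_base) auto
  with y have "z \<noteq> 0" by (auto simp: z_def)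
  define u where "u = (1 / norm z) *\<^sub>R z"
  have ze: "cinner z (e j) = 0" if "j \<in> F" for j
  proof -
    have "(\<Sum>i\<in>F. cinner y (e i) * cinner (e i) (e j)) = (\<Sum>i\<in>F. if i = j then cinner y (e i) else 0)"
      using e that by (intro sum.cong) (auto simp: orthonormal_on_def)
    then show ?thesis
      using that insert.hyps by (simp add: z_def cinner.diff_left cinner.sum_left cinner_scaleC_left)
  qed
  have ez: "cinner (e j) z = 0" if "j \<in> F" for j
    using ze[OF that] by (metis cinner_commute complex_cnj_zero)
  have uu: "cinner u u = 1"
    using \<open>z \<noteq> 0\<close> by (simp add: cinner_self u_def)
  have uj: "cinner u (e j) = 0" and ju: "cinner (e j) u = 0" if "j \<in> F" for j
    using that by (simp_all add: u_def cinner.scaleR_left cinner.scaleR_right ze ez)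
  have "orthonormal_on (insert x F) (e(x := u))"
    unfolding orthonormal_on_def
  proof (intro ballI)
    fix i j assume "i \<in> insert x F" "j \<in> insert x F"
    then show "cinner ((e(x := u)) i) ((e(x := u)) j) = (if i = j then 1 else 0)"
      using e insert.hyps by (auto simp: orthonormal_on_def uu uj ju)
  qed
  then show ?case by blast
qed (simp add: orthonormal_on_def)

lemma
  assumes e: "orthonormal_on W e" and A: "A \<subseteq> W" "finite A"
  shows orthonormal_cinner: "j \<in> W \<Longrightarrow> cinner (\<Sum>i\<in>A. c i *\<^sub>C e i) (e j) = (if j \<in> A then c j else 0)"
    and orthonormal_norm: "(norm (\<Sum>i\<in>A. c i *\<^sub>C e i))\<^sup>2 = (\<Sum>i\<in>A. (cmod (c i))\<^sup>2)"
proof -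
  have *: "cinner (\<Sum>i\<in>A. c i *\<^sub>C e i) (e j) = (if j \<in> A then c j else 0)" if "j \<in> W" for j
  proof -
    have "cinner (\<Sum>i\<in>A. c i *\<^sub>C e i) (e j) = (\<Sum>i\<in>A. if i = j then c i else 0)"
      unfolding cinner.sum_left cinner_scaleC_left
      using e A that by (intro sum.cong refl) (auto simp: orthonormal_on_def subset_iff)
    then show ?thesis using A by simp
  qed
  then show "j \<in> W \<Longrightarrow> cinner (\<Sum>i\<in>A. c i *\<^sub>C e i) (e j) = (if j \<in> A then c j else 0)" .
  have "complex_of_real ((norm (\<Sum>i\<in>A. c i *\<^sub>C e i))\<^sup>2) = (\<Sum>j\<in>A. cnj (c j) * c j)"
    unfolding cinner_self[symmetric] cinner.sum_right cinner_scaleC_right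
    using A * by (intro sum.cong) auto
  also have "\<dots> = complex_of_real (\<Sum>j\<in>A. (cmod (c j))\<^sup>2)"
    unfolding of_real_sum complex_norm_square by (simp add: mult.commute)
  finally show "(norm (\<Sum>i\<in>A. c i *\<^sub>C e i))\<^sup>2 = (\<Sum>j\<in>A. (cmod (c j))\<^sup>2)"
    by (simp only: of_real_eq_iff)
qed

lemma bessel:
  assumes e: "orthonormal_on W e" and W: "finite W"
  shows "(\<Sum>i\<in>W. (cmod (cinner h (e i)))\<^sup>2) \<le> (norm h)\<^sup>2"
proof -
  define p where "p = (\<Sum>i\<in>W. cinner h (e i) *\<^sub>C e i)"
  define S where "S = (\<Sum>i\<in>W. (cmod (cinner h (e i)))\<^sup>2)"
  have p: "(norm p)\<^sup>2 = S" unfolding p_def S_def by (rule orthonormal_norm[OF e order_refl W])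
  have "cinner h p = complex_of_real S"
    unfolding p_def S_def of_real_sum complex_norm_square
    by (simp add: cinner.sum_right cinner_scaleC_right mult.commute)
  then have "(norm (h - p))\<^sup>2 = (norm h)\<^sup>2 - S" by (simp add: norm_diff_sq p)
  then show ?thesis unfolding S_def[symmetric] by (metis diff_ge_0_iff_ge zero_le_power2)
qed

subsection \<open>Truncated shifts\<close>

lift_definition rank_one :: "'h::complex_hilbert \<Rightarrow> 'h \<Rightarrow> 'h \<Rightarrow>\<^sub>L 'h" is "\<lambda>u v h. cinner h u *\<^sub>C v"
  by (rule bounded_linear_compose[OF scaleC.bounded_linear_left cinner.bounded_linear_left])

lemma rank_one_BH: "rank_one u v \<in> BH"
  by (simp add: BH_def rank_one.rep_eq cinner_scaleC_left scaleC_scaleC)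

text \<open>The left creation operators of the Fock space, compressed and dilated by r, and extended
  by zero to all of H so that \<phi> can be evaluated at them. Source words are shorter than M, so
  target words have length at most M; this is the range of words on which orthonormality is
  assumed.\<close>

definition shift_tuple ::
    "real \<Rightarrow> nat \<Rightarrow> ('n list \<Rightarrow> 'h::complex_hilbert) \<Rightarrow> ('h, 'n::finite) optuple" where
  "shift_tuple r M e = (\<chi> i. r *\<^sub>R (\<Sum>\<gamma> | length \<gamma> < M. rank_one (e \<gamma>) (e (i # \<gamma>))))"

lemma shift_tuple_BH: "shift_tuple r M e $ i \<in> BH"
  by (simp add: shift_tuple_def BH_comb BH_sum rank_one_BH)

lemma op_adj_shift_tuple:
  "op_adj (shift_tuple r M e $ i) = r *\<^sub>R (\<Sum>\<gamma> | length \<gamma> < M. rank_one (e (i # \<gamma>)) (e \<gamma>))"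
proof (rule op_adj_eqI)
  fix x y
  have "cinner x (e \<gamma>) * cinner (e (i # \<gamma>)) y = cinner x (cinner y (e (i # \<gamma>)) *\<^sub>C e \<gamma>)" for \<gamma>
    by (simp add: cinner_scaleC_right cinner_commute[of y] mult.commute)
  then show "cinner ((shift_tuple r M e $ i) x) y =
      cinner x ((r *\<^sub>R (\<Sum>\<gamma> | length \<gamma> < M. rank_one (e (i # \<gamma>)) (e \<gamma>))) y)"
    by (simp add: shift_tuple_def blinfun.scaleR_left blinfun.sum_left rank_one.rep_eq
        cinner.scaleR_left cinner.scaleR_right cinner.sum_left cinner.sum_right cinner_scaleC_left)
qed

context
  fixes e :: "'n::finite list \<Rightarrow> 'h::complex_hilbert" and M :: nat
  assumes e: "orthonormal_on {\<gamma>. length \<gamma> < Suc M} e"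
begin

text \<open>Adjoints of different components read off coefficients at words with different first
  letters. These sets of words are disjoint, so Bessel's inequality bounds the total, and the
  dilation makes the bound strict.\<close>

lemma shift_tuple_nc_ball:
  assumes "0 \<le> r" "r < 1"
  shows "shift_tuple r M e \<in> nc_ball"
  unfolding nc_ball_iff
proof (intro conjI allI exI[of _ "r\<^sup>2"])
  fix h
  have "(norm (op_adj (shift_tuple r M e $ i) h))\<^sup>2 =
      r\<^sup>2 * (\<Sum>\<gamma> | length \<gamma> < M. (cmod (cinner h (e (i # \<gamma>))))\<^sup>2)" for i
    using orthonormal_norm[OF e _ finite_words(1), of M "\<lambda>\<gamma>. cinner h (e (i # \<gamma>))"]
    by (auto simp: Collect_mono less_SucI op_adj_shift_tuple blinfun.scaleR_left blinfun.sum_left rank_one.rep_eq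
        power_mult_distrib finite_words)
  then have "row_form (shift_tuple r M e) h =
      r\<^sup>2 * (\<Sum>i\<in>UNIV. \<Sum>\<gamma> | length \<gamma> < M. (cmod (cinner h (e (i # \<gamma>))))\<^sup>2)"
    by (simp add: row_form_def sum_distrib_left)
  also have "\<dots> \<le> r\<^sup>2 * (\<Sum>\<gamma> | length \<gamma> < Suc M. (cmod (cinner h (e \<gamma>)))\<^sup>2)"
    by (intro mult_left_mono) (simp_all add: sum_words_Suc)
  also have "\<dots> \<le> r\<^sup>2 * (norm h)\<^sup>2"
    by (intro mult_left_mono bessel[OF e] finite_words) simp
  finally show "row_form (shift_tuple r M e) h \<le> r\<^sup>2 * (norm h)\<^sup>2" .
qed (use assms in \<open>auto simp: shift_tuple_BH power_less_one_iff\<close>)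

lemma shift_tuple_apply:
  assumes "length \<delta> < Suc M"
  shows "(shift_tuple r M e $ i) (e \<delta>) = (if length \<delta> < M then r *\<^sub>R e (i # \<delta>) else 0)"
proof -
  have "(\<Sum>\<gamma> | length \<gamma> < M. cinner (e \<delta>) (e \<gamma>) *\<^sub>C e (i # \<gamma>)) =
      (\<Sum>\<gamma> | length \<gamma> < M. if \<gamma> = \<delta> then e (i # \<delta>) else 0)"
    using e assms by (intro sum.cong) (auto simp: orthonormal_on_def scaleC_one scaleC.zero_left)
  then show ?thesis
    by (simp add: shift_tuple_def blinfun.scaleR_left blinfun.sum_left rank_one.rep_eq finite_words)
qed

text \<open>Words that would grow beyond length M are sent to zero. On each basis vector a power
  series in this tuple is therefore a finite sum.\<close>

lemma word_prod_shift_tuple: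
  assumes "length \<beta> < Suc M"
  shows "word_prod (shift_tuple r M e) \<alpha> (e \<beta>) =
    (if length \<alpha> + length \<beta> < Suc M then r ^ length \<alpha> *\<^sub>R e (\<alpha> @ \<beta>) else 0)"
proof (induction \<alpha>)
  case (Cons i \<alpha>)
  then show ?case by (auto simp: blinfun.scaleR_right shift_tuple_apply)
qed (use assms in simp)

end

subsection \<open>Free holomorphic self-maps of the ball\<close>

locale nc_self_map =
  fixes \<phi> :: "('h::complex_hilbert, 'n::finite) optuple \<Rightarrow> ('h, 'n) optuple"
    and a :: "'n \<Rightarrow> 'n list \<Rightarrow> complex"
  assumes infinite_dim: "\<not> (\<exists>B :: 'h set. finite B \<and> cspan B = UNIV)"
    and maps: "X \<in> nc_ball \<Longrightarrow> \<phi> X \<in> nc_ball"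
    and expansion: "X \<in> nc_ball \<Longrightarrow>
      (\<lambda>k. \<Sum>\<alpha> | length \<alpha> = k. op_scaleC (a j \<alpha>) (word_prod X \<alpha>)) sums (\<phi> X $ j)"
begin

lemma \<phi>_BH: "X \<in> nc_ball \<Longrightarrow> \<phi> X $ j \<in> BH"
  using maps nc_ball_iff by blast

text \<open>Apply \<open>\<phi>\<close> to the \<open>r\<close>-dilate of the left shifts, compressed to words of length at most \<open>M\<close>.\<close>

lemma coefficient_contraction_dilated:
  fixes r :: real
  assumes r: "0 \<le> r" "r < 1"
  shows "(\<Sum>j\<in>UNIV. \<Sum>\<beta> | length \<beta> < Suc M.
      (cmod (\<Sum>\<alpha> | length \<alpha> + length \<beta> < Suc M. cnj (a j \<alpha>) * r ^ length \<alpha> * v (\<alpha> @ \<beta>)))\<^sup>2)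
    \<le> (\<Sum>\<gamma> | length \<gamma> < Suc M. (cmod (v \<gamma>))\<^sup>2)"
proof -
  obtain e :: "'n list \<Rightarrow> 'h" where e: "orthonormal_on {\<gamma>. length \<gamma> < Suc M} e"
    using orthonormal_family_exists[OF infinite_dim finite_words(1)] by blast
  define X where "X = shift_tuple r M e"
  have X: "X \<in> nc_ball" unfolding X_def by (rule shift_tuple_nc_ball[OF e r])
  define u where "u = (\<Sum>\<gamma> | length \<gamma> < Suc M. v \<gamma> *\<^sub>C e \<gamma>)"
  have \<phi>_e: "(\<phi> X $ j) (e \<beta>) = (\<Sum>\<alpha> | length \<alpha> + length \<beta> < Suc M. (a j \<alpha> * r ^ length \<alpha>) *\<^sub>C e (\<alpha> @ \<beta>))"
    if \<beta>: "length \<beta> < Suc M" for j \<beta>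
  proof -
    have sc: "(c * complex_of_real r ^ n) *\<^sub>C x = c *\<^sub>C (r ^ n *\<^sub>R x)" for c n and x :: 'h
      by (simp only: of_real_power[symmetric] scaleC_of_real scaleC_scaleC[symmetric])
    define t where "t k = (\<Sum>\<alpha> | length \<alpha> = k. a j \<alpha> *\<^sub>C word_prod X \<alpha> (e \<beta>))" for k
    have "(\<lambda>k. (\<Sum>\<alpha> | length \<alpha> = k. op_scaleC (a j \<alpha>) (word_prod X \<alpha>)) (e \<beta>)) sums (\<phi> X $ j) (e \<beta>)"
      by (rule bounded_linear.sums[OF blinfun.bounded_linear_left expansion[OF X]])
    then have "t sums (\<phi> X $ j) (e \<beta>)"
      by (simp add: t_def[abs_def] blinfun.sum_left op_scaleC.rep_eq)
    moreover have "t sums (\<Sum>k<Suc M. t k)"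
      by (rule sums_finite)
        (auto simp: t_def X_def word_prod_shift_tuple[OF e \<beta>] intro!: sum.neutral)
    ultimately have "(\<phi> X $ j) (e \<beta>) = (\<Sum>k<Suc M. t k)" using sums_unique2 by blast
    also have "\<dots> = (\<Sum>\<alpha> | length \<alpha> < Suc M. a j \<alpha> *\<^sub>C word_prod X \<alpha> (e \<beta>))"
      unfolding t_def by (rule sum_words_by_length)
    also have "\<dots> = (\<Sum>\<alpha> | length \<alpha> + length \<beta> < Suc M. (a j \<alpha> * r ^ length \<alpha>) *\<^sub>C e (\<alpha> @ \<beta>))"
      by (rule sum.mono_neutral_cong_right)
        (auto simp: finite_words X_def word_prod_shift_tuple[OF e \<beta>] sc)
    finally show ?thesis .
  qed
  have "cinner (op_adj (\<phi> X $ j) u) (e \<beta>) =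
      (\<Sum>\<alpha> | length \<alpha> + length \<beta> < Suc M. cnj (a j \<alpha>) * r ^ length \<alpha> * v (\<alpha> @ \<beta>))"
    if \<beta>: "length \<beta> < Suc M" for j \<beta>
  proof -
    have "cinner (op_adj (\<phi> X $ j) u) (e \<beta>) =
        (\<Sum>\<alpha> | length \<alpha> + length \<beta> < Suc M. cnj (a j \<alpha>) * r ^ length \<alpha> * cinner u (e (\<alpha> @ \<beta>)))"
      by (simp add: cinner_op_adj' \<phi>_BH[OF X] \<phi>_e[OF \<beta>] cinner.sum_right cinner_scaleC_right)
    also have "\<dots> = (\<Sum>\<alpha> | length \<alpha> + length \<beta> < Suc M. cnj (a j \<alpha>) * r ^ length \<alpha> * v (\<alpha> @ \<beta>))"
      by (intro sum.cong refl) (auto simp: u_def orthonormal_cinner[OF e] finite_words)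
    finally show ?thesis .
  qed
  then have "(\<Sum>j\<in>UNIV. \<Sum>\<beta> | length \<beta> < Suc M.
      (cmod (\<Sum>\<alpha> | length \<alpha> + length \<beta> < Suc M. cnj (a j \<alpha>) * r ^ length \<alpha> * v (\<alpha> @ \<beta>)))\<^sup>2)
      = (\<Sum>j\<in>UNIV. \<Sum>\<beta> | length \<beta> < Suc M. (cmod (cinner (op_adj (\<phi> X $ j) u) (e \<beta>)))\<^sup>2)"
    by (intro sum.cong refl) auto
  \<comment> \<open>The adjoints may leave the span of the family; Bessel's inequality discards that
    part.\<close>
  also have "\<dots> \<le> row_form (\<phi> X) u"
    unfolding row_form_def by (intro sum_mono bessel[OF e] finite_words)
  also have "\<dots> \<le> (norm u)\<^sup>2"
  proof -
    obtain s where "s < 1" "row_form (\<phi> X) u \<le> s * (norm u)\<^sup>2"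
      using maps[OF X] unfolding nc_ball_iff by blast
    then show ?thesis using mult_right_mono[of s 1 "(norm u)\<^sup>2"] by simp
  qed
  also have "\<dots> = (\<Sum>\<gamma> | length \<gamma> < Suc M. (cmod (v \<gamma>))\<^sup>2)"
    unfolding u_def by (rule orthonormal_norm[OF e order_refl finite_words(1)])
  finally show ?thesis .
qed

text \<open>All sums are finite and continuous in r, so the dilated bound passes to r = 1, although
  the undilated shifts need not lie in the open ball. The left side is the squared norm of the
  truncated adjoint of multiplication by the row \<phi>.\<close>

lemma coefficient_contraction:
  "(\<Sum>j\<in>UNIV. \<Sum>\<beta> | length \<beta> < N.
      (cmod (\<Sum>\<alpha> | length \<alpha> + length \<beta> < N. cnj (a j \<alpha>) * v (\<alpha> @ \<beta>)))\<^sup>2)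
    \<le> (\<Sum>\<gamma> | length \<gamma> < N. (cmod (v \<gamma>))\<^sup>2)"
proof (cases N)
  case (Suc M)
  define F where "F r = (\<Sum>j\<in>UNIV. \<Sum>\<beta> | length \<beta> < Suc M.
      (cmod (\<Sum>\<alpha> | length \<alpha> + length \<beta> < Suc M.
        cnj (a j \<alpha>) * complex_of_real r ^ length \<alpha> * v (\<alpha> @ \<beta>)))\<^sup>2)" for r :: real
  have "continuous (at_left 1) F"
    unfolding F_def by (intro continuous_intros)
  then have "(F \<longlongrightarrow> F 1) (at_left 1)"
    by (simp add: continuous_within)
  moreover have "\<forall>\<^sub>F r in at_left (1::real). F r \<le> (\<Sum>\<gamma> | length \<gamma> < N. (cmod (v \<gamma>))\<^sup>2)"
  proof (rule eventually_mono[OF eventually_at_left_real[of 0 1]])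
    fix r :: real assume "r \<in> {0<..<1}"
    then show "F r \<le> (\<Sum>\<gamma> | length \<gamma> < N. (cmod (v \<gamma>))\<^sup>2)"
      using coefficient_contraction_dilated[of r v M] by (simp add: F_def Suc)
  qed simp
  ultimately have "F 1 \<le> (\<Sum>\<gamma> | length \<gamma> < N. (cmod (v \<gamma>))\<^sup>2)"
    by (rule tendsto_upperbound) simp
  then show ?thesis by (simp add: F_def Suc)
qed simp

text \<open>The contraction is tested on the sequence \<open>a j\<close> itself; keeping only the
  index \<open>j\<close> and the empty word on the left gives S^2 \<le> S.\<close>

lemma coefficient_bound: "(\<Sum>\<alpha> | length \<alpha> < N. (cmod (a j \<alpha>))\<^sup>2) \<le> 1"
proof (cases N)
  case (Suc M)
  define S where "S = (\<Sum>\<alpha> | length \<alpha> < N. (cmod (a j \<alpha>))\<^sup>2)"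
  have "(cmod (\<Sum>\<alpha> | length \<alpha> + length ([] :: 'n list) < N. cnj (a j \<alpha>) * a j (\<alpha> @ [])))\<^sup>2 \<le>
      (\<Sum>\<beta> | length \<beta> < N. (cmod (\<Sum>\<alpha> | length \<alpha> + length \<beta> < N. cnj (a j \<alpha>) * a j (\<alpha> @ \<beta>)))\<^sup>2)"
    by (rule member_le_sum) (auto simp: finite_words Suc)
  also have "\<dots> \<le> (\<Sum>j'\<in>UNIV. \<Sum>\<beta> | length \<beta> < N.
      (cmod (\<Sum>\<alpha> | length \<alpha> + length \<beta> < N. cnj (a j' \<alpha>) * a j (\<alpha> @ \<beta>)))\<^sup>2)"
    by (rule member_le_sum[where i = j]) (auto intro: sum_nonneg)
  also have "\<dots> \<le> S" unfolding S_def by (rule coefficient_contraction)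
  also have "(\<Sum>\<alpha> | length \<alpha> + length ([] :: 'n list) < N. cnj (a j \<alpha>) * a j (\<alpha> @ [])) = complex_of_real S"
    unfolding S_def of_real_sum complex_norm_square by (simp add: mult.commute)
  finally have "S * S \<le> S" by (simp add: power2_eq_square)
  moreover have "0 \<le> S" by (simp add: S_def sum_nonneg)
  ultimately have "S \<le> 1" by (cases "S = 0") (auto simp: mult_le_cancel_right)
  then show ?thesis by (simp add: S_def)
qed simp

end

subsection \<open>Adjoints of word products\<close>

lemma op_adj_compose: "A \<in> BH \<Longrightarrow> B \<in> BH \<Longrightarrow> op_adj (A o\<^sub>L B) = op_adj B o\<^sub>L op_adj A"
  by (rule op_adj_eqI) (simp add: cinner_op_adj)

lemma op_adj_id: "op_adj id_blinfun = id_blinfun"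
  by (rule op_adj_eqI) simp

lemma word_prod_append: "word_prod X (\<alpha> @ \<beta>) = word_prod X \<alpha> o\<^sub>L word_prod X \<beta>"
  by (induction \<alpha>) (auto intro!: blinfun_eqI)

lemma op_adj_tendsto:
  assumes A: "\<And>n. A n \<in> BH" "B \<in> BH" and lim: "A \<longlonglongrightarrow> B"
  shows "(\<lambda>n. op_adj (A n) h) \<longlonglongrightarrow> op_adj B h"
proof -
  have eq: "op_adj (A n) h - op_adj B h = op_adj (A n - B) h" for n
  proof -
    have "op_adj (A n - B) = op_adj (A n) - op_adj B"
      by (rule op_adj_eqI)
        (simp add: blinfun.diff_left cinner.diff_left cinner.diff_right cinner_op_adj A)
    then show ?thesis by (simp add: blinfun.diff_left)
  qed
  have "(\<lambda>n. norm (A n - B) * norm h) \<longlonglongrightarrow> 0"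
    using tendsto_mult_left_zero[OF tendsto_norm_zero[OF LIM_zero[OF lim]]] .
  then have "(\<lambda>n. op_adj (A n) h - op_adj B h) \<longlonglongrightarrow> 0"
    by (rule Lim_null_comparison[rotated]) (simp add: eq norm_op_adj_le A BH_comb)
  then show ?thesis by (rule LIM_zero_cancel)
qed

context
  fixes X :: "('h::complex_hilbert, 'n::finite) optuple"
  assumes BH: "\<And>i. X $ i \<in> BH"
begin

lemma word_prod_BH: "word_prod X \<alpha> \<in> BH"
  by (induction \<alpha>) (auto simp: BH_comb BH)

lemma op_adj_word_Cons: "op_adj (word_prod X (i # \<alpha>)) h = op_adj (word_prod X \<alpha>) (op_adj (X $ i) h)"
  by (simp add: op_adj_compose BH word_prod_BH)

lemma op_adj_word_append:
  "op_adj (word_prod X (\<alpha> @ \<beta>)) h = op_adj (word_prod X \<beta>) (op_adj (word_prod X \<alpha>) h)"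
  by (simp add: word_prod_append op_adj_compose word_prod_BH)

lemma sum_norm_adj_word_le:
  assumes r: "0 \<le> r" "\<And>h. row_form X h \<le> r * (norm h)\<^sup>2"
  shows "(\<Sum>\<alpha> | length \<alpha> = k. (norm (op_adj (word_prod X \<alpha>) h))\<^sup>2) \<le> r ^ k * (norm h)\<^sup>2"
proof (induction k arbitrary: h)
  case (Suc k)
  have "(\<Sum>\<alpha> | length \<alpha> = Suc k. (norm (op_adj (word_prod X \<alpha>) h))\<^sup>2) \<le>
      (\<Sum>i\<in>UNIV. r ^ k * (norm (op_adj (X $ i) h))\<^sup>2)"
    unfolding sum_words_eq_Suc op_adj_word_Cons by (intro sum_mono Suc.IH)
  also have "\<dots> = r ^ k * row_form X h" by (simp add: row_form_def sum_distrib_left)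
  also have "\<dots> \<le> r ^ k * (r * (norm h)\<^sup>2)" by (intro mult_left_mono r) (use r in simp)
  finally show ?case by (simp add: mult_ac)
qed (simp add: op_adj_id)

text \<open>The sum telescopes over word lengths, since the row forms at one length add up to the
  squared norms at the next. In the limit this says that the Poisson kernel of X is an
  isometry.\<close>

lemma sum_defect_adj_word:
  "(\<Sum>\<alpha> | length \<alpha> < N. (norm (op_adj (word_prod X \<alpha>) h))\<^sup>2 - row_form X (op_adj (word_prod X \<alpha>) h)) =
    (norm h)\<^sup>2 - (\<Sum>\<alpha> | length \<alpha> = N. (norm (op_adj (word_prod X \<alpha>) h))\<^sup>2)"
proof (induction N arbitrary: h)
  case (Suc N)
  show ?case
    unfolding sum_words_Suc sum_words_eq_Suc op_adj_word_Cons Suc.IH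
    by (simp add: op_adj_id sum_subtractf row_form_def)
qed (simp add: op_adj_id)

text \<open>The terms with words of length m add up to the m-th power of
  \<open>adj_comb z X\<close>, so this is a truncated Neumann series applied to a vector on which it
  telescopes.\<close>

lemma sum_scalar_adj_word:
  "(\<Sum>\<alpha> | length \<alpha> < N. scalar_word z \<alpha> *\<^sub>C op_adj (word_prod X \<alpha>) (k - adj_comb z X k)) =
    k - (adj_comb z X ^^ N) k"
proof -
  define S where "S N h = (\<Sum>\<alpha> | length \<alpha> < N. scalar_word z \<alpha> *\<^sub>C op_adj (word_prod X \<alpha>) h)" for N h
  have S_Suc: "S (Suc N) h = h + S N (adj_comb z X h)" for N h
  proof -
    have "S (Suc N) h = h + (\<Sum>i\<in>UNIV. \<Sum>\<alpha> | length \<alpha> < N.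
        scalar_word z \<alpha> *\<^sub>C op_adj (word_prod X \<alpha>) (z $ i *\<^sub>C op_adj (X $ i) h))"
      unfolding S_def sum_words_Suc op_adj_word_Cons
      by (simp add: op_adj_id scaleC_one op_adj_scaleC word_prod_BH scaleC_scaleC mult.commute)
    also have "\<dots> = h + S N (adj_comb z X h)"
      unfolding S_def adj_comb_def by (subst sum.swap) (simp add: blinfun.sum_right scaleC.sum_right)
    finally show ?thesis .
  qed
  have "S N (k - adj_comb z X k) = k - (adj_comb z X ^^ N) k" for k
  proof (induction N arbitrary: k)
    case (Suc N)
    then show ?case by (simp add: S_Suc adj_comb_diff funpow_swap1)
  qed (simp add: S_def)
  then show ?thesis by (simp add: S_def)
qed

end

text \<open>The constant is uniform over the closed ball of scalars: the same c serves interior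
  points and their boundary limit, which is what keeps the resolvents under control in that
  limit.\<close>

lemma adj_comb_contraction:
  assumes "X \<in> nc_ball"
  obtains c where "0 \<le> c" "c < 1" "\<And>z h. norm z \<le> 1 \<Longrightarrow> norm (adj_comb z X h) \<le> c * norm h"
proof -
  obtain r where r: "0 \<le> r" "r < 1" "\<And>h. row_form X h \<le> r * (norm h)\<^sup>2"
    using assms unfolding nc_ball_iff by blast
  show thesis
  proof (rule that[of "sqrt r"])
    fix z :: "complex ^ 'b" and h :: 'a
    assume "norm z \<le> 1"
    then have "norm (adj_comb z X h) \<le> 1 * sqrt (r * (norm h)\<^sup>2)"
      using norm_adj_comb_le r by (meson mult_mono order_trans real_sqrt_le_mono real_sqrt_ge_zero
          row_form_nonneg zero_le_one)
    then show "norm (adj_comb z X h) \<le> sqrt r * norm h" by (simp add: real_sqrt_mult)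
  qed (use r in auto)
qed

lemma adj_resolvent:
  assumes X: "X \<in> nc_ball" and z: "norm z \<le> 1"
  shows "\<exists>!k. k - adj_comb z X k = h"
proof -
  obtain c where c: "0 \<le> c" "c < 1" "\<And>h. norm (adj_comb z X h) \<le> c * norm h"
    using adj_comb_contraction[OF X] z by metis
  have "\<exists>!k. h + adj_comb z X k = k"
    by (rule banach_fix_type[OF c(1,2)]) (use c(3) in \<open>simp add: dist_norm flip: adj_comb_diff\<close>)
  moreover have "h + adj_comb z X k = k \<longleftrightarrow> k - adj_comb z X k = h" for k
    by (auto simp: algebra_simps)
  ultimately show ?thesis by simp
qed

subsection \<open>The defect form\<close>

definition defect :: "('h::complex_hilbert, 'n::finite) optuple \<Rightarrow> 'h \<Rightarrow> 'h \<Rightarrow> complex" where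
  "defect X u w = cinner u w - (\<Sum>i\<in>UNIV. cinner (op_adj (X $ i) u) (op_adj (X $ i) w))"

lemma defect_self: "defect X u u = complex_of_real ((norm u)\<^sup>2 - row_form X u)"
  by (simp add: defect_def cinner_self row_form_def)

lemma defect_commute: "defect X u w = cnj (defect X w u)"
  unfolding defect_def complex_cnj_diff cnj_sum by (simp add: cinner_commute[symmetric])

lemma defect_add_left: "defect X (u + v) w = defect X u w + defect X v w"
  by (simp add: defect_def blinfun.add_right cinner.add_left sum.distrib)

lemma defect_scaleC_left:
  "(\<And>i. X $ i \<in> BH) \<Longrightarrow> defect X (c *\<^sub>C u) w = c * defect X u w"
  by (simp add: defect_def op_adj_scaleC cinner_scaleC_left right_diff_distrib sum_distrib_left)

lemma bounded_linear_defect: "bounded_linear (\<lambda>u. defect X u w)"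
  unfolding defect_def
  by (intro bounded_linear_sub bounded_linear_sum cinner.bounded_linear_left
      bounded_linear_compose[OF cinner.bounded_linear_left blinfun.bounded_linear_right])

lemma row_defect_nonneg:
  assumes "X \<in> nc_ball"
  shows "0 \<le> (norm u)\<^sup>2 - row_form X u"
proof -
  obtain r where "r < 1" "row_form X u \<le> r * (norm u)\<^sup>2"
    using assms unfolding nc_ball_iff by blast
  then show ?thesis using mult_right_mono[of r 1 "(norm u)\<^sup>2"] by simp
qed

section \<open>Positive semidefinite sesquilinear forms and their Gram factorisations\<close>

locale psd_form =
  fixes B :: "'h::complex_hilbert \<Rightarrow> 'h \<Rightarrow> complex"
  assumes add_left: "B (x + y) z = B x z + B y z"
    and scale_left: "B (c *\<^sub>C x) y = c * B x y"
    and hermitian: "B x y = cnj (B y x)"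
    and nonneg: "0 \<le> Re (B x x)"
begin

lemma add_right: "B z (x + y) = B z x + B z y"
  by (metis add_left complex_cnj_add hermitian)

lemma scale_right: "B x (c *\<^sub>C y) = cnj c * B x y"
  by (metis complex_cnj_mult hermitian scale_left)

lemma zero_left: "B 0 x = 0"
  using scale_left[of 0 0 x] by (simp add: scaleC.zero_left)

lemma diff_left: "B (x - y) z = B x z - B y z"
  using add_left[of "x - y" y z] by simp

lemma diff_right: "B z (x - y) = B z x - B z y"
  using add_right[of z "x - y" y] by simp

lemma sum_left: "B (\<Sum>i\<in>I. u i) x = (\<Sum>i\<in>I. B (u i) x)"
  by (induction I rule: infinite_finite_induct) (auto simp: zero_left add_left)

lemma sum_right: "B x (\<Sum>i\<in>I. u i) = (\<Sum>i\<in>I. B x (u i))"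
  by (subst hermitian) (simp add: sum_left hermitian[symmetric])

lemma self_real: "B x x = complex_of_real (Re (B x x))"
  using hermitian[of x x] by (simp add: complex_eq_iff)

lemma minus_left: "B (- x) y = - B x y" and minus_right: "B y (- x) = - B y x"
  using diff_left[of 0 x y] diff_right[of y 0 x] zero_left[of y] hermitian[of y 0] by simp_all

lemma add_scale_self:
  "Re (B (x + c *\<^sub>C y) (x + c *\<^sub>C y)) =
    Re (B x x) + 2 * Re (cnj c * B x y) + (cmod c)\<^sup>2 * Re (B y y)"
proof -
  have "B (x + c *\<^sub>C y) (x + c *\<^sub>C y) =
      B x x + (cnj c * B x y + cnj (cnj c * B x y)) + (c * cnj c) * B y y"
    by (simp add: add_left add_right scale_left scale_right hermitian[of y x] algebra_simps)
  then show ?thesis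
    by (simp only: plus_complex.sel complex_add_cnj complex_norm_square[symmetric]) simp
qed

lemma scale_self: "Re (B (c *\<^sub>C x) (c *\<^sub>C x)) = (cmod c)\<^sup>2 * Re (B x x)"
  using add_scale_self[of 0 c x] by (simp add: zero_left)

lemma null_right:
  assumes "B y y = 0"
  shows "B x y = 0"
proof (rule ccontr)
  assume "B x y \<noteq> 0"
  \<comment> \<open>As \<open>B y y\<close> vanishes, the form depends affinely on t along this
    direction; this t makes its value exactly -1.\<close>
  define t where "t = (Re (B x x) + 1) / (2 * (cmod (B x y))\<^sup>2)"
  have "0 \<le> Re (B (x + (- of_real t * B x y) *\<^sub>C y) (x + (- of_real t * B x y) *\<^sub>C y))"
    by (rule nonneg)
  also have "\<dots> = Re (B x x) - 2 * (t * (cmod (B x y))\<^sup>2)"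
  proof -
    have "cnj (- of_real t * B x y) * B x y = - of_real t * (B x y * cnj (B x y))" by simp
    also have "\<dots> = complex_of_real (- (t * (cmod (B x y))\<^sup>2))"
      by (simp only: complex_norm_square[symmetric] of_real_minus of_real_mult mult_minus_left)
    finally have Re_eq: "Re (cnj (- of_real t * B x y) * B x y) = - (t * (cmod (B x y))\<^sup>2)"
      by (simp only: Re_complex_of_real)
    show ?thesis unfolding add_scale_self assms Re_eq by simp
  qed
  also have "\<dots> = - 1" using \<open>B x y \<noteq> 0\<close> by (simp add: t_def field_simps)
  finally show False by simp
qed

text \<open>Gram--Schmidt elimination of one vector; in the degenerate case the new coefficients vanish
  because \<open>x / 0 = 0\<close>.\<close>

lemma gram_decomposition:
  assumes "finite A"
  shows "\<exists>(P::nat) g. \<forall>i\<in>A. \<forall>j\<in>A. B (v i) (v j) = (\<Sum>p<P. g p i * cnj (g p j))"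
  using assms
proof (induction A arbitrary: v)
  case (insert x F)
  define b where "b = Re (B (v x) (v x))"
  have b: "B (v x) (v x) = complex_of_real b" unfolding b_def by (rule self_real)
  have "b \<ge> 0" by (simp add: b_def nonneg)
  define c where "c i = B (v i) (v x)" for i
  define v' where "v' i = v i - (c i / b) *\<^sub>C v x" for i
  obtain P g where g: "\<And>i j. i \<in> F \<Longrightarrow> j \<in> F \<Longrightarrow> B (v' i) (v' j) = (\<Sum>p<(P::nat). g p i * cnj (g p j))"
    using insert.IH[of v'] by blast
  have c0: "c i = 0" if "b = 0" for i
    using null_right[of "v x" "v i"] that by (simp add: b c_def)
  have cx: "c x = complex_of_real b" by (simp add: c_def b)
  have cnj_c: "B (v x) (v i) = cnj (c i)" for i unfolding c_def by (rule hermitian)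
  have v': "B (v i) (v j) = B (v' i) (v' j) + c i * cnj (c j) / b" for i j
    by (cases "b = 0")
      (simp_all add: v'_def c0 scaleC.zero_left diff_left diff_right scale_left scale_right cx cnj_c
        c_def[symmetric])
  \<comment> \<open>The induction hypothesis says nothing about \<open>g p x\<close>, so the old
    coordinates are reset to zero at x; the new coordinate alone accounts for every pairing with
    \<open>v x\<close>.\<close>
  define g' where "g' p = (if p < P then (g p)(x := 0) else (\<lambda>i. c i / sqrt b))" for p
  have sq: "c i / sqrt b * cnj (c j / sqrt b) = c i * cnj (c j) / b" for i j
    using \<open>b \<ge> 0\<close> by (simp flip: of_real_mult)
  have "B (v i) (v j) = (\<Sum>p<Suc P. g' p i * cnj (g' p j))" if "i \<in> insert x F" "j \<in> insert x F" for i j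
  proof -
    have "(\<Sum>p<Suc P. g' p i * cnj (g' p j)) = (\<Sum>p<P. ((g p)(x := 0)) i * cnj (((g p)(x := 0)) j)) + c i * cnj (c j) / b"
      using sq[of i j] by (simp add: g'_def)
    also have "\<dots> = B (v i) (v j)"
    proof (cases "i = x \<or> j = x")
      case True
      then have "c i * cnj (c j) / b = B (v i) (v j)"
        by (cases "b = 0") (auto simp: c0 cx cnj_c c_def[symmetric])
      with True show ?thesis by auto
    next
      case False
      then show ?thesis using that insert.hyps by (simp add: v' g)
    qed
    finally show ?thesis by simp
  qed
  then show ?case by blast
qed simp

end

lemma psd_form_defect:
  assumes X: "X \<in> nc_ball"
  shows "psd_form (defect X)"
proof
  show "defect X (c *\<^sub>C u) w = c * defect X u w" for c u w
    by (rule defect_scaleC_left) (use X nc_ball_iff in blast)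
  show "0 \<le> Re (defect X u u)" for u
    using row_defect_nonneg[OF X, of u] by (simp add: defect_self)
qed (rule defect_add_left defect_commute)+

lemma (in psd_form) gram_self:
  assumes g: "\<And>i j. i \<in> A \<Longrightarrow> j \<in> A \<Longrightarrow> B (v i) (v j) = (\<Sum>p<(P::nat). g p i * cnj (g p j))"
    and f: "f ` S \<subseteq> A"
  shows "Re (B (\<Sum>s\<in>S. c s *\<^sub>C v (f s)) (\<Sum>s\<in>S. c s *\<^sub>C v (f s))) =
    (\<Sum>p<P. (cmod (\<Sum>s\<in>S. c s * g p (f s)))\<^sup>2)"
proof -
  have "B (\<Sum>s\<in>S. c s *\<^sub>C v (f s)) (\<Sum>s\<in>S. c s *\<^sub>C v (f s)) =
      (\<Sum>s\<in>S. \<Sum>t\<in>S. c s * (cnj (c t) * B (v (f s)) (v (f t))))"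
    by (simp only: sum_left scale_left) (simp add: sum_right scale_right sum_distrib_left)
  also have "\<dots> = (\<Sum>s\<in>S. \<Sum>t\<in>S. \<Sum>p<P. c s * g p (f s) * cnj (c t * g p (f t)))"
  proof (intro sum.cong refl)
    fix s t assume "s \<in> S" "t \<in> S"
    then have "B (v (f s)) (v (f t)) = (\<Sum>p<P. g p (f s) * cnj (g p (f t)))"
      using f by (intro g) auto
    then show "c s * (cnj (c t) * B (v (f s)) (v (f t))) = (\<Sum>p<P. c s * g p (f s) * cnj (c t * g p (f t)))"
      by (simp add: sum_distrib_left mult_ac)
  qed
  also have "\<dots> = (\<Sum>s\<in>S. \<Sum>p<P. \<Sum>t\<in>S. c s * g p (f s) * cnj (c t * g p (f t)))"
    by (rule sum.cong[OF refl], rule sum.swap)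
  also have "\<dots> = (\<Sum>p<P. \<Sum>s\<in>S. \<Sum>t\<in>S. c s * g p (f s) * cnj (c t * g p (f t)))"
    by (rule sum.swap)
  also have "\<dots> = (\<Sum>p<P. (\<Sum>s\<in>S. c s * g p (f s)) * cnj (\<Sum>t\<in>S. c t * g p (f t)))"
    by (simp add: sum_product cnj_sum)
  also have "\<dots> = complex_of_real (\<Sum>p<P. (cmod (\<Sum>s\<in>S. c s * g p (f s)))\<^sup>2)"
    unfolding of_real_sum complex_norm_square ..
  finally show ?thesis by (simp only: Re_complex_of_real)
qed

section \<open>Vector-valued contraction and the power series of the scalar map\<close>

context nc_self_map
begin

text \<open>A Gram factorisation splits the vectors into P scalar sequences whose energies add up to
  the B-energy, and the scalar contraction applies to each sequence. This is the contraction
  tensored with an identity, obtained without a square root of B.\<close>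

lemma vector_contraction:
  assumes B: "psd_form B"
  shows "(\<Sum>j\<in>UNIV. \<Sum>\<beta> | length \<beta> < N.
      Re (B (\<Sum>\<alpha> | length \<alpha> < N - length \<beta>. cnj (a j \<alpha>) *\<^sub>C v (\<alpha> @ \<beta>))
            (\<Sum>\<alpha> | length \<alpha> < N - length \<beta>. cnj (a j \<alpha>) *\<^sub>C v (\<alpha> @ \<beta>))))
    \<le> (\<Sum>\<gamma> | length \<gamma> < N. Re (B (v \<gamma>) (v \<gamma>)))"
proof -
  interpret psd_form B by fact
  obtain P g where g: "\<And>\<gamma> \<delta>. \<gamma> \<in> {\<gamma>. length \<gamma> < N} \<Longrightarrow> \<delta> \<in> {\<gamma>. length \<gamma> < N} \<Longrightarrow>
      B (v \<gamma>) (v \<delta>) = (\<Sum>p<(P::nat). g p \<gamma> * cnj (g p \<delta>))"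
    using gram_decomposition[OF finite_words(1), of N v] by blast
  have gram: "Re (B (\<Sum>s\<in>S. c s *\<^sub>C v (f s)) (\<Sum>s\<in>S. c s *\<^sub>C v (f s))) =
      (\<Sum>p<P. (cmod (\<Sum>s\<in>S. c s * g p (f s)))\<^sup>2)"
    if "\<And>s. s \<in> S \<Longrightarrow> length (f s) < N" for c f and S :: "'n list set"
    using that by (intro gram_self[of "{\<gamma>. length \<gamma> < N}"] g) auto
  have idx: "{\<alpha> :: 'n list. length \<alpha> < N - length \<beta>} = {\<alpha>. length \<alpha> + length \<beta> < N}" for \<beta> :: "'n list"
    by auto
  have "(\<Sum>j\<in>UNIV. \<Sum>\<beta> | length \<beta> < N.
      Re (B (\<Sum>\<alpha> | length \<alpha> < N - length \<beta>. cnj (a j \<alpha>) *\<^sub>C v (\<alpha> @ \<beta>))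
            (\<Sum>\<alpha> | length \<alpha> < N - length \<beta>. cnj (a j \<alpha>) *\<^sub>C v (\<alpha> @ \<beta>))))
    = (\<Sum>j\<in>UNIV. \<Sum>\<beta> | length \<beta> < N. \<Sum>p<P.
        (cmod (\<Sum>\<alpha> | length \<alpha> + length \<beta> < N. cnj (a j \<alpha>) * g p (\<alpha> @ \<beta>)))\<^sup>2)"
    unfolding idx by (intro sum.cong refl gram) auto
  also have "\<dots> = (\<Sum>j\<in>UNIV. \<Sum>p<P. \<Sum>\<beta> | length \<beta> < N.
        (cmod (\<Sum>\<alpha> | length \<alpha> + length \<beta> < N. cnj (a j \<alpha>) * g p (\<alpha> @ \<beta>)))\<^sup>2)"
    by (rule sum.cong[OF refl], rule sum.swap)
  also have "\<dots> = (\<Sum>p<P. \<Sum>j\<in>UNIV. \<Sum>\<beta> | length \<beta> < N.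
        (cmod (\<Sum>\<alpha> | length \<alpha> + length \<beta> < N. cnj (a j \<alpha>) * g p (\<alpha> @ \<beta>)))\<^sup>2)"
    by (rule sum.swap)
  also have "\<dots> \<le> (\<Sum>p<P. \<Sum>\<gamma> | length \<gamma> < N. (cmod (g p \<gamma>))\<^sup>2)"
    by (intro sum_mono coefficient_contraction)
  also have "\<dots> = (\<Sum>\<gamma> | length \<gamma> < N. \<Sum>p<P. (cmod (g p \<gamma>))\<^sup>2)"
    by (rule sum.swap)
  also have "\<dots> = (\<Sum>\<gamma> | length \<gamma> < N. Re (B (v \<gamma>) (v \<gamma>)))"
  proof (intro sum.cong refl)
    fix \<gamma> :: "'n list" assume "\<gamma> \<in> {\<gamma>. length \<gamma> < N}"
    then show "(\<Sum>p<P. (cmod (g p \<gamma>))\<^sup>2) = Re (B (v \<gamma>) (v \<gamma>))"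
      using gram[of "{\<gamma>}" "\<lambda>\<gamma>. \<gamma>" "\<lambda>_. 1"] by (simp add: scaleC_one)
  qed
  finally show ?thesis .
qed

text \<open>An explicit series for the scalar representation, from which continuity can be read off;
  \<open>\<phi>_scalar_tuple\<close> links it to \<phi> on the ball.\<close>

definition scalar_map :: "complex ^ 'n \<Rightarrow> complex ^ 'n" where
  "scalar_map z = (\<chi> j. \<Sum>k. \<Sum>\<alpha> | length \<alpha> = k. a j \<alpha> * scalar_word z \<alpha>)"

text \<open>Cauchy--Schwarz on each homogeneous part, with the coefficients of total square at most
  1. The resulting bound is geometric and uniform on smaller balls.\<close>

lemma scalar_term_bound:
  "cmod (\<Sum>\<alpha> | length \<alpha> = k. a j \<alpha> * scalar_word z \<alpha>) \<le> norm z ^ k"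
proof -
  have "cmod (\<Sum>\<alpha> | length \<alpha> = k. a j \<alpha> * scalar_word z \<alpha>) \<le>
      (\<Sum>\<alpha> | length \<alpha> = k. \<bar>cmod (a j \<alpha>)\<bar> * \<bar>cmod (scalar_word z \<alpha>)\<bar>)"
    by (rule sum_norm_le) (simp add: norm_mult)
  also have "\<dots> \<le> L2_set (\<lambda>\<alpha>. cmod (a j \<alpha>)) {\<alpha>. length \<alpha> = k} * L2_set (\<lambda>\<alpha>. cmod (scalar_word z \<alpha>)) {\<alpha>. length \<alpha> = k}"
    by (rule L2_set_mult_ineq)
  also have "\<dots> \<le> 1 * norm z ^ k"
  proof (intro mult_mono)
    have "(\<Sum>\<alpha> | length \<alpha> = k. (cmod (a j \<alpha>))\<^sup>2) \<le> (\<Sum>\<alpha> | length \<alpha> < Suc k. (cmod (a j \<alpha>))\<^sup>2)"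
      by (intro sum_mono2 finite_words) auto
    also have "\<dots> \<le> 1" by (rule coefficient_bound)
    finally show "L2_set (\<lambda>\<alpha>. cmod (a j \<alpha>)) {\<alpha>. length \<alpha> = k} \<le> 1"
      by (simp add: L2_set_def)
    show "L2_set (\<lambda>\<alpha>. cmod (scalar_word z \<alpha>)) {\<alpha>. length \<alpha> = k} \<le> norm z ^ k"
      unfolding L2_set_def sum_scalar_word_sq by (simp add: real_sqrt_power)
  qed (auto simp: L2_set_nonneg)
  finally show ?thesis by simp
qed

lemma scalar_map_sums:
  assumes "norm z < 1"
  shows "(\<lambda>k. \<Sum>\<alpha> | length \<alpha> = k. a j \<alpha> * scalar_word z \<alpha>) sums (scalar_map z $ j)"
proof -
  have "summable (\<lambda>k. \<Sum>\<alpha> | length \<alpha> = k. a j \<alpha> * scalar_word z \<alpha>)"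
    by (rule summable_comparison_test[OF _ summable_geometric[of "norm z"]])
      (use assms scalar_term_bound in auto)
  then show ?thesis by (simp add: scalar_map_def summable_sums)
qed

lemma scalar_map_continuous: "continuous_on (ball 0 1) scalar_map"
proof -
  have "continuous_on (cball 0 r) (\<lambda>z. scalar_map z $ j)" if r: "0 \<le> r" "r < 1" for r j
  proof (rule uniform_limit_theorem)
    show "uniform_limit (cball 0 r) (\<lambda>n z. \<Sum>k<n. \<Sum>\<alpha> | length \<alpha> = k. a j \<alpha> * scalar_word z \<alpha>)
        (\<lambda>z. scalar_map z $ j) sequentially"
      unfolding scalar_map_def vec_lambda_beta
    proof (rule Weierstrass_m_test[where M = "\<lambda>k. r ^ k"])
      fix k and z :: "complex ^ 'n" assume "z \<in> cball 0 r"
      then have "norm z ^ k \<le> r ^ k" by (intro power_mono) auto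
      then show "cmod (\<Sum>\<alpha> | length \<alpha> = k. a j \<alpha> * scalar_word z \<alpha>) \<le> r ^ k"
        using scalar_term_bound order_trans by blast
    qed (use r in simp)
    have "continuous_on UNIV (\<lambda>z. scalar_word z \<alpha>)" for \<alpha> :: "'n list"
      by (induction \<alpha>) (auto intro!: continuous_intros)
    then show "\<forall>\<^sub>F n in sequentially.
        continuous_on (cball 0 r) (\<lambda>z. \<Sum>k<n. \<Sum>\<alpha> | length \<alpha> = k. a j \<alpha> * scalar_word z \<alpha>)"
      by (intro always_eventually allI continuous_intros) (auto intro: continuous_on_subset)
  qed simp
  then have loc: "continuous_on (cball 0 r) scalar_map" if "0 \<le> r" "r < 1" for r
    using continuous_on_vec_lambda[of "cball 0 r" "\<lambda>j z. scalar_map z $ j"] that by simp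
  show ?thesis
  proof (rule continuous_at_imp_continuous_on, rule ballI)
    fix z :: "complex ^ 'n" assume "z \<in> ball 0 1"
    then obtain r where r: "norm z < r" "r < 1" using dense by auto
    then have "0 \<le> r" by (meson norm_ge_zero less_imp_le order_trans)
    then have "continuous_on (ball 0 r) scalar_map"
      using loc[of r] r ball_subset_cball continuous_on_subset by blast
    then show "isCont scalar_map z"
      using r by (simp add: continuous_on_eq_continuous_at)
  qed
qed

lemma nontrivial: "\<exists>h :: 'h. h \<noteq> 0"
proof (rule ccontr)
  assume "\<not> ?thesis"
  then have "cspan {} = (UNIV :: 'h set)" by auto
  with infinite_dim show False by blast
qed

lemma \<phi>_scalar_tuple:
  assumes "norm z < 1"
  shows "\<phi> (scalar_tuple z) = scalar_tuple (scalar_map z)"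
proof -
  obtain h0 :: 'h where "h0 \<noteq> 0" using nontrivial by blast
  then have X: "(scalar_tuple z :: ('h, 'n) optuple) \<in> nc_ball"
    using assms by (simp add: scalar_tuple_nc_ball_iff)
  have "\<phi> (scalar_tuple z) $ j = op_scaleC (scalar_map z $ j) id_blinfun" for j
  proof (rule blinfun_eqI)
    fix h
    have "(\<lambda>k. (\<Sum>\<alpha> | length \<alpha> = k. op_scaleC (a j \<alpha>) (word_prod (scalar_tuple z) \<alpha>)) h)
        sums (\<phi> (scalar_tuple z) $ j) h"
      by (rule bounded_linear.sums[OF blinfun.bounded_linear_left expansion[OF X]])
    then have "(\<lambda>k. (\<Sum>\<alpha> | length \<alpha> = k. a j \<alpha> * scalar_word z \<alpha>) *\<^sub>C h) sums (\<phi> (scalar_tuple z) $ j) h"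
      by (simp add: blinfun.sum_left word_prod_scalar_tuple op_scaleC.rep_eq scaleC_scaleC scaleC.sum_left)
    moreover have "(\<lambda>k. (\<Sum>\<alpha> | length \<alpha> = k. a j \<alpha> * scalar_word z \<alpha>) *\<^sub>C h) sums (scalar_map z $ j *\<^sub>C h)"
      by (rule bounded_linear.sums[OF scaleC.bounded_linear_left scalar_map_sums[OF assms]])
    ultimately show "(\<phi> (scalar_tuple z) $ j) h = op_scaleC (scalar_map z $ j) id_blinfun h"
      by (simp add: sums_unique2 op_scaleC.rep_eq)
  qed
  then show ?thesis by (simp add: vec_eq_iff scalar_tuple_def)
qed

lemma scalar_map_ball: "norm z < 1 \<Longrightarrow> norm (scalar_map z) < 1"
  using maps[of "scalar_tuple z"] nontrivial by (auto simp: \<phi>_scalar_tuple scalar_tuple_nc_ball_iff)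

subsection \<open>The Schwarz--Pick inequality between a scalar and an operator point\<close>

text \<open>The coefficient contraction is applied to the superposition
  \<open>X\<^sub>\<gamma>\<^sup>* h + cnj \<lambda>\<^sub>\<gamma> g\<close> of the Poisson kernel of \<open>X\<close> and the Szego kernel at \<open>\<lambda>\<close>; the
  defect form \<open>\<langle>(I - X X\<^sup>*) u, w\<rangle>\<close> takes the place of the square root of \<open>I - X X\<^sup>*\<close>.\<close>

lemma kernel_energy_tendsto:
  fixes X :: "('h, 'n) optuple"
  assumes X: "X \<in> nc_ball" and z: "norm z < 1"
  shows "(\<lambda>N. \<Sum>\<gamma> | length \<gamma> < N.
      Re (defect X (op_adj (word_prod X \<gamma>) (k - adj_comb z X k) + cnj (scalar_word z \<gamma>) *\<^sub>C g)
                   (op_adj (word_prod X \<gamma>) (k - adj_comb z X k) + cnj (scalar_word z \<gamma>) *\<^sub>C g)))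
    \<longlonglongrightarrow> (norm (k - adj_comb z X k))\<^sup>2 + 2 * Re (defect X k g)
        + Re (defect X g g) / (1 - (norm z)\<^sup>2)"
proof -
  interpret psd_form "defect X" by (rule psd_form_defect[OF X])
  obtain r where BH: "\<And>i. X $ i \<in> BH" and r: "0 \<le> r" "r < 1" "\<And>h. row_form X h \<le> r * (norm h)\<^sup>2"
    using X unfolding nc_ball_iff by blast
  define h where "h = k - adj_comb z X k"
  \<comment> \<open>The energy splits into the telescoping Poisson part, a mixed part that is a
    truncated Neumann series, and a geometric Szego part. Parametrising h through k lets the mixed
    part converge simply to \<open>defect X k g\<close>.\<close>
  have "(\<Sum>\<gamma> | length \<gamma> < N.
      Re (defect X (op_adj (word_prod X \<gamma>) h + cnj (scalar_word z \<gamma>) *\<^sub>C g)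
                   (op_adj (word_prod X \<gamma>) h + cnj (scalar_word z \<gamma>) *\<^sub>C g))) =
      ((norm h)\<^sup>2 - (\<Sum>\<gamma> | length \<gamma> = N. (norm (op_adj (word_prod X \<gamma>) h))\<^sup>2))
      + 2 * Re (defect X (k - (adj_comb z X ^^ N) k) g) + (\<Sum>n<N. ((norm z)\<^sup>2) ^ n) * Re (defect X g g)" for N
  proof -
    have 1: "(\<Sum>\<gamma> | length \<gamma> < N. Re (defect X (op_adj (word_prod X \<gamma>) h) (op_adj (word_prod X \<gamma>) h))) =
        (norm h)\<^sup>2 - (\<Sum>\<gamma> | length \<gamma> = N. (norm (op_adj (word_prod X \<gamma>) h))\<^sup>2)"
      unfolding defect_self Re_complex_of_real by (rule sum_defect_adj_word[OF BH])
    have 2: "(\<Sum>\<gamma> | length \<gamma> < N. Re (scalar_word z \<gamma> * defect X (op_adj (word_prod X \<gamma>) h) g)) =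
        Re (defect X (k - (adj_comb z X ^^ N) k) g)"
      unfolding sum_scalar_adj_word[OF BH, symmetric] h_def[symmetric] by (simp add: sum_left scale_left)
    have 3: "(\<Sum>\<gamma> | length \<gamma> < N. (cmod (scalar_word z \<gamma>))\<^sup>2 * Re (defect X g g)) =
        (\<Sum>n<N. ((norm z)\<^sup>2) ^ n) * Re (defect X g g)"
      by (simp add: sum_distrib_right flip: sum_words_by_length sum_scalar_word_sq)
    show ?thesis
      unfolding add_scale_self complex_cnj_cnj complex_mod_cnj sum.distrib sum_distrib_left[symmetric] 1 2 3 ..
  qed
  moreover have "(\<lambda>N. ((norm h)\<^sup>2 - (\<Sum>\<gamma> | length \<gamma> = N. (norm (op_adj (word_prod X \<gamma>) h))\<^sup>2))
      + 2 * Re (defect X (k - (adj_comb z X ^^ N) k) g) + (\<Sum>n<N. ((norm z)\<^sup>2) ^ n) * Re (defect X g g))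
    \<longlonglongrightarrow> ((norm h)\<^sup>2 - 0) + 2 * Re (defect X (k - 0) g) + 1 / (1 - (norm z)\<^sup>2) * Re (defect X g g)"
  proof (intro tendsto_intros bounded_linear.tendsto[OF bounded_linear_defect])
    have "(\<lambda>N. r ^ N * (norm h)\<^sup>2) \<longlonglongrightarrow> 0 * (norm h)\<^sup>2"
      by (intro tendsto_intros LIMSEQ_power_zero) (use r in auto)
    then have lim: "(\<lambda>N. r ^ N * (norm h)\<^sup>2) \<longlonglongrightarrow> 0" by simp
    have "norm (\<Sum>\<gamma> | length \<gamma> = N. (norm (op_adj (word_prod X \<gamma>) h))\<^sup>2) \<le> r ^ N * (norm h)\<^sup>2" for N
    proof -
      have "0 \<le> (\<Sum>\<gamma> | length \<gamma> = N. (norm (op_adj (word_prod X \<gamma>) h))\<^sup>2)" by (rule sum_nonneg) simp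
      then show ?thesis using sum_norm_adj_word_le[OF BH r(1,3), where k = N and h = h] by simp
    qed
    then show "(\<lambda>N. \<Sum>\<gamma> | length \<gamma> = N. (norm (op_adj (word_prod X \<gamma>) h))\<^sup>2) \<longlonglongrightarrow> 0"
      by (intro Lim_null_comparison[OF _ lim] always_eventually allI)
    obtain c where c: "0 \<le> c" "c < 1" "\<And>h. norm (adj_comb z X h) \<le> c * norm h"
      using adj_comb_contraction[OF X] z less_imp_le by metis
    have "norm ((adj_comb z X ^^ N) k) \<le> c ^ N * norm k" for N
    proof (induction N)
      case (Suc N)
      have "norm ((adj_comb z X ^^ Suc N) k) \<le> c * norm ((adj_comb z X ^^ N) k)" using c(3) by simp
      also have "\<dots> \<le> c * (c ^ N * norm k)" by (intro mult_left_mono Suc c)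
      finally show ?case by (simp add: mult.assoc)
    qed simp
    moreover have "(\<lambda>N. c ^ N * norm k) \<longlonglongrightarrow> 0 * norm k"
      by (intro tendsto_intros LIMSEQ_power_zero) (use c in auto)
    then have lim: "(\<lambda>N. c ^ N * norm k) \<longlonglongrightarrow> 0" by simp
    ultimately show "(\<lambda>N. (adj_comb z X ^^ N) k) \<longlonglongrightarrow> 0"
      by (intro Lim_null_comparison[OF _ lim] always_eventually allI)
    have "norm ((norm z)\<^sup>2) < 1" using z by (simp add: power_less_one_iff)
    then show "(\<lambda>N. \<Sum>n<N. ((norm z)\<^sup>2) ^ n) \<longlonglongrightarrow> 1 / (1 - (norm z)\<^sup>2)"
      using geometric_sums unfolding sums_def by blast
  qed
  ultimately show ?thesis by (simp add: h_def)
qed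

text \<open>The adjoint of multiplication by the j-th component respects both kernels: it takes the
  Poisson kernel of h to that of \<open>op_adj (\<phi> X $ j) h\<close> and multiplies the Szego
  kernel by the conjugate of \<open>scalar_map z $ j\<close>. Truncation spoils this, so the outer
  cutoff M is held fixed while the inner cutoff N tends to infinity.\<close>

lemma kernel_energy_le:
  fixes X :: "('h, 'n) optuple"
  assumes X: "X \<in> nc_ball" and z: "norm z < 1" and h: "k - adj_comb z X k = h"
  shows "(\<Sum>j\<in>UNIV. \<Sum>\<beta> | length \<beta> < M.
      Re (defect X (op_adj (word_prod X \<beta>) (op_adj (\<phi> X $ j) h) + cnj (scalar_word z \<beta>) *\<^sub>C cnj (scalar_map z $ j) *\<^sub>C g)
                   (op_adj (word_prod X \<beta>) (op_adj (\<phi> X $ j) h) + cnj (scalar_word z \<beta>) *\<^sub>C cnj (scalar_map z $ j) *\<^sub>C g)))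
    \<le> (norm h)\<^sup>2 + 2 * Re (defect X k g) + Re (defect X g g) / (1 - (norm z)\<^sup>2)"
proof -
  interpret psd_form "defect X" by (rule psd_form_defect[OF X])
  have BH: "\<And>i. X $ i \<in> BH" using X unfolding nc_ball_iff by blast
  define v where "v \<gamma> = op_adj (word_prod X \<gamma>) h + cnj (scalar_word z \<gamma>) *\<^sub>C g" for \<gamma>
  \<comment> \<open>At cutoff N the coordinate \<beta> sees only words \<alpha> shorter than
    \<open>N - length \<beta>\<close>; \<open>p\<close> and \<open>c\<close> are the corresponding
    partial sums for the operator and the scalar point.\<close>
  define p where "p j m = op_adj (\<Sum>\<alpha> | length \<alpha> < m. op_scaleC (a j \<alpha>) (word_prod X \<alpha>)) h" for j m
  define c where "c j m = (\<Sum>\<alpha> | length \<alpha> < m. a j \<alpha> * scalar_word z \<alpha>)" for j m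
  define y where "y N j \<beta> = op_adj (word_prod X \<beta>) (p j (N - length \<beta>))
      + cnj (scalar_word z \<beta>) *\<^sub>C cnj (c j (N - length \<beta>)) *\<^sub>C g" for N j \<beta>
  have p_eq: "p j m = (\<Sum>\<alpha> | length \<alpha> < m. cnj (a j \<alpha>) *\<^sub>C op_adj (word_prod X \<alpha>) h)" for j m
  proof -
    have "op_adj (\<Sum>\<alpha> | length \<alpha> < m. op_scaleC (a j \<alpha>) (word_prod X \<alpha>)) =
        (\<Sum>\<alpha> | length \<alpha> < m. op_scaleC (cnj (a j \<alpha>)) (op_adj (word_prod X \<alpha>)))"
      by (rule op_adj_eqI)
        (simp add: blinfun.sum_left op_scaleC.rep_eq cinner.sum_left cinner.sum_right
          cinner_scaleC_left cinner_scaleC_right cinner_op_adj word_prod_BH BH)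
    then show ?thesis by (simp add: p_def blinfun.sum_left op_scaleC.rep_eq)
  qed
  have y_eq: "(\<Sum>\<alpha> | length \<alpha> < N - length \<beta>. cnj (a j \<alpha>) *\<^sub>C v (\<alpha> @ \<beta>)) = y N j \<beta>" for N j \<beta>
  proof -
    have "cnj (a j \<alpha>) *\<^sub>C v (\<alpha> @ \<beta>) =
        op_adj (word_prod X \<beta>) (cnj (a j \<alpha>) *\<^sub>C op_adj (word_prod X \<alpha>) h)
        + (cnj (scalar_word z \<beta>) * cnj (a j \<alpha> * scalar_word z \<alpha>)) *\<^sub>C g" for \<alpha>
      by (simp add: v_def op_adj_word_append BH op_adj_scaleC word_prod_BH scalar_word_append
          scaleC_add_right scaleC_scaleC mult_ac)
    then show ?thesis
      by (simp add: y_def p_eq c_def sum.distrib blinfun.sum_right scaleC_scaleC cnj_sum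
          sum_distrib_left scaleC.sum_left scaleC.sum_right)
  qed
  have p_lim: "p j \<longlonglongrightarrow> op_adj (\<phi> X $ j) h" for j
    unfolding p_def
  proof (rule op_adj_tendsto)
    show "(\<lambda>m. \<Sum>\<alpha> | length \<alpha> < m. op_scaleC (a j \<alpha>) (word_prod X \<alpha>)) \<longlonglongrightarrow> \<phi> X $ j"
      using expansion[OF X, of j] unfolding sums_def sum_words_by_length .
  qed (auto intro!: BH_sum BH_comb word_prod_BH BH \<phi>_BH X)
  have c_lim: "c j \<longlonglongrightarrow> scalar_map z $ j" for j
    using scalar_map_sums[OF z, of j] unfolding sums_def sum_words_by_length c_def[abs_def] .
  define Y where "Y j \<beta> = op_adj (word_prod X \<beta>) (op_adj (\<phi> X $ j) h)
      + cnj (scalar_word z \<beta>) *\<^sub>C cnj (scalar_map z $ j) *\<^sub>C g" for j \<beta>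
  have shift: "filterlim (\<lambda>N. N - m) sequentially sequentially" for m :: nat
    by (rule filterlim_minus_const_nat_at_top)
  have y_lim: "(\<lambda>N. y N j \<beta>) \<longlonglongrightarrow> Y j \<beta>" for j \<beta>
    unfolding y_def Y_def
    by (intro tendsto_intros scaleC.tendsto blinfun.tendsto tendsto_cnj
        filterlim_compose[OF p_lim shift] filterlim_compose[OF c_lim shift])
  have defect_lim: "(\<lambda>N. Re (defect X (y N j \<beta>) (y N j \<beta>))) \<longlonglongrightarrow> Re (defect X (Y j \<beta>) (Y j \<beta>))" for j \<beta>
    unfolding defect_def by (intro tendsto_intros cinner.tendsto blinfun.tendsto y_lim)
  have "(\<Sum>j\<in>UNIV. \<Sum>\<beta> | length \<beta> < M. Re (defect X (Y j \<beta>) (Y j \<beta>)))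
      \<le> (norm (k - adj_comb z X k))\<^sup>2 + 2 * Re (defect X k g) + Re (defect X g g) / (1 - (norm z)\<^sup>2)"
  proof (rule LIMSEQ_le)
    show "(\<lambda>N. \<Sum>j\<in>UNIV. \<Sum>\<beta> | length \<beta> < M. Re (defect X (y N j \<beta>) (y N j \<beta>))) \<longlonglongrightarrow>
        (\<Sum>j\<in>UNIV. \<Sum>\<beta> | length \<beta> < M. Re (defect X (Y j \<beta>) (Y j \<beta>)))"
      by (intro tendsto_sum defect_lim)
    show "(\<lambda>N. \<Sum>\<gamma> | length \<gamma> < N. Re (defect X (v \<gamma>) (v \<gamma>))) \<longlonglongrightarrow>
        (norm (k - adj_comb z X k))\<^sup>2 + 2 * Re (defect X k g) + Re (defect X g g) / (1 - (norm z)\<^sup>2)"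
      unfolding v_def h[symmetric] by (rule kernel_energy_tendsto[OF X z])
    have "(\<Sum>j\<in>UNIV. \<Sum>\<beta> | length \<beta> < M. Re (defect X (y N j \<beta>) (y N j \<beta>))) \<le>
        (\<Sum>\<gamma> | length \<gamma> < N. Re (defect X (v \<gamma>) (v \<gamma>)))" if "N \<ge> M" for N
    proof -
      have "(\<Sum>j\<in>UNIV. \<Sum>\<beta> | length \<beta> < M. Re (defect X (y N j \<beta>) (y N j \<beta>))) \<le>
          (\<Sum>j\<in>UNIV. \<Sum>\<beta> | length \<beta> < N. Re (defect X (y N j \<beta>) (y N j \<beta>)))"
        using that by (intro sum_mono sum_mono2 finite_words nonneg) auto
      also have "\<dots> \<le> (\<Sum>\<gamma> | length \<gamma> < N. Re (defect X (v \<gamma>) (v \<gamma>)))"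
        using vector_contraction[OF psd_form_defect[OF X], of v N] unfolding y_eq .
      finally show ?thesis .
    qed
    then show "\<exists>M'. \<forall>N\<ge>M'. (\<Sum>j\<in>UNIV. \<Sum>\<beta> | length \<beta> < M. Re (defect X (y N j \<beta>) (y N j \<beta>))) \<le>
        (\<Sum>\<gamma> | length \<gamma> < N. Re (defect X (v \<gamma>) (v \<gamma>)))" by blast
  qed
  then show ?thesis unfolding Y_def h .
qed

text \<open>The vector g in the kernel inequality is free; at g = - k the mixed terms combine to -2
  D, where D is the defect form at k. This leaves 2 D \<le> (defect of \<phi> X at h) + (t / s) D,
  and t \<le> s, which is the assumption on the norms of z and its image, absorbs one D.\<close>

lemma schwarz_pick:
  fixes X :: "('h, 'n) optuple"
  assumes X: "X \<in> nc_ball" and z: "norm z < 1" and le: "norm z \<le> norm (scalar_map z)"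
    and k: "k - adj_comb z X k = h - adj_comb (scalar_map z) (\<phi> X) h"
  shows "(norm k)\<^sup>2 - row_form X k \<le> (norm h)\<^sup>2 - row_form (\<phi> X) h"
proof -
  interpret psd_form "defect X" by (rule psd_form_defect[OF X])
  define w where "w = scalar_map z"
  define s where "s = 1 - (norm z)\<^sup>2"
  define t where "t = 1 - (norm w)\<^sup>2"
  define yh where "yh j = op_adj (\<phi> X $ j) h" for j
  have s: "s > 0" using z by (simp add: s_def power_less_one_iff)
  have ts: "t \<le> s" using le by (simp add: s_def t_def w_def power_mono)
  obtain R where R: "\<And>h. R h - adj_comb z X (R h) = h"
    using adj_resolvent[OF X less_imp_le[OF z]] by metis
  have BH: "\<And>i. X $ i \<in> BH" using X unfolding nc_ball_iff by blast
  \<comment> \<open>\<open>R\<close> is only a choice of solutions; its linearity is recovered here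
    from the uniqueness in \<open>adj_resolvent\<close>.\<close>
  have "k = R h - (\<Sum>j\<in>UNIV. w $ j *\<^sub>C R (yh j))"
  proof -
    interpret L: bounded_linear "adj_comb z X" by (rule bounded_linear_adj_comb)
    have "(R h - (\<Sum>j\<in>UNIV. w $ j *\<^sub>C R (yh j))) - adj_comb z X (R h - (\<Sum>j\<in>UNIV. w $ j *\<^sub>C R (yh j)))
        = (R h - adj_comb z X (R h)) - (\<Sum>j\<in>UNIV. w $ j *\<^sub>C (R (yh j) - adj_comb z X (R (yh j))))"
      by (simp add: L.diff L.sum adj_comb_scaleC[OF BH] scaleC.diff_right sum_subtractf)
    also have "\<dots> = h - adj_comb w (\<phi> X) h" unfolding R by (simp add: adj_comb_def yh_def)
    finally show ?thesis
      using adj_resolvent[OF X less_imp_le[OF z], of "h - adj_comb w (\<phi> X) h"] k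
      unfolding w_def by blast
  qed
  then have k_eq: "Re (defect X k k) = Re (defect X (R h) k) - (\<Sum>j\<in>UNIV. Re (w $ j * defect X (R (yh j)) k))"
    by (subst (2) \<open>k = _\<close>) (simp add: diff_left sum_left scale_left)
  have main: "(\<Sum>j\<in>UNIV. (norm (yh j))\<^sup>2 + 2 * Re (defect X (R (yh j)) (cnj (w $ j) *\<^sub>C g))
        + Re (defect X (cnj (w $ j) *\<^sub>C g) (cnj (w $ j) *\<^sub>C g)) / s)
      \<le> (norm h)\<^sup>2 + 2 * Re (defect X (R h) g) + Re (defect X g g) / s" for g
  proof (rule LIMSEQ_le_const2)
    show "(\<lambda>M. \<Sum>j\<in>UNIV. \<Sum>\<beta> | length \<beta> < M.
      Re (defect X (op_adj (word_prod X \<beta>) (yh j) + cnj (scalar_word z \<beta>) *\<^sub>C cnj (w $ j) *\<^sub>C g)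
                   (op_adj (word_prod X \<beta>) (yh j) + cnj (scalar_word z \<beta>) *\<^sub>C cnj (w $ j) *\<^sub>C g)))
      \<longlonglongrightarrow> (\<Sum>j\<in>UNIV. (norm (yh j))\<^sup>2 + 2 * Re (defect X (R (yh j)) (cnj (w $ j) *\<^sub>C g))
        + Re (defect X (cnj (w $ j) *\<^sub>C g) (cnj (w $ j) *\<^sub>C g)) / s)"
    proof (rule tendsto_sum)
      fix j
      show "(\<lambda>M. \<Sum>\<beta> | length \<beta> < M.
        Re (defect X (op_adj (word_prod X \<beta>) (yh j) + cnj (scalar_word z \<beta>) *\<^sub>C cnj (w $ j) *\<^sub>C g)
                     (op_adj (word_prod X \<beta>) (yh j) + cnj (scalar_word z \<beta>) *\<^sub>C cnj (w $ j) *\<^sub>C g)))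
        \<longlonglongrightarrow> (norm (yh j))\<^sup>2 + 2 * Re (defect X (R (yh j)) (cnj (w $ j) *\<^sub>C g))
          + Re (defect X (cnj (w $ j) *\<^sub>C g) (cnj (w $ j) *\<^sub>C g)) / s"
        using kernel_energy_tendsto[OF X z, of "R (yh j)" "cnj (w $ j) *\<^sub>C g"] unfolding R s_def .
    qed
  qed (use kernel_energy_le[OF X z R] in \<open>auto simp: yh_def w_def s_def\<close>)
  define d where "d j = Re (w $ j * defect X (R (yh j)) k)" for j
  have "(\<Sum>j\<in>UNIV. (norm (yh j))\<^sup>2 - 2 * d j + (cmod (w $ j))\<^sup>2 * Re (defect X k k) / s)
      \<le> (norm h)\<^sup>2 - 2 * Re (defect X (R h) k) + Re (defect X k k) / s"
  proof -
    have "Re (defect X (R (yh j)) (cnj (w $ j) *\<^sub>C (- k))) = - d j" for j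
      by (simp add: scale_right minus_right scaleC.minus_right d_def)
    then show ?thesis
      using main[of "- k"] unfolding scale_self by (simp add: minus_left minus_right)
  qed
  then have "row_form (\<phi> X) h - 2 * (\<Sum>j\<in>UNIV. d j) + (norm w)\<^sup>2 * Re (defect X k k) / s
      \<le> (norm h)\<^sup>2 - 2 * Re (defect X (R h) k) + Re (defect X k k) / s"
    unfolding norm_vec_sq row_form_def yh_def[symmetric]
    by (simp add: sum.distrib sum_subtractf sum_distrib_left sum_distrib_right sum_divide_distrib)
  then have "2 * Re (defect X k k) \<le> (norm h)\<^sup>2 - row_form (\<phi> X) h + t * (Re (defect X k k) / s)"
  proof -
    have "t * (Re (defect X k k) / s) = Re (defect X k k) / s - (norm w)\<^sup>2 * Re (defect X k k) / s"
      by (simp add: t_def left_diff_distrib diff_divide_distrib)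
    then show ?thesis
      using k_eq \<open>row_form (\<phi> X) h - 2 * (\<Sum>j\<in>UNIV. d j) + _ \<le> _\<close> unfolding d_def[symmetric] by linarith
  qed
  also have "t * (Re (defect X k k) / s) \<le> s * (Re (defect X k k) / s)"
    by (intro mult_right_mono ts divide_nonneg_pos nonneg s)
  also have "\<dots> = Re (defect X k k)" using s by simp
  finally have "Re (defect X k k) \<le> (norm h)\<^sup>2 - row_form (\<phi> X) h" by simp
  then show ?thesis by (simp add: defect_self)
qed

end

lemma tendsto_row_form: "f \<longlonglongrightarrow> h \<Longrightarrow> (\<lambda>n. row_form X (f n)) \<longlonglongrightarrow> row_form X h"
  unfolding row_form_def by (intro tendsto_intros blinfun.tendsto)

lemma tendsto_adj_comb: "z \<longlonglongrightarrow> \<zeta> \<Longrightarrow> (\<lambda>n. adj_comb (z n) X h) \<longlonglongrightarrow> adj_comb \<zeta> X h"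
  unfolding adj_comb_def by (intro tendsto_intros scaleC.tendsto)

context nc_self_map
begin

subsection \<open>The boundary fixed point\<close>

text \<open>Julia's inequality at \<zeta> with constant 1. The equation between k and h replaces the
  resolvents of X and \<phi> X at \<zeta>. The map itself is never evaluated at \<zeta>.\<close>

definition boundary_fixed_point :: "complex ^ 'n \<Rightarrow> bool" where
  "boundary_fixed_point \<zeta> \<longleftrightarrow> norm \<zeta> = 1 \<and>
    (\<forall>X\<in>nc_ball. \<forall>h k. k - adj_comb \<zeta> X k = h - adj_comb \<zeta> (\<phi> X) h \<longrightarrow>
      (norm k)\<^sup>2 - row_form X k \<le> (norm h)\<^sup>2 - row_form (\<phi> X) h)"

text \<open>Continuity is known only on the open unit ball, while Brouwer's theorem needs a compact
  set: r times the map sends the closed ball of radius r into itself.\<close>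

lemma dilated_fixed_point:
  assumes r: "0 < r" "r < 1"
  obtains z where "norm z < 1" "r *\<^sub>R scalar_map z = z"
proof -
  have sub: "cball 0 r \<subseteq> ball (0 :: complex ^ 'n) 1" using r by auto
  have "continuous_on (cball 0 r) (\<lambda>z. r *\<^sub>R scalar_map z)"
    using scalar_map_continuous sub by (intro continuous_intros) (rule continuous_on_subset)
  moreover have "norm (r *\<^sub>R scalar_map z) \<le> r" if "z \<in> cball 0 r" for z
    using scalar_map_ball[of z] that sub r by (auto intro!: mult_left_le simp: less_imp_le)
  then have "(\<lambda>z. r *\<^sub>R scalar_map z) \<in> cball 0 r \<rightarrow> cball 0 r" by auto
  ultimately obtain z where "z \<in> cball 0 r" "r *\<^sub>R scalar_map z = z"
    using brouwer[of "cball 0 r" "\<lambda>z. r *\<^sub>R scalar_map z"] r by auto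
  then show thesis using that sub by auto
qed

lemma boundary_fixed_point_exists:
  assumes no_fix: "\<And>z. norm z < 1 \<Longrightarrow> scalar_map z \<noteq> z"
  shows "\<exists>\<zeta>. boundary_fixed_point \<zeta>"
proof -
  \<comment> \<open>The offset 2 keeps every \<open>r n\<close> strictly between 0 and 1, also for n
    = 0.\<close>
  define r where "r n = 1 - 1 / real (n + 2)" for n
  have r: "0 < r n" "r n < 1" for n by (auto simp: r_def field_simps)
  obtain z where z: "\<And>n. norm (z n) < 1" and fix_z: "\<And>n. r n *\<^sub>R scalar_map (z n) = z n"
  proof -
    have "\<exists>z. norm z < 1 \<and> r n *\<^sub>R scalar_map z = z" for n
      using dilated_fixed_point[OF r, of n] by blast
    then show thesis using that by metis
  qed
  have "compact (cball 0 1 :: (complex ^ 'n) set)" by simp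
  moreover have "\<forall>n. z n \<in> cball 0 1" using z by (simp add: less_imp_le)
  ultimately obtain \<zeta> s where \<zeta>: "\<zeta> \<in> cball 0 1" and s: "strict_mono (s :: nat \<Rightarrow> nat)"
    and "(z \<circ> s) \<longlonglongrightarrow> \<zeta>"
    unfolding compact_def by blast
  then have z_lim: "(\<lambda>n. z (s n)) \<longlonglongrightarrow> \<zeta>" by (simp add: comp_def)
  have w: "scalar_map (z n) = (1 / r n) *\<^sub>R z n" for n
    using r(1)[of n] by (subst (2) fix_z[symmetric]) simp
  have "(\<lambda>n. r (s n)) \<longlonglongrightarrow> 1"
  proof -
    have "r \<longlonglongrightarrow> 1 - 0"
      unfolding r_def by (intro tendsto_intros LIMSEQ_ignore_initial_segment[OF lim_1_over_n])
    then show ?thesis using LIMSEQ_subseq_LIMSEQ[OF _ s] by (auto simp: comp_def)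
  qed
  then have "(\<lambda>n. (1 / r (s n)) *\<^sub>R z (s n)) \<longlonglongrightarrow> (1 / 1) *\<^sub>R \<zeta>"
    by (intro tendsto_intros z_lim) auto
  then have w_lim: "(\<lambda>n. scalar_map (z (s n))) \<longlonglongrightarrow> \<zeta>" by (simp add: w)
  \<comment> \<open>Undoing the dilation enlarges the norm; this is the assumption under which
    \<open>schwarz_pick\<close> has constant 1.\<close>
  have le: "norm (z n) \<le> norm (scalar_map (z n))" for n
    unfolding w using r[of n] by (simp add: le_divide_eq mult_left_le)
  have "norm \<zeta> = 1"
  proof (rule ccontr)
    assume "norm \<zeta> \<noteq> 1"
    with \<zeta> have "norm \<zeta> < 1" by auto
    then have "isCont scalar_map \<zeta>"
      using scalar_map_continuous by (simp add: continuous_on_eq_continuous_at)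
    then have "(\<lambda>n. scalar_map (z (s n))) \<longlonglongrightarrow> scalar_map \<zeta>"
      using z_lim by (rule isCont_tendsto_compose)
    then have "scalar_map \<zeta> = \<zeta>" using w_lim LIMSEQ_unique by blast
    with no_fix \<open>norm \<zeta> < 1\<close> show False by blast
  qed
  moreover have "(norm k)\<^sup>2 - row_form X k \<le> (norm h)\<^sup>2 - row_form (\<phi> X) h"
    if X: "X \<in> nc_ball" and k: "k - adj_comb \<zeta> X k = h - adj_comb \<zeta> (\<phi> X) h" for X h k
  proof -
    \<comment> \<open>The vector h stays fixed. Since k solves its equation only at \<zeta>, it is
      approximated by vectors \<kappa> n solving the equation at z (s n); the uniform constant c
      forces them to converge to k.\<close>
    define g where "g n = h - adj_comb (scalar_map (z (s n))) (\<phi> X) h" for n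
    define \<kappa> where "\<kappa> n = (THE k. k - adj_comb (z (s n)) X k = g n)" for n
    have \<kappa>: "\<kappa> n - adj_comb (z (s n)) X (\<kappa> n) = g n" for n
      unfolding \<kappa>_def by (rule theI'[OF adj_resolvent[OF X less_imp_le[OF z]]])
    obtain c where c: "c < 1" "\<And>z h. norm z \<le> 1 \<Longrightarrow> norm (adj_comb z X h) \<le> c * norm h"
      using adj_comb_contraction[OF X] by metis
    have bound: "(1 - c) * norm (\<kappa> n - k) \<le> norm (g n - (k - adj_comb (z (s n)) X k))" for n
    proof -
      define \<delta> where "\<delta> = \<kappa> n - k"
      have "\<delta> - adj_comb (z (s n)) X \<delta> = g n - (k - adj_comb (z (s n)) X k)"
        unfolding \<delta>_def \<kappa>[symmetric] adj_comb_diff by (simp add: algebra_simps)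
      moreover have "norm \<delta> - norm (adj_comb (z (s n)) X \<delta>) \<le> norm (\<delta> - adj_comb (z (s n)) X \<delta>)"
        by (rule norm_triangle_ineq2)
      moreover have "norm (adj_comb (z (s n)) X \<delta>) \<le> c * norm \<delta>"
        by (rule c(2)[OF less_imp_le[OF z]])
      ultimately show ?thesis unfolding \<delta>_def[symmetric] by (simp add: left_diff_distrib)
    qed
    have "(\<lambda>n. norm (g n - (k - adj_comb (z (s n)) X k)) / (1 - c)) \<longlonglongrightarrow>
        norm ((h - adj_comb \<zeta> (\<phi> X) h) - (k - adj_comb \<zeta> X k)) / (1 - c)"
      unfolding g_def using c(1) by (intro tendsto_intros tendsto_adj_comb z_lim w_lim) auto
    then have lim: "(\<lambda>n. norm (g n - (k - adj_comb (z (s n)) X k)) / (1 - c)) \<longlonglongrightarrow> 0" by (simp add: k)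
    have "(\<lambda>n. \<kappa> n - k) \<longlonglongrightarrow> 0"
      by (rule Lim_null_comparison[OF _ lim]) (use bound c(1) in \<open>simp add: le_divide_eq mult.commute\<close>)
    then have \<kappa>_lim: "\<kappa> \<longlonglongrightarrow> k" by (rule LIM_zero_cancel)
    show ?thesis
    proof (rule LIMSEQ_le_const2)
      show "(\<lambda>n. (norm (\<kappa> n))\<^sup>2 - row_form X (\<kappa> n)) \<longlonglongrightarrow> (norm k)\<^sup>2 - row_form X k"
        by (intro tendsto_intros tendsto_row_form \<kappa>_lim)
      show "\<exists>N. \<forall>n\<ge>N. (norm (\<kappa> n))\<^sup>2 - row_form X (\<kappa> n) \<le> (norm h)\<^sup>2 - row_form (\<phi> X) h"
        using schwarz_pick[OF X z le] \<kappa> unfolding g_def by blast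
    qed
  qed
  ultimately show ?thesis unfolding boundary_fixed_point_def by blast
qed

end

locale nc_self_map_ordered = nc_self_map \<phi> a
  for \<phi> :: "('h::complex_hilbert, 'n::{finite,linorder}) optuple \<Rightarrow> ('h, 'n) optuple"
    and a :: "'n \<Rightarrow> 'n list \<Rightarrow> complex"
begin

text \<open>For a paired k and h the squared terms agree and the defect does not decrease from k to
  h. Only the margin needs work: (1 - d) |h| \<le> 2 |k|, where d is a contraction constant at
  \<phi> X, and this is the origin of the factor ((1 - d) / 2)^2.\<close>

lemma ellipsoid_invariant:
  assumes \<zeta>: "boundary_fixed_point \<zeta>" and c: "0 < c" "c < 1" and X: "X \<in> ellipsoid c \<zeta>"
  shows "\<phi> X \<in> ellipsoid c \<zeta>"
proof -
  have norm_\<zeta>: "norm \<zeta> = 1" using \<zeta> by (simp add: boundary_fixed_point_def)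
  have X_ball: "X \<in> nc_ball" using ellipsoid_subset_nc_ball[OF c norm_\<zeta>] X by blast
  obtain e where e: "e > 0" and gap: "\<And>k. (norm (k - adj_comb \<zeta> X k))\<^sup>2 + e * (norm k)\<^sup>2 \<le>
      c / (1 - c) * ((norm k)\<^sup>2 - row_form X k)"
    using X unfolding ellipsoid_iff[OF c norm_\<zeta>] ellipsoid_gap_def by blast
  obtain b where b: "b < 1" "\<And>h. norm (adj_comb \<zeta> X h) \<le> b * norm h"
    using adj_comb_contraction[OF X_ball] norm_\<zeta> by (metis order_refl)
  obtain d where d: "d < 1" "\<And>h. norm (adj_comb \<zeta> (\<phi> X) h) \<le> d * norm h"
    using adj_comb_contraction[OF maps[OF X_ball]] norm_\<zeta> by (metis order_refl)
  have "(norm (h - adj_comb \<zeta> (\<phi> X) h))\<^sup>2 + e * ((1 - d) / 2)\<^sup>2 * (norm h)\<^sup>2 \<le>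
      c / (1 - c) * ((norm h)\<^sup>2 - row_form (\<phi> X) h)" for h
  proof -
    obtain k where k: "k - adj_comb \<zeta> X k = h - adj_comb \<zeta> (\<phi> X) h"
      using adj_resolvent[OF X_ball, of \<zeta>] norm_\<zeta> by (metis order_refl)
    have "(1 - d) * norm h \<le> norm (h - adj_comb \<zeta> (\<phi> X) h)"
      using norm_triangle_ineq2[of h "adj_comb \<zeta> (\<phi> X) h"] d(2)[of h] by (simp add: algebra_simps)
    also have "\<dots> \<le> norm k + norm (adj_comb \<zeta> X k)"
      unfolding k[symmetric] by (rule norm_triangle_ineq4)
    also have "\<dots> \<le> 2 * norm k"
      using b(2)[of k] mult_right_mono[OF less_imp_le[OF b(1)], of "norm k"] by simp
    finally have "((1 - d) / 2 * norm h)\<^sup>2 \<le> (norm k)\<^sup>2"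
      using d(1) by (intro power_mono) auto
    then have "((1 - d) / 2)\<^sup>2 * (norm h)\<^sup>2 \<le> (norm k)\<^sup>2"
      by (simp only: power_mult_distrib)
    then have "e * (((1 - d) / 2)\<^sup>2 * (norm h)\<^sup>2) \<le> e * (norm k)\<^sup>2"
      by (rule mult_left_mono) (use e in simp)
    then have "(norm (h - adj_comb \<zeta> (\<phi> X) h))\<^sup>2 + e * ((1 - d) / 2)\<^sup>2 * (norm h)\<^sup>2 \<le>
        (norm (k - adj_comb \<zeta> X k))\<^sup>2 + e * (norm k)\<^sup>2"
      by (simp add: k mult.assoc)
    also have "\<dots> \<le> c / (1 - c) * ((norm k)\<^sup>2 - row_form X k)" by (rule gap)
    also have "\<dots> \<le> c / (1 - c) * ((norm h)\<^sup>2 - row_form (\<phi> X) h)"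
      using \<zeta> X_ball k c unfolding boundary_fixed_point_def by (intro mult_left_mono) auto
    finally show ?thesis .
  qed
  moreover have "e * ((1 - d) / 2)\<^sup>2 > 0" using e d(1) by simp
  ultimately have "ellipsoid_gap c \<zeta> (\<phi> X)" unfolding ellipsoid_gap_def by blast
  then show ?thesis
    unfolding ellipsoid_iff[OF c norm_\<zeta>] using \<phi>_BH[OF X_ball] by blast
qed

end

subsection \<open>Uniqueness: scalar ellipsoids are strictly convex\<close>

text \<open>The numerator of the horosphere function at \<zeta>, kept apart from the denominator 1 -
  |z|^2 so that it is convex and continuous up to the sphere.\<close>

definition horo :: "complex ^ 'n \<Rightarrow> complex ^ 'n::finite \<Rightarrow> real" where
  "horo \<zeta> z = (cmod (1 - (\<Sum>i\<in>UNIV. \<zeta> $ i * cnj (z $ i))))\<^sup>2"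

lemma continuous_on_horo: "continuous_on S (horo \<zeta>)"
  unfolding horo_def by (intro continuous_intros)

lemma norm_midpoint_sq:
  fixes x y :: "'a::real_inner"
  shows "(norm ((1/2) *\<^sub>R (x + y)))\<^sup>2 = ((norm x)\<^sup>2 + (norm y)\<^sup>2) / 2 - (norm (x - y))\<^sup>2 / 4"
  by (simp only: power2_norm_eq_inner) (simp add: inner_simps inner_commute field_simps)

lemma horo_midpoint: "horo \<zeta> ((1/2) *\<^sub>R (x + y)) \<le> (horo \<zeta> x + horo \<zeta> y) / 2"
proof -
  define p where "p z = 1 - (\<Sum>i\<in>UNIV. \<zeta> $ i * cnj (z $ i))" for z
  have eq: "p ((1/2) *\<^sub>R (x + y)) = (1/2) *\<^sub>R (p x + p y)"
  proof -
    have "(\<Sum>i\<in>UNIV. \<zeta> $ i * cnj (((1/2) *\<^sub>R (x + y)) $ i)) =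
        (1/2) *\<^sub>R ((\<Sum>i\<in>UNIV. \<zeta> $ i * cnj (x $ i)) + (\<Sum>i\<in>UNIV. \<zeta> $ i * cnj (y $ i)))"
      unfolding sum.distrib[symmetric] scaleR_sum_right
      by (intro sum.cong refl) (simp add: algebra_simps)
    then show ?thesis by (simp only: p_def) (simp add: scaleR_conv_of_real field_simps)
  qed
  show ?thesis
    unfolding horo_def p_def[symmetric] eq norm_midpoint_sq
    using zero_le_power2[of "cmod (p x - p y)"] by argo
qed

text \<open>The equality case of Cauchy--Schwarz in the closed ball: the real inner product of z and
  \<zeta> is 1, which leaves no room for |z - \<zeta>|^2.\<close>

lemma horo_eq_0:
  assumes "horo \<zeta> z = 0" "norm \<zeta> = 1" "norm z \<le> 1"
  shows "z = \<zeta>"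
proof -
  have "(\<Sum>i\<in>UNIV. \<zeta> $ i * cnj (z $ i)) = 1" using assms(1) by (simp add: horo_def)
  then have "Re (\<Sum>i\<in>UNIV. \<zeta> $ i * cnj (z $ i)) = 1" by simp
  then have "inner \<zeta> z = 1" by (simp add: inner_vec_def inner_complex_def)
  moreover have "(norm (z - \<zeta>))\<^sup>2 = (norm z)\<^sup>2 + (norm \<zeta>)\<^sup>2 - 2 * inner \<zeta> z"
    by (simp add: power2_norm_eq_inner inner_diff inner_commute)
  moreover have "(norm z)\<^sup>2 \<le> 1" using assms(3) by (simp add: power_le_one)
  ultimately have "(norm (z - \<zeta>))\<^sup>2 \<le> 0" using assms(2) by simp
  then show ?thesis by simp
qed

text \<open>At a scalar tuple every form involved is a multiple of |h|^2, so a uniform margin is the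
  same as strict inequality between two numbers.\<close>

lemma scalar_tuple_ellipsoid_iff:
  fixes z \<zeta> :: "complex ^ 'n::{finite,linorder}"
  assumes c: "0 < c" "c < 1" and \<zeta>: "norm \<zeta> = 1" and h0: "(h0::'h::complex_hilbert) \<noteq> 0"
  shows "(scalar_tuple z :: ('h, 'n) optuple) \<in> ellipsoid c \<zeta> \<longleftrightarrow>
    horo \<zeta> z < c / (1 - c) * (1 - (norm z)\<^sup>2)"
proof -
  have diff: "h - adj_comb \<zeta> (scalar_tuple z) h = (1 - (\<Sum>i\<in>UNIV. \<zeta> $ i * cnj (z $ i))) *\<^sub>C h" for h :: 'h
    by (simp add: adj_comb_scalar scaleC.diff_left scaleC_one)
  have "(norm (h - adj_comb \<zeta> (scalar_tuple z) h))\<^sup>2 + e * (norm h)\<^sup>2 \<le>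
        c / (1 - c) * ((norm h)\<^sup>2 - row_form (scalar_tuple z) h) \<longleftrightarrow>
      (horo \<zeta> z + e) * (norm h)\<^sup>2 \<le> c / (1 - c) * (1 - (norm z)\<^sup>2) * (norm h)\<^sup>2" for h :: 'h and e
  proof -
    have "(norm (h - adj_comb \<zeta> (scalar_tuple z) h))\<^sup>2 = horo \<zeta> z * (norm h)\<^sup>2"
      by (simp only: diff norm_scaleC horo_def power_mult_distrib)
    then show ?thesis by (simp only: row_form_scalar) (simp add: algebra_simps)
  qed
  then have "(scalar_tuple z :: ('h, 'n) optuple) \<in> ellipsoid c \<zeta> \<longleftrightarrow>
      (\<exists>e>0. \<forall>h::'h. (horo \<zeta> z + e) * (norm h)\<^sup>2 \<le> c / (1 - c) * (1 - (norm z)\<^sup>2) * (norm h)\<^sup>2)"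
    unfolding ellipsoid_iff[OF c \<zeta>] ellipsoid_gap_def by (simp add: scalar_tuple_BH)
  also have "\<dots> \<longleftrightarrow> (\<exists>e>0. horo \<zeta> z + e \<le> c / (1 - c) * (1 - (norm z)\<^sup>2))"
  proof -
    have eq: "(\<forall>h::'h. A * (norm h)\<^sup>2 \<le> B * (norm h)\<^sup>2) \<longleftrightarrow> A \<le> B" for A B :: real
    proof
      assume "\<forall>h::'h. A * (norm h)\<^sup>2 \<le> B * (norm h)\<^sup>2"
      then have "A * (norm h0)\<^sup>2 \<le> B * (norm h0)\<^sup>2" by blast
      then show "A \<le> B" using h0 by simp
    qed (simp add: mult_right_mono)
    show ?thesis unfolding eq ..
  qed
  also have "\<dots> \<longleftrightarrow> horo \<zeta> z < c / (1 - c) * (1 - (norm z)\<^sup>2)"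
  proof -
    have "(\<exists>e>0. A + e \<le> B) \<longleftrightarrow> A < B" for A B :: real
      by (auto intro: exI[of _ "B - A"])
    then show ?thesis by blast
  qed
  finally show ?thesis .
qed

context nc_self_map_ordered
begin

text \<open>The ellipsoids give strict inequalities, while the extremal argument needs closed ones.
  If the bound failed, the level l attained by the image would exceed \<kappa>, and the ellipsoid of
  level l would contain z but not its image.\<close>

lemma horo_invariant:
  assumes inv: "\<And>c. 0 < c \<Longrightarrow> c < 1 \<Longrightarrow> \<phi> ` ellipsoid c \<zeta> \<subseteq> ellipsoid c \<zeta>" and \<zeta>: "norm \<zeta> = 1"
    and z: "norm z < 1" and \<kappa>: "0 < \<kappa>" "horo \<zeta> z \<le> \<kappa> * (1 - (norm z)\<^sup>2)"
  shows "horo \<zeta> (scalar_map z) \<le> \<kappa> * (1 - (norm (scalar_map z))\<^sup>2)"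
proof (rule ccontr)
  assume neg: "\<not> ?thesis"
  obtain h0 :: 'h where h0: "h0 \<noteq> 0" using nontrivial by blast
  have pos: "1 - (norm (scalar_map z))\<^sup>2 > 0" "1 - (norm z)\<^sup>2 > 0"
    using scalar_map_ball[OF z] z by (simp_all add: power_less_one_iff)
  define l where "l = horo \<zeta> (scalar_map z) / (1 - (norm (scalar_map z))\<^sup>2)"
  have l: "\<kappa> < l" using neg pos by (simp add: l_def less_divide_eq)
  \<comment> \<open>This inverts the relation c / (1 - c) = l between centre parameter and
    level.\<close>
  define c where "c = l / (1 + l)"
  have c: "0 < c" "c < 1" "c / (1 - c) = l" using l \<kappa>(1) by (auto simp: c_def field_simps)
  have "horo \<zeta> z < c / (1 - c) * (1 - (norm z)\<^sup>2)"
    unfolding c(3) using \<kappa>(2) mult_strict_right_mono[OF l pos(2)] by linarith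
  then have "(scalar_tuple z :: ('h, 'n) optuple) \<in> ellipsoid c \<zeta>"
    using scalar_tuple_ellipsoid_iff[OF c(1,2) \<zeta> h0] by blast
  then have "\<phi> (scalar_tuple z) \<in> ellipsoid c \<zeta>" using inv[OF c(1,2)] by blast
  then have "horo \<zeta> (scalar_map z) < l * (1 - (norm (scalar_map z))\<^sup>2)"
    unfolding \<phi>_scalar_tuple[OF z] scalar_tuple_ellipsoid_iff[OF c(1,2) \<zeta> h0] c(3) .
  then show False using pos by (simp add: l_def)
qed

text \<open>Minimising \<open>u\<close> over A selects the smallest horoball at \<eta> that still
  meets A. The minimiser p and its image q both lie in A and in that horoball; if they differed,
  their midpoint would lie in A with a smaller value of \<open>u\<close>. So p would be a fixed
  point.\<close>

lemma invariant_point_unique: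
  assumes no_fix: "\<And>z. norm z < 1 \<Longrightarrow> scalar_map z \<noteq> z"
    and \<zeta>: "norm \<zeta> = 1" "\<And>c. 0 < c \<Longrightarrow> c < 1 \<Longrightarrow> \<phi> ` ellipsoid c \<zeta> \<subseteq> ellipsoid c \<zeta>"
    and \<eta>: "norm \<eta> = 1" "\<And>c. 0 < c \<Longrightarrow> c < 1 \<Longrightarrow> \<phi> ` ellipsoid c \<eta> \<subseteq> ellipsoid c \<eta>"
  shows "\<zeta> = \<eta>"
proof (rule ccontr)
  assume ne: "\<zeta> \<noteq> \<eta>"
  \<comment> \<open>Level 1 is chosen because both closed horoballs of this level pass through the
    origin, so A is not empty.\<close>
  define A where "A = {z \<in> cball 0 1. horo \<zeta> z \<le> 1 - (norm z)\<^sup>2 \<and> horo \<eta> z \<le> 1 - (norm z)\<^sup>2}"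
  have ball: "norm z < 1" if "z \<in> A" for z
  proof (rule ccontr)
    assume "\<not> norm z < 1"
    with that have "norm z = 1" "horo \<zeta> z \<le> 0" "horo \<eta> z \<le> 0" by (auto simp: A_def)
    moreover have "0 \<le> horo \<zeta> z" "0 \<le> horo \<eta> z" by (simp_all add: horo_def)
    ultimately have "z = \<zeta>" "z = \<eta>" using \<zeta>(1) \<eta>(1) by (auto intro: horo_eq_0)
    with ne show False by blast
  qed
  define u where "u z = horo \<eta> z / (1 - (norm z)\<^sup>2)" for z
  have pos: "1 - (norm z)\<^sup>2 > 0" if "norm z < 1" for z :: "complex ^ 'n::{finite,linorder}"
    using that by (simp add: power_less_one_iff)
  have "compact A"
  proof -
    have "closed {z. horo \<zeta> z \<le> 1 - (norm z)\<^sup>2}" "closed {z. horo \<eta> z \<le> 1 - (norm z)\<^sup>2}"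
      by (intro closed_Collect_le continuous_on_horo continuous_intros)+
    moreover have "A = cball 0 1 \<inter> ({z. horo \<zeta> z \<le> 1 - (norm z)\<^sup>2} \<inter> {z. horo \<eta> z \<le> 1 - (norm z)\<^sup>2})"
      by (auto simp: A_def)
    ultimately show ?thesis by (simp add: compact_Int_closed closed_Int)
  qed
  moreover have "0 \<in> A" by (simp add: A_def horo_def)
  moreover have "continuous_on A u"
    unfolding u_def using pos ball by (intro continuous_intros continuous_on_horo) fastforce
  ultimately obtain p where p: "p \<in> A" and min: "\<And>z. z \<in> A \<Longrightarrow> u p \<le> u z"
    using continuous_attains_inf[of A u] by blast
  define q where "q = scalar_map p"
  have norm_p: "norm p < 1" using ball[OF p] .
  then have norm_q: "norm q < 1" unfolding q_def by (rule scalar_map_ball)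
  have "p \<noteq> q" using no_fix[OF norm_p] by (simp add: q_def)
  have up: "horo \<eta> p = u p * (1 - (norm p)\<^sup>2)" using pos[OF norm_p] by (simp add: u_def)
  \<comment> \<open>Positivity makes \<open>u p\<close> an admissible level in
    \<open>horo_invariant\<close> and keeps the final decrease strict.\<close>
  have "u p > 0"
  proof -
    have "horo \<eta> p \<noteq> 0" using horo_eq_0[of \<eta> p] \<eta>(1) norm_p by auto
    then show ?thesis using pos[OF norm_p] by (simp add: u_def horo_def)
  qed
  have \<zeta>_q: "horo \<zeta> q \<le> 1 * (1 - (norm q)\<^sup>2)"
    unfolding q_def using p by (intro horo_invariant[OF \<zeta>(2,1) norm_p]) (auto simp: A_def)
  have \<eta>_q1: "horo \<eta> q \<le> 1 * (1 - (norm q)\<^sup>2)"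
    unfolding q_def using p by (intro horo_invariant[OF \<eta>(2,1) norm_p]) (auto simp: A_def)
  have \<eta>_q: "horo \<eta> q \<le> u p * (1 - (norm q)\<^sup>2)"
    unfolding q_def using up \<open>u p > 0\<close> by (intro horo_invariant[OF \<eta>(2,1) norm_p]) auto
  have p_A: "horo \<zeta> p \<le> 1 - (norm p)\<^sup>2" "horo \<eta> p \<le> 1 - (norm p)\<^sup>2"
    using p by (auto simp: A_def)
  define m where "m = (1/2) *\<^sub>R (p + q)"
  have m_sq: "(norm m)\<^sup>2 = ((norm p)\<^sup>2 + (norm q)\<^sup>2) / 2 - (norm (p - q))\<^sup>2 / 4"
    unfolding m_def by (rule norm_midpoint_sq)
  have pq: "(norm (p - q))\<^sup>2 > 0" using \<open>p \<noteq> q\<close> by simp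
  have m1: "horo \<zeta> m \<le> 1 - (norm m)\<^sup>2"
    using horo_midpoint[of \<zeta> p q] \<zeta>_q p_A(1) m_sq pq unfolding m_def[symmetric] by argo
  have m2: "horo \<eta> m \<le> 1 - (norm m)\<^sup>2"
    using horo_midpoint[of \<eta> p q] \<eta>_q1 p_A(2) m_sq pq unfolding m_def[symmetric] by argo
  have "0 \<le> 1 - (norm m)\<^sup>2" using order_trans[OF _ m1, of 0] by (simp only: horo_def zero_le_power2)
  then have "norm m \<le> 1" by (simp add: power_le_one_iff)
  with m1 m2 have m: "m \<in> A" by (simp add: A_def)
  have "horo \<eta> m \<le> (u p * (1 - (norm p)\<^sup>2) + u p * (1 - (norm q)\<^sup>2)) / 2"
    using horo_midpoint[of \<eta> p q] \<eta>_q up unfolding m_def[symmetric] by argo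
  also have "\<dots> = u p * (1 - ((norm p)\<^sup>2 + (norm q)\<^sup>2) / 2)" by (simp add: field_simps)
  \<comment> \<open>Strict convexity of the squared norm: the midpoint of distinct points lies below
    the mean by |p - q|^2 / 4.\<close>
  also have "\<dots> < u p * (1 - (norm m)\<^sup>2)"
    using m_sq pq \<open>u p > 0\<close> by (intro mult_strict_left_mono) auto
  finally have "u m < u p" using pos[OF ball[OF m]] by (simp add: u_def divide_less_eq)
  with min[OF m] show False by simp
qed

end

section \<open>Identification of the scalar representation; existence and uniqueness of the boundary
  point\<close>

lemma scalar_tuple_inject:
  assumes "(h0::'h::complex_hilbert) \<noteq> 0"
  shows "(scalar_tuple z :: ('h, 'n::finite) optuple) = scalar_tuple w \<longleftrightarrow> z = w"
proof
  assume eq: "(scalar_tuple z :: ('h, 'n) optuple) = scalar_tuple w"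
  have "z $ i = w $ i" for i
  proof -
    have "(scalar_tuple z $ i) h0 = (scalar_tuple w $ i) h0" by (simp only: eq)
    then have "(z $ i - w $ i) *\<^sub>C h0 = 0"
      by (simp add: scalar_tuple_def op_scaleC.rep_eq scaleC.diff_left)
    then show ?thesis using assms norm_scaleC[of "z $ i - w $ i" h0] by simp
  qed
  then show "z = w" by (simp add: vec_eq_iff)
qed simp

theorem theorem3p1:
  fixes \<phi> :: "('h::complex_hilbert, 'n::{finite,linorder}) optuple \<Rightarrow> ('h, 'n) optuple"
  assumes separable: "separable_space (euclidean :: 'h topology)"
    and infinite_dim: "\<not> (\<exists>B :: 'h set. finite B \<and> cspan B = UNIV)"
    and maps: "\<phi> ` nc_ball \<subseteq> nc_ball"
    and holo: "free_holomorphic_map \<phi>"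
    and no_fixed_points: "\<not> (\<exists>z\<in>ball 0 1. scalar_rep \<phi> z = z)"
  shows "\<exists>!\<zeta> :: complex ^ 'n::{finite,linorder}. \<zeta> \<in> sphere 0 1 \<and>
           (\<forall>c\<in>{0<..<1}. \<forall>k\<ge>1. (\<phi> ^^ k) ` ellipsoid c \<zeta> \<subseteq> ellipsoid c \<zeta>)"
proof -
  obtain a where a: "\<And>j X. X \<in> nc_ball \<Longrightarrow>
      (\<lambda>k. \<Sum>\<alpha> | length \<alpha> = k. op_scaleC (a j \<alpha>) (word_prod X \<alpha>)) sums (\<phi> X $ j)"
  proof -
    have "\<exists>b. \<forall>X\<in>nc_ball. (\<lambda>k. \<Sum>\<alpha> | length \<alpha> = k. op_scaleC (b \<alpha>) (word_prod X \<alpha>)) sums (\<phi> X $ j)" for j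
      using holo unfolding free_holomorphic_map_def free_holomorphic_def by blast
    then obtain a where "\<forall>j. \<forall>X\<in>nc_ball.
        (\<lambda>k. \<Sum>\<alpha> | length \<alpha> = k. op_scaleC (a j \<alpha>) (word_prod X \<alpha>)) sums (\<phi> X $ j)"
      using choice[of "\<lambda>j b. \<forall>X\<in>nc_ball. (\<lambda>k. \<Sum>\<alpha> | length \<alpha> = k. op_scaleC (b \<alpha>) (word_prod X \<alpha>)) sums (\<phi> X $ j)"]
      by blast
    then show thesis using that by blast
  qed
  interpret nc_self_map_ordered \<phi> a
    by unfold_locales (use infinite_dim maps a in auto)
  obtain h0 :: 'h where h0: "h0 \<noteq> 0" using nontrivial by blast
  have no_fix: "scalar_map z \<noteq> z" if "norm z < 1" for z
  proof -
    \<comment> \<open>The description operator is resolved here: on a nonzero space a scalar tuple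
      determines its scalars.\<close>
    have "scalar_rep \<phi> z = scalar_map z"
      unfolding scalar_rep_def \<phi>_scalar_tuple[OF that] by (rule the_equality) (auto simp: scalar_tuple_inject[OF h0])
    then show ?thesis using no_fixed_points that by auto
  qed
  obtain \<zeta> where \<zeta>: "boundary_fixed_point \<zeta>"
    using boundary_fixed_point_exists[OF no_fix] by blast
  show ?thesis
  proof (rule ex1I)
    have "(\<phi> ^^ k) ` ellipsoid c \<zeta> \<subseteq> ellipsoid c \<zeta>" if "c \<in> {0<..<1}" for c k
      by (induction k) (use ellipsoid_invariant[OF \<zeta>] that in auto)
    then show "\<zeta> \<in> sphere 0 1 \<and> (\<forall>c\<in>{0<..<1}. \<forall>k\<ge>1. (\<phi> ^^ k) ` ellipsoid c \<zeta> \<subseteq> ellipsoid c \<zeta>)"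
      using \<zeta> by (simp add: boundary_fixed_point_def)
  next
    fix \<eta> :: "complex ^ 'n::{finite,linorder}"
    assume \<eta>: "\<eta> \<in> sphere 0 1 \<and> (\<forall>c\<in>{0<..<1}. \<forall>k\<ge>1. (\<phi> ^^ k) ` ellipsoid c \<eta> \<subseteq> ellipsoid c \<eta>)"
    show "\<eta> = \<zeta>"
    proof (rule invariant_point_unique[OF no_fix])
      show "\<phi> ` ellipsoid c \<eta> \<subseteq> ellipsoid c \<eta>" if "0 < c" "c < 1" for c
      proof -
        have "(\<phi> ^^ 1) ` ellipsoid c \<eta> \<subseteq> ellipsoid c \<eta>"
          using \<eta> that order_refl[of "1::nat"] greaterThanLessThan_iff[of c 0 1] by blast
        then show ?thesis by simp
      qed
    qed (use \<eta> \<zeta> ellipsoid_invariant[OF \<zeta>] in \<open>auto simp: boundary_fixed_point_def\<close>)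
  qed
qed

end
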